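(* Let $A \subseteq \mathbb{R}$ be a finite set containing at least two elements, and let $d \geq 1$ be an integer. There exists a constant $m(A,d)$ (depending only on $A$ and $d$) such that the following holds. Define $$k(A,d) = d + \max_{1 \leq s \leq d} \left( \left\lfloor \frac{d}{s} \right\rfloor (W(A,s) - s) \right),$$ which is equal to $|A| d$ if $A$ is an arithmetic progression. If $k \geq k(A,d)$ is an integer then for any integer $n \geq 2k$, every $A$-valued degree $d$ function on $\binom{[n]}{k}$ is an $m(A,d)$-junta. Conversely, if $1 \leq k < k(A,d)$ then for every $m$ there exist $n \geq 2k$ and an $A$-valued degree $d$ function on $\binom{[n]}{k}$ which is not an $m$-junta.
   Context: For an integer $s \geq 1$, $W(A,s)$ is the minimal value $W$ such that every univariate real polynomial $P$ of degree at most $s$ satisfying $P(0), P(1), \ldots, P(W) \in A$ is constant. For integers $0 \leq k \leq n$, the slice is $\binom{[n]}{k} = \{x \in \{0,1\}^n : \sum_{i=1}^n x_i = k\}$. A function $f\colon \binom{[n]}{k} \to \mathbb{R}$ is $A$-valued if $f(x) \in A$ for all $x \in \binom{[n]}{k}$. It has degree $d$ (meaning degree at most $d$) if there is a real polynomial $P$ in $n$ variables of degree at most $d$ such that $f(x) = P(x_1,\ldots,x_n)$ for all $x \in \binom{[n]}{k}$. For $J \subseteq [n] = \{1,\ldots,n\}$, $f$ is a $J$-junta if there is a function $g\colon \{0,1\}^J \to \mathbb{R}$ such that $f(x) = g(x|_J)$ for all $x \in \binom{[n]}{k}$, where $x|_J$ is the restriction of $x$ to the coordinates in $J$. $f$ is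 an $m$-junta if it is a $J$-junta for some $J$ of size at most $m$. *)

theory Defs
  imports
    Complex_Main
    "HOL-Library.FuncSet"
    "HOL-Library.Poly_Mapping"
    "HOL-Computational_Algebra.Polynomial"
begin

text \<open>For finite \<open>A\<close> the set whose least element is taken is nonempty: it contains
  \<open>card A * s\<close>, since a polynomial taking one value more than \<open>s\<close> times is constant.\<close>

definition W :: "real set \<Rightarrow> nat \<Rightarrow> nat" where
  "W A s = (LEAST w. \<forall>P :: real poly.
     degree P \<le> s \<and> (\<forall>i\<le>w. poly P (real i) \<in> A) \<longrightarrow> (\<exists>c. P = [:c:]))"

definition k_bound :: "real set \<Rightarrow> nat \<Rightarrow> int" where
  "k_bound A d = int d + (MAX s\<in>{1..d}. int (d div s) * (int (W A s) - int s))"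

definition arithmetic_progression :: "real set \<Rightarrow> bool" where
  "arithmetic_progression A \<longleftrightarrow>
     (\<exists>a b l. b \<noteq> 0 \<and> A = (\<lambda>i. a + real i * b) ` {..<l})"

text \<open>Points of the cube are functions on \<open>{1..n}\<close>, set to \<open>undefined\<close> outside of it.\<close>

definition slice :: "nat \<Rightarrow> nat \<Rightarrow> (nat \<Rightarrow> nat) set" where
  "slice n k = {x \<in> {1..n} \<rightarrow>\<^sub>E {0, 1}. (\<Sum>i=1..n. x i) = k}"

definition valued_on_slice :: "nat \<Rightarrow> nat \<Rightarrow> real set \<Rightarrow> ((nat \<Rightarrow> nat) \<Rightarrow> real) \<Rightarrow> bool" where
  "valued_on_slice n k A f \<longleftrightarrow> (\<forall>x\<in>slice n k. f x \<in> A)"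

text \<open>A multivariate real polynomial is a finitely supported map from monomials to
  coefficients, a monomial being a finitely supported map from variable indices to exponents.\<close>

type_synonym mpolynomial = "(nat \<Rightarrow>\<^sub>0 nat) \<Rightarrow>\<^sub>0 real"

definition in_variables :: "nat set \<Rightarrow> mpolynomial \<Rightarrow> bool" where
  "in_variables V P \<longleftrightarrow> (\<forall>m\<in>Poly_Mapping.keys P. Poly_Mapping.keys m \<subseteq> V)"

definition total_degree_at_most :: "nat \<Rightarrow> mpolynomial \<Rightarrow> bool" where
  "total_degree_at_most d P \<longleftrightarrow>
     (\<forall>m\<in>Poly_Mapping.keys P. (\<Sum>i\<in>Poly_Mapping.keys m. Poly_Mapping.lookup m i) \<le> d)"

definition evaluate :: "mpolynomial \<Rightarrow> (nat \<Rightarrow> real) \<Rightarrow> real" where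
  "evaluate P x = (\<Sum>m\<in>Poly_Mapping.keys P. Poly_Mapping.lookup P m *
     (\<Prod>i\<in>Poly_Mapping.keys m. x i ^ Poly_Mapping.lookup m i))"

definition has_degree_on_slice :: "nat \<Rightarrow> nat \<Rightarrow> nat \<Rightarrow> ((nat \<Rightarrow> nat) \<Rightarrow> real) \<Rightarrow> bool" where
  "has_degree_on_slice n k d f \<longleftrightarrow>
     (\<exists>P. in_variables {1..n} P \<and> total_degree_at_most d P \<and>
        (\<forall>x\<in>slice n k. f x = evaluate P (\<lambda>i. real (x i))))"

definition set_junta_on_slice :: "nat \<Rightarrow> nat \<Rightarrow> nat set \<Rightarrow> ((nat \<Rightarrow> nat) \<Rightarrow> real) \<Rightarrow> bool" where
  "set_junta_on_slice n k J f \<longleftrightarrow>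
     (\<exists>g :: (nat \<Rightarrow> nat) \<Rightarrow> real. \<forall>x\<in>slice n k. f x = g (restrict x J))"

definition junta_on_slice :: "nat \<Rightarrow> nat \<Rightarrow> nat \<Rightarrow> ((nat \<Rightarrow> nat) \<Rightarrow> real) \<Rightarrow> bool" where
  "junta_on_slice n k m f \<longleftrightarrow> (\<exists>J\<subseteq>{1..n}. card J \<le> m \<and> set_junta_on_slice n k J f)"

end

theory Submission
  imports Defs "HOL-Library.Ramsey" "HOL-Library.Disjoint_Sets"
begin

text \<open>
  A function on the slice of weight \<open>k\<close> is treated as a function \<open>F\<close> of \<open>k\<close>-element sets. It is a junta
  as soon as few disjoint pairs \<open>a\<close>, \<open>b\<close> are \<^emph>\<open>sensitive\<close>, meaning that swapping \<open>a\<close> for \<open>b\<close> can change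
  \<open>F\<close>: the members of a maximal family of disjoint sensitive pairs are the coordinates that matter
  (\<open>junta_if_few_sensitive_pairs\<close>). So above the threshold a bound on the number of disjoint sensitive
  pairs is needed that is independent of \<open>n\<close> and \<open>k\<close>.

  \<^item> A sensitive pair stays sensitive when a coordinate is fixed to one, with fewer than \<open>d\<close> exceptions
    (\<open>few_desensitizing_coordinates\<close>). Fixing coordinates one after another therefore reduces to the
    weight \<open>K\<close> that equals the threshold, and \<open>n\<close> may be taken huge compared with \<open>K\<close>.

  \<^item> By Ramsey's theorem some \<open>K\<close> coordinates outside the witnesses of sensitivity are
    interchangeable. They serve as a reserve: filling up a set of at most \<open>K\<close> elements from the reserve
    extends \<open>F\<close> from the slice to the ball of all sets with at most \<open>K\<close> elements
    (\<open>ball_extension\<close>). On the ball a function of degree \<open>d\<close> is a unique multilinear polynomial, whose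
    coefficients \<open>c S\<close> vanish for \<open>card S > d\<close>, and many disjoint sensitive pairs force many nonzero
    coefficients.

  \<^item> If there were many sets \<open>S\<close> with \<open>c S \<noteq> 0\<close>, they would contain a large sunflower, with a
    core \<open>Z\<close> and petals of size \<open>b\<close>. Choose \<open>b\<close> minimal and then \<open>Z\<close> minimal. After another use of
    Ramsey's theorem, setting the core to one and turning on \<open>j\<close> petals gives a value \<open>Q(j)\<close> that
    depends on \<open>j\<close> only. Minimality of \<open>b\<close> excludes nonzero coefficients that use a proper part of a
    petal, and minimality of \<open>Z\<close> those that omit a point of the core. Hence \<open>Q\<close> is a nonconstant
    polynomial, of degree at most \<open>s = (d - card Z) div b\<close>, and it takes values in \<open>A\<close> as long as
    \<open>card Z + b * j \<le> K\<close>. The definition of \<open>W A s\<close> gives \<open>K < card Z + b * W A s\<close>, which the formula for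
    the threshold contradicts (\<open>no_large_bouquet_step\<close>, \<open>k_bound_blocks\<close>).

  Below the threshold the same picture is read backwards. Take \<open>s\<close> attaining the maximum, a
  nonconstant polynomial \<open>P\<close> of degree at most \<open>s\<close> with \<open>P(0), \<dots>, P(W A s - 1)\<close> in \<open>A\<close>, disjoint blocks of
  \<open>d div s\<close> coordinates and \<open>r = d mod s\<close> further coordinates. The function that is \<open>P\<close> of the number of
  full blocks when all \<open>r\<close> coordinates are one, and \<open>P(0)\<close> otherwise, has degree at most \<open>d\<close>, and the
  weight is too small for \<open>W A s\<close> full blocks (\<open>non_juntas_from_polynomial\<close>).
\<close>

section \<open>Pigeonhole, sunflowers and Ramsey's theorem\<close>

lemma pigeonhole_fibre:
  assumes "finite S" "finite R" "\<phi> ` S \<subseteq> R" "card S > q * card R"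
  shows "\<exists>y\<in>R. card {x\<in>S. \<phi> x = y} > q"
proof (rule ccontr)
  assume "\<not> ?thesis"
  then have le: "card {x\<in>S. \<phi> x = y} \<le> q" if "y \<in> R" for y
    using that by (meson not_less)
  have "S = (\<Union>y\<in>R. {x\<in>S. \<phi> x = y})"
    using assms(3) by auto
  then have "card S \<le> (\<Sum>y\<in>R. card {x\<in>S. \<phi> x = y})"
    using card_UN_le[OF assms(2), of "\<lambda>y. {x\<in>S. \<phi> x = y}"] by simp
  also have "\<dots> \<le> (\<Sum>y\<in>R. q)"
    by (intro sum_mono le)
  finally show False
    using assms(4) by (simp add: mult.commute)
qed

lemma maximal_disjoint_subfamily:
  assumes "finite \<F>"
  obtains \<G> where "\<G> \<subseteq> \<F>" "disjoint \<G>"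
    "\<And>S. S \<in> \<F> \<Longrightarrow> S \<noteq> {} \<Longrightarrow> S \<inter> \<Union>\<G> \<noteq> {}"
proof -
  have "finite {\<G>. \<G> \<subseteq> \<F> \<and> disjoint \<G>}" "{} \<in> {\<G>. \<G> \<subseteq> \<F> \<and> disjoint \<G>}"
    using assms by (auto simp: disjoint_def)
  then obtain \<G> where "\<G> \<in> {\<G>. \<G> \<subseteq> \<F> \<and> disjoint \<G>}"
    and "\<forall>\<G>' \<in> {\<G>. \<G> \<subseteq> \<F> \<and> disjoint \<G>}. \<G> \<subseteq> \<G>' \<longrightarrow> \<G> = \<G>'"
    using finite_has_maximal[of "{\<G>. \<G> \<subseteq> \<F> \<and> disjoint \<G>}"] by blast
  then have G: "\<G> \<subseteq> \<F>" "disjoint \<G>"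
    and max: "\<And>\<G>'. \<G>' \<subseteq> \<F> \<Longrightarrow> disjoint \<G>' \<Longrightarrow> \<G> \<subseteq> \<G>' \<Longrightarrow> \<G> = \<G>'"
    by simp_all
  have "S \<inter> \<Union>\<G> \<noteq> {}" if "S \<in> \<F>" "S \<noteq> {}" for S
  proof
    assume disj: "S \<inter> \<Union>\<G> = {}"
    then have "disjoint (insert S \<G>)"
      using G(2) by (auto simp: disjoint_def)
    then have "S \<in> \<G>"
      using max[of "insert S \<G>"] G(1) that(1) by blast
    then show False
      using disj that(2) by blast
  qed
  with G show thesis
    using that by blast
qed

text \<open>
  The petals \<open>PP\<close> surround the core \<open>Z\<close>. A common petal size \<open>b\<close> is demanded because the petals become
  the blocks of variables of a symmetric polynomial.
\<close>

definition sunflower :: "nat \<Rightarrow> 'a set set \<Rightarrow> bool" where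
  "sunflower N \<F> \<longleftrightarrow> (\<exists>Z PP b. b \<ge> 1 \<and> card PP = N \<and> disjoint PP \<and>
     (\<forall>P\<in>PP. card P = b \<and> P \<inter> Z = {} \<and> Z \<union> P \<in> \<F>))"

lemma sunflower_mono:
  assumes "sunflower N \<F>" "\<F> \<subseteq> \<F>'"
  shows "sunflower N \<F>'"
proof -
  obtain Z PP b where "b \<ge> 1" "card PP = N" "disjoint PP"
    and "\<forall>P\<in>PP. card P = b \<and> P \<inter> Z = {} \<and> Z \<union> P \<in> \<F>"
    using assms(1) unfolding sunflower_def by (elim exE conjE)
  then show ?thesis
    unfolding sunflower_def using assms(2)
    by (intro exI[of _ Z] exI[of _ PP] exI[of _ b] conjI ballI) auto
qed

text \<open>
  Either a maximal disjoint subfamily already has \<open>N\<close> members and forms a sunflower with empty core, or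
  its union is a small set that meets every member. In the second case one of its points lies in many
  members; it joins the core, and the members without it have one element less.
\<close>

lemma uniform_sunflower:
  "\<exists>M. \<forall>\<F> :: 'a set set. finite \<F> \<and> (\<forall>S\<in>\<F>. finite S \<and> card S = e) \<and> card \<F> \<ge> M \<longrightarrow>
     sunflower N \<F>"
proof (induction e)
  case 0
  have "card \<F> < 2" if "finite \<F>" "\<forall>S\<in>\<F>. finite S \<and> card S = 0" for \<F> :: "'a set set"
  proof -
    have "\<F> \<subseteq> {{}}"
      using that by auto
    then show ?thesis
      using card_mono[of "{{}}" \<F>] by simp
  qed
  then show ?case
    by (intro exI[of _ 2]) (metis not_less)
next
  case (Suc e)
  then obtain M where M: "\<And>\<F> :: 'a set set. finite \<F> \<Longrightarrow> \<forall>S\<in>\<F>. finite S \<and> card S = e \<Longrightarrow>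
      card \<F> \<ge> M \<Longrightarrow> sunflower N \<F>"
    by meson
  have "sunflower N \<F>"
    if fin: "finite \<F>" and size: "\<forall>S\<in>\<F>. finite S \<and> card S = Suc e"
      and big: "card \<F> \<ge> Suc (M * (N * Suc e))" for \<F> :: "'a set set"
  proof -
    obtain \<G> where G: "\<G> \<subseteq> \<F>" "disjoint \<G>"
      and hit: "\<And>S. S \<in> \<F> \<Longrightarrow> S \<noteq> {} \<Longrightarrow> S \<inter> \<Union>\<G> \<noteq> {}"
      using maximal_disjoint_subfamily[OF fin] by metis
    have finG: "finite \<G>"
      using G(1) fin finite_subset by blast
    show ?thesis
    proof (cases "card \<G> \<ge> N")
      case True
      then obtain PP where PP: "PP \<subseteq> \<G>" "card PP = N"
        by (meson obtain_subset_with_card_n)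
      have "disjoint PP"
        using G(2) PP(1) by (meson pairwise_subset)
      then show ?thesis
        unfolding sunflower_def using PP G(1) size by (intro exI[of _ "{}"] exI[of _ PP] exI[of _ "Suc e"]) auto
    next
      case False
      define H where "H = \<Union>\<G>"
      have finH: "finite H"
        unfolding H_def using finG G(1) size by blast
      have "card H \<le> (\<Sum>S\<in>\<G>. card S)"
        unfolding H_def using card_Union_le_sum_card by blast
      also have "\<dots> = card \<G> * Suc e"
        using G(1) size by (simp add: subset_iff)
      also have "\<dots> \<le> N * Suc e"
        using False by (intro mult_le_mono1) simp
      finally have cH: "card H \<le> N * Suc e" .
      define h where "h S = (SOME x. x \<in> S \<inter> H)" for S
      have h: "h S \<in> S \<inter> H" if "S \<in> \<F>" for S
      proof -
        have "S \<noteq> {}"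
          using size that by auto
        then show ?thesis
          unfolding h_def H_def using hit[OF that] by (metis someI_ex ex_in_conv)
      qed
      have "card \<F> > M * card H"
        using big mult_le_mono2[OF cH, of M] by linarith
      then obtain x where x: "x \<in> H" "card {S\<in>\<F>. h S = x} > M"
        using pigeonhole_fibre[of \<F> H h M] fin finH h by blast
      define \<F>' where "\<F>' = (\<lambda>S. S - {x}) ` {S\<in>\<F>. h S = x}"
      have mem: "x \<in> S" if "S \<in> \<F>" "h S = x" for S
        using h[OF that(1)] that(2) by blast
      have "inj_on (\<lambda>S. S - {x}) {S\<in>\<F>. h S = x}"
        using mem by (intro inj_onI) (metis (mono_tags, lifting) insert_Diff mem_Collect_eq)
      then have card': "card \<F>' \<ge> M"
        unfolding \<F>'_def using x(2) by (simp add: card_image)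
      have "\<forall>S\<in>\<F>'. finite S \<and> card S = e"
        unfolding \<F>'_def using mem size by auto
      moreover have "finite \<F>'"
        unfolding \<F>'_def using fin by simp
      ultimately obtain Z PP b where ZP: "b \<ge> 1" "card PP = N" "disjoint PP"
        "\<forall>P\<in>PP. card P = b \<and> P \<inter> Z = {} \<and> Z \<union> P \<in> \<F>'"
        using M card' unfolding sunflower_def by meson
      have "P \<inter> insert x Z = {} \<and> insert x Z \<union> P \<in> \<F>" if "P \<in> PP" for P
      proof -
        obtain S where S: "S \<in> \<F>" "h S = x" "Z \<union> P = S - {x}"
          using ZP(4) \<open>P \<in> PP\<close> unfolding \<F>'_def by blast
        then have "insert x Z \<union> P = S"
          using mem[of S] by blast
        then show ?thesis
          using S ZP(4) \<open>P \<in> PP\<close> by blast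
      qed
      then show ?thesis
        unfolding sunflower_def using ZP by (intro exI[of _ "insert x Z"] exI[of _ PP] exI[of _ b]) auto
    qed
  qed
  then show ?case
    by blast
qed

lemma sunflower_exists:
  "\<exists>M. \<forall>\<F> :: 'a set set. finite \<F> \<and> (\<forall>S\<in>\<F>. finite S \<and> card S \<le> d) \<and> card \<F> \<ge> M \<longrightarrow>
     sunflower N \<F>"
proof -
  have "\<forall>e. \<exists>M. \<forall>\<F> :: 'a set set. finite \<F> \<and> (\<forall>S\<in>\<F>. finite S \<and> card S = e) \<and>
      card \<F> \<ge> M \<longrightarrow> sunflower N \<F>"
    by (rule allI) (rule uniform_sunflower)
  from choice[OF this] obtain M where M: "\<forall>e. \<forall>\<F> :: 'a set set. finite \<F> \<and>
      (\<forall>S\<in>\<F>. finite S \<and> card S = e) \<and> card \<F> \<ge> M e \<longrightarrow> sunflower N \<F>" ..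
  define q where "q = (\<Sum>e\<le>d. M e)"
  have "sunflower N \<F>"
    if fin: "finite \<F>" and size: "\<forall>S\<in>\<F>. finite S \<and> card S \<le> d"
      and big: "card \<F> \<ge> Suc (q * Suc d)" for \<F> :: "'a set set"
  proof -
    have "card ` \<F> \<subseteq> {..d}"
      using size by auto
    then obtain e where e: "e \<le> d" "card {S\<in>\<F>. card S = e} > q"
      using pigeonhole_fibre[of \<F> "{..d}" card q] fin big by (auto simp del: mult_Suc_right)
    have "M e \<le> q"
      unfolding q_def using e(1) by (intro member_le_sum) auto
    then have "sunflower N {S\<in>\<F>. card S = e}"
      using M[rule_format, of "{S\<in>\<F>. card S = e}" e] e fin size by simp
    then show ?thesis
      by (rule sunflower_mono) simp
  qed
  then show ?thesis
    by blast
qed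

lemma ramsey_one_size:
  "\<exists>M. \<forall>(V :: 'a set) (\<chi> :: 'a set \<Rightarrow> nat). finite V \<and> card V \<ge> M \<and>
     (\<forall>T\<subseteq>V. card T = r \<longrightarrow> \<chi> T < C) \<longrightarrow>
     (\<exists>H\<subseteq>V. card H = N \<and> (\<forall>T T'. T \<subseteq> H \<and> T' \<subseteq> H \<and> card T = r \<and> card T' = r \<longrightarrow> \<chi> T = \<chi> T'))"
proof -
  obtain M :: nat where M: "partn_lst {..<M} (replicate C N) r"
    using ramsey_full[of "replicate C N" r] ..
  have "\<exists>H\<subseteq>V. card H = N \<and> (\<forall>T T'. T \<subseteq> H \<and> T' \<subseteq> H \<and> card T = r \<and> card T' = r \<longrightarrow> \<chi> T = \<chi> T')"
    if fin: "finite V" and big: "card V \<ge> M" and col: "\<forall>T\<subseteq>V. card T = r \<longrightarrow> \<chi> T < C"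
    for V :: "'a set" and \<chi> :: "'a set \<Rightarrow> nat"
  proof -
    obtain h where h: "inj_on h {..<M}" "h ` {..<M} \<subseteq> V"
      using card_le_inj[of "{..<M}" V] fin big by auto
    have card_h: "card (h ` U) = card U" if "U \<subseteq> {..<M}" for U
      using h(1) that card_image inj_on_subset by metis
    have col': "(\<lambda>U. \<chi> (h ` U)) \<in> nsets {..<M} r \<rightarrow> {..<length (replicate C N)}"
    proof
      fix U assume "U \<in> nsets {..<M} r"
      then have "U \<subseteq> {..<M}" "card U = r"
        by (auto simp: nsets_def)
      then have "h ` U \<subseteq> V" "card (h ` U) = r"
        using h(2) card_h by auto
      then show "\<chi> (h ` U) \<in> {..<length (replicate C N)}"
        using col by simp
    qed
    from M[unfolded partn_lst_def, rule_format, OF col']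
    obtain i where i: "i < C" "monochromatic {..<M} (replicate C N ! i) r (\<lambda>U. \<chi> (h ` U)) i"
      by auto
    then obtain H where H: "H \<in> nsets {..<M} N"
        and mono: "(\<lambda>U. \<chi> (h ` U)) ` nsets H r \<subseteq> {i}"
      unfolding monochromatic_def using List.nth_replicate[OF i(1)] by auto
    have Hsub: "H \<subseteq> {..<M}" "finite H" "card H = N"
      using H by (auto simp: nsets_def)
    have "\<chi> T = i" if "T \<subseteq> h ` H" "card T = r" for T
    proof -
      have "\<exists>U. U \<subseteq> H \<and> T = h ` U"
        using that(1) by (simp add: subset_image_iff)
      then obtain U where U: "U \<subseteq> H" "T = h ` U"
        by (elim exE conjE)
      then have "U \<in> nsets H r"
        using that(2) card_h[of U] Hsub finite_subset[of U H] by (auto simp: nsets_def)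
      then show ?thesis
        using mono U(2) by blast
    qed
    moreover have "h ` H \<subseteq> V" "card (h ` H) = N"
      using h(2) Hsub card_h[of H] by auto
    ultimately show ?thesis
      by (intro exI[of _ "h ` H"]) simp
  qed
  then show ?thesis
    by blast
qed

definition homogeneous :: "nat \<Rightarrow> ('a set \<Rightarrow> 'c) \<Rightarrow> 'a set \<Rightarrow> bool" where
  "homogeneous L \<chi> H \<longleftrightarrow>
     (\<forall>T T'. T \<subseteq> H \<longrightarrow> T' \<subseteq> H \<longrightarrow> card T = card T' \<longrightarrow> card T \<le> L \<longrightarrow> \<chi> T = \<chi> T')"

text \<open>
  Ramsey's theorem is applied to one size after another, each time inside the homogeneous set
  obtained before.
\<close>

lemma ramsey_all_sizes:
  "\<exists>M. \<forall>(V :: 'a set) (\<chi> :: 'a set \<Rightarrow> nat). finite V \<and> card V \<ge> M \<and>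
     (\<forall>T\<subseteq>V. card T \<le> L \<longrightarrow> \<chi> T < C) \<longrightarrow> (\<exists>H\<subseteq>V. card H = N \<and> homogeneous L \<chi> H)"
proof (induction L)
  case 0
  have "\<exists>H\<subseteq>V. card H = N \<and> homogeneous 0 \<chi> H"
    if fin: "finite V" and big: "card V \<ge> N" for V :: "'a set" and \<chi> :: "'a set \<Rightarrow> nat"
  proof -
    obtain H where H: "H \<subseteq> V" "card H = N"
      using big by (meson obtain_subset_with_card_n)
    have "finite H"
      using H(1) fin finite_subset by blast
    then have "T = {}" if "T \<subseteq> H" "card T = 0" for T
      using that finite_subset[of T H] by simp
    then have "\<chi> T = \<chi> T'" if "T \<subseteq> H" "T' \<subseteq> H" "card T = card T'" "card T \<le> 0" for T T'
      using that by (metis le_zero_eq)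
    then have "homogeneous 0 \<chi> H"
      unfolding homogeneous_def by blast
    then show ?thesis
      using H by blast
  qed
  then show ?case
    by (intro exI[of _ N]) simp
next
  case (Suc L)
  then obtain M where M: "\<forall>(V :: 'a set) (\<chi> :: 'a set \<Rightarrow> nat). finite V \<and> card V \<ge> M \<and>
     (\<forall>T\<subseteq>V. card T \<le> L \<longrightarrow> \<chi> T < C) \<longrightarrow> (\<exists>H\<subseteq>V. card H = N \<and> homogeneous L \<chi> H)" ..
  obtain M' where M': "\<forall>(V :: 'a set) (\<chi> :: 'a set \<Rightarrow> nat). finite V \<and> card V \<ge> M' \<and>
     (\<forall>T\<subseteq>V. card T = Suc L \<longrightarrow> \<chi> T < C) \<longrightarrow>
     (\<exists>H\<subseteq>V. card H = M \<and>
        (\<forall>T T'. T \<subseteq> H \<and> T' \<subseteq> H \<and> card T = Suc L \<and> card T' = Suc L \<longrightarrow> \<chi> T = \<chi> T'))"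
    using ramsey_one_size[where ?'a='a and r="Suc L" and C=C and N=M] ..
  have "\<exists>H\<subseteq>V. card H = N \<and> homogeneous (Suc L) \<chi> H"
    if fin: "finite V" and big: "card V \<ge> M'" and col: "\<forall>T\<subseteq>V. card T \<le> Suc L \<longrightarrow> \<chi> T < C"
    for V :: "'a set" and \<chi> :: "'a set \<Rightarrow> nat"
  proof -
    have "\<exists>H\<subseteq>V. card H = M \<and>
        (\<forall>T T'. T \<subseteq> H \<and> T' \<subseteq> H \<and> card T = Suc L \<and> card T' = Suc L \<longrightarrow> \<chi> T = \<chi> T')"
      using fin big col by (intro M'[rule_format]) simp
    then obtain H where H: "H \<subseteq> V" "card H = M" and top: "\<forall>T T'. T \<subseteq> H \<and> T' \<subseteq> H \<and>
        card T = Suc L \<and> card T' = Suc L \<longrightarrow> \<chi> T = \<chi> T'"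
      by (elim exE conjE)
    have "\<chi> T < C" if "T \<subseteq> H" "card T \<le> L" for T
      using col that H(1) by auto
    moreover have "finite H"
      using H(1) fin finite_subset by blast
    ultimately have "\<exists>H'\<subseteq>H. card H' = N \<and> homogeneous L \<chi> H'"
      using H(2) by (intro M[rule_format]) simp
    then obtain H' where H': "H' \<subseteq> H" "card H' = N" and low: "homogeneous L \<chi> H'"
      by (elim exE conjE)
    have "\<chi> T = \<chi> T'" if "T \<subseteq> H'" "T' \<subseteq> H'" "card T = card T'" "card T \<le> Suc L" for T T'
    proof (cases "card T \<le> L")
      case True
      then show ?thesis
        using low[unfolded homogeneous_def, rule_format, OF that(1-3)] by simp
    next
      case False
      moreover have "T \<subseteq> H" "T' \<subseteq> H"
        using that H'(1) by auto
      ultimately show ?thesis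
        using top that by simp
    qed
    then have "homogeneous (Suc L) \<chi> H'"
      unfolding homogeneous_def by blast
    then show ?thesis
      using H H' by (intro exI[of _ H'] conjI) auto
  qed
  then show ?case
    by (intro exI[of _ M']) simp
qed

lemma ramsey_finite_palette:
  "\<exists>M. \<forall>(V :: 'a set) (\<chi> :: 'a set \<Rightarrow> 'c) D. finite V \<and> card V \<ge> M \<and> finite D \<and> card D \<le> C \<and>
     (\<forall>T\<subseteq>V. card T \<le> L \<longrightarrow> \<chi> T \<in> D) \<longrightarrow> (\<exists>H\<subseteq>V. card H = N \<and> homogeneous L \<chi> H)"
proof -
  obtain M where M: "\<forall>(V :: 'a set) (\<chi> :: 'a set \<Rightarrow> nat). finite V \<and> card V \<ge> M \<and>
     (\<forall>T\<subseteq>V. card T \<le> L \<longrightarrow> \<chi> T < C) \<longrightarrow> (\<exists>H\<subseteq>V. card H = N \<and> homogeneous L \<chi> H)"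
    using ramsey_all_sizes[where ?'a='a and L=L and C=C and N=N] ..
  have "\<exists>H\<subseteq>V. card H = N \<and> homogeneous L \<chi> H"
    if fin: "finite V" and big: "card V \<ge> M" and D: "finite D" "card D \<le> C"
      and col: "\<forall>T\<subseteq>V. card T \<le> L \<longrightarrow> \<chi> T \<in> D"
    for V :: "'a set" and \<chi> :: "'a set \<Rightarrow> 'c" and D
  proof -
    obtain h :: "'c \<Rightarrow> nat" where h: "inj_on h D" "h ` D \<subseteq> {..<C}"
      using card_le_inj[of D "{..<C}"] D by auto
    have "\<forall>T\<subseteq>V. card T \<le> L \<longrightarrow> h (\<chi> T) < C"
      using col h(2) by blast
    then have "\<exists>H\<subseteq>V. card H = N \<and> homogeneous L (\<lambda>T. h (\<chi> T)) H"
      using fin big by (intro M[rule_format]) simp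
    then obtain H where H: "H \<subseteq> V" "card H = N" and hom: "homogeneous L (\<lambda>T. h (\<chi> T)) H"
      by (elim exE conjE)
    have "\<chi> T = \<chi> T'" if "T \<subseteq> H" "T' \<subseteq> H" "card T = card T'" "card T \<le> L" for T T'
    proof -
      have "\<chi> T \<in> D" "\<chi> T' \<in> D"
        using col that H(1) by auto
      moreover have "h (\<chi> T) = h (\<chi> T')"
        using hom[unfolded homogeneous_def, rule_format, OF that] .
      ultimately show ?thesis
        using h(1) by (meson inj_onD)
    qed
    then have "homogeneous L \<chi> H"
      unfolding homogeneous_def by blast
    then show ?thesis
      using H by blast
  qed
  then show ?thesis
    by (intro exI[of _ M] allI impI) (elim conjE exE, blast)
qed

text \<open>
  Deleting the marked element maps the \<open>r\<close>-subsets to the \<open>(r - 1)\<close>-subsets, and the former outnumber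
  the latter by a factor \<open>(n - r + 1) / r\<close> with \<open>n = card PP\<close>. So some rest \<open>R\<close> is
  left by many marked elements.
\<close>

lemma fixed_link:
  assumes fin: "finite PP" and r: "r \<ge> 1" and p: "\<And>T. T \<subseteq> PP \<Longrightarrow> card T = r \<Longrightarrow> p T \<in> T"
    and big: "card PP \<ge> r * (q + 2)"
  shows "\<exists>R\<subseteq>PP. card R = r - 1 \<and> card {P\<in>PP - R. p (insert P R) = P} > q"
proof -
  define n where "n = card PP"
  obtain k where k: "r = Suc k"
    using r by (cases r) auto
  have nk: "n \<ge> r * (q + 1) + k"
    using big k by (simp add: n_def algebra_simps)
  have "Suc k * (n choose Suc k) = (n - k) * (n choose k)"
    using binomial_absorption[of k n] binomial_absorb_comp[of n k] by simp
  moreover have "(n - k) * (n choose k) \<ge> (Suc k * (q + 1)) * (n choose k)"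
    using nk k by (intro mult_le_mono1) simp
  ultimately have "Suc k * (n choose Suc k) \<ge> Suc k * ((q + 1) * (n choose k))"
    by (simp only: mult.assoc)
  then have "n choose Suc k \<ge> (q + 1) * (n choose k)"
    by (simp only: Suc_mult_le_cancel1)
  moreover have "n choose k > 0"
    using nk by simp
  ultimately have count: "card (nsets PP r) > q * card (nsets PP k)"
    unfolding card_nsets k n_def[symmetric] by (simp only: distrib_right mult_1)
  have finT: "finite T" if "T \<in> nsets PP r" for T
    using that by (simp add: nsets_def)
  have "(\<lambda>T. T - {p T}) ` nsets PP r \<subseteq> nsets PP k"
    using p k by (fastforce simp: nsets_def)
  then obtain R where R: "R \<in> nsets PP k" "card {T\<in>nsets PP r. T - {p T} = R} > q"
    using pigeonhole_fibre[OF _ _ _ count, of "\<lambda>T. T - {p T}"] fin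
    by (auto simp: finite_imp_finite_nsets)
  let ?S = "{T\<in>nsets PP r. T - {p T} = R}"
  have ins: "T = insert (p T) R \<and> p T \<in> PP - R" if "T \<in> ?S" for T
    using that p[of T] by (auto simp: nsets_def)
  have "inj_on p ?S"
    using ins by (metis (no_types, lifting) inj_onI)
  then have "card ?S = card (p ` ?S)"
    by (simp add: card_image)
  also have "p ` ?S \<subseteq> {P\<in>PP - R. p (insert P R) = P}"
  proof
    fix P assume "P \<in> p ` ?S"
    then obtain T where T: "T \<in> ?S" "P = p T"
      by blast
    have "p (insert (p T) R) = p T"
      using ins[OF T(1)] by metis
    then show "P \<in> {P\<in>PP - R. p (insert P R) = P}"
      using ins[OF T(1)] T(2) by blast
  qed
  then have "card (p ` ?S) \<le> card {P\<in>PP - R. p (insert P R) = P}"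
    using fin by (intro card_mono) auto
  finally show ?thesis
    using R k by (intro exI[of _ R]) (auto simp: nsets_def)
qed

section \<open>Polynomials on a ball\<close>

text \<open>
  The family \<open>c\<close> lists the coefficients of a multilinear polynomial in the variables \<open>X\<close>, and \<open>sum c (Pow T)\<close> is
  its value at the indicator of \<open>T\<close>. The values in the ball of radius \<open>K\<close> determine the coefficients of all
  sets of size at most \<open>K\<close>.
\<close>

definition ball_valued :: "real set \<Rightarrow> nat \<Rightarrow> nat \<Rightarrow> 'a set \<Rightarrow> ('a set \<Rightarrow> real) \<Rightarrow> bool" where
  "ball_valued A K d X c \<longleftrightarrow> finite X \<and> (\<forall>S\<subseteq>X. card S > d \<longrightarrow> c S = 0) \<and>
     (\<forall>T\<subseteq>X. card T \<le> K \<longrightarrow> sum c (Pow T) \<in> A)"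

section \<open>Polynomials in the binomial basis and the numbers W\<close>

definition binomial_poly :: "nat \<Rightarrow> real poly" where
  "binomial_poly r = smult (1 / fact r) (\<Prod>i<r. [:- real i, 1:])"

lemma poly_binomial_poly: "poly (binomial_poly r) (real j) = real (j choose r)"
proof -
  have "poly (binomial_poly r) (real j) = (\<Prod>i<r. real j - real i) / fact r"
    by (simp add: binomial_poly_def poly_prod)
  also have "\<dots> = real j gchoose r"
    by (simp add: gbinomial_prod_rev atLeast0LessThan)
  finally show ?thesis
    by (simp add: binomial_gbinomial)
qed

lemma degree_binomial_poly: "degree (binomial_poly r) = r"
  by (simp add: binomial_poly_def degree_prod_sum_eq)

lemma poly_constI:
  assumes "degree (P :: real poly) < card S" "\<And>x. x \<in> S \<Longrightarrow> poly P x = c"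
  shows "P = [:c:]"
proof (rule ccontr)
  assume ne: "P \<noteq> [:c:]"
  have "S \<subseteq> {x. poly (P - [:c:]) x = 0}"
    using assms(2) by auto
  moreover have "finite {x. poly (P - [:c:]) x = 0}"
    using ne by (intro poly_roots_finite) simp
  ultimately have "card S \<le> card {x. poly (P - [:c:]) x = 0}"
    by (intro card_mono)
  also have "\<dots> \<le> degree (P - [:c:])"
    using ne by (intro card_poly_roots_bound) simp
  also have "\<dots> \<le> degree P"
    by (rule degree_diff_le) auto
  finally show False
    using assms(1) by simp
qed

text \<open>
  Some value is taken more than \<open>s\<close> times.
\<close>

lemma constant_if_many_values:
  assumes "finite A" "degree P \<le> s" "\<And>i. i \<le> s * card A \<Longrightarrow> poly P (real i) \<in> A"
  shows "\<exists>c. P = [:c:]"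
proof -
  have "(\<lambda>i. poly P (real i)) ` {..s * card A} \<subseteq> A"
    using assms(3) by auto
  then obtain y where y: "y \<in> A" "card {i\<in>{..s * card A}. poly P (real i) = y} > s"
    using pigeonhole_fibre[of "{..s * card A}" A "\<lambda>i. poly P (real i)" s] assms(1) by auto
  have "card (real ` {i\<in>{..s * card A}. poly P (real i) = y}) > s"
    using y(2) by (simp add: card_image)
  then have "P = [:y:]"
    using assms(2) by (intro poly_constI[where S="real ` {i\<in>{..s * card A}. poly P (real i) = y}"]) auto
  then show ?thesis ..
qed

lemma W_constant:
  assumes "finite A" "degree P \<le> s" "\<And>i. i \<le> W A s \<Longrightarrow> poly P (real i) \<in> A"
  shows "\<exists>c. P = [:c:]"
proof -
  have "\<forall>P :: real poly. degree P \<le> s \<and> (\<forall>i\<le>W A s. poly P (real i) \<in> A) \<longrightarrow> (\<exists>c. P = [:c:])"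
    unfolding W_def by (rule LeastI[where k="s * card A"]) (use constant_if_many_values assms(1) in blast)
  then show ?thesis
    using assms by blast
qed

lemma W_le: "finite A \<Longrightarrow> W A s \<le> s * card A"
  unfolding W_def by (rule Least_le) (use constant_if_many_values in blast)

lemma W_greater_if_nonconstant:
  assumes "finite A" "degree P \<le> s" "\<And>i. i \<le> w \<Longrightarrow> poly P (real i) \<in> A" "\<nexists>c. P = [:c:]"
  shows "w < W A s"
proof (rule ccontr)
  assume "\<not> w < W A s"
  then have "\<And>i. i \<le> W A s \<Longrightarrow> poly P (real i) \<in> A"
    using assms(3) by simp
  then show False
    using W_constant[OF assms(1,2)] assms(4) by blast
qed

lemma W_attained:
  assumes "W A s > 0"
  obtains P where "degree P \<le> s" "\<And>i. i < W A s \<Longrightarrow> poly P (real i) \<in> A" "\<nexists>c. P = [:c:]"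
proof -
  have "\<not> (\<forall>P :: real poly. degree P \<le> s \<and> (\<forall>i\<le>W A s - 1. poly P (real i) \<in> A) \<longrightarrow> (\<exists>c. P = [:c:]))"
    using assms unfolding W_def by (intro not_less_Least) simp
  then obtain P :: "real poly" where P: "degree P \<le> s" "\<forall>i\<le>W A s - 1. poly P (real i) \<in> A" "\<nexists>c. P = [:c:]"
    by blast
  show thesis
    by (rule that[of P]) (use P assms in auto)
qed

text \<open>
  The polynomial \<open>a + (b - a) * (X choose s)\<close> takes the value \<open>a\<close> at \<open>0, \<dots>, s - 1\<close> and \<open>b\<close> at \<open>s\<close>.
\<close>

lemma W_greater:
  assumes "finite A" "card A \<ge> 2" "s \<ge> 1"
  shows "s < W A s"
proof -
  obtain a b where ab: "a \<in> A" "b \<in> A" "a \<noteq> b"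
    using assms(2) by (metis card_2_iff' obtain_subset_with_card_n subsetD)
  define P where "P = [:a:] + smult (b - a) (binomial_poly s)"
  have P: "poly P (real i) = a + (b - a) * real (i choose s)" for i
    by (simp add: P_def poly_binomial_poly)
  have "degree P \<le> s"
    unfolding P_def by (intro degree_add_le degree_smult_le[THEN order_trans]) (simp_all add: degree_binomial_poly)
  moreover have "poly P (real i) \<in> A" if "i \<le> s" for i
    using that ab by (cases "i = s") (simp_all add: P binomial_eq_0)
  moreover have "\<nexists>c. P = [:c:]"
  proof
    assume "\<exists>c. P = [:c:]"
    then have "poly P (real 0) = poly P (real s)"
      by auto
    then show False
      using ab assms(3) unfolding P by (simp add: binomial_eq_0)
  qed
  ultimately show ?thesis
    using W_greater_if_nonconstant[OF assms(1)] by blast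
qed

section \<open>Symmetric functions with values in a finite set\<close>

text \<open>
  The sums over power sets determine the coefficients by recursion on the size, and a bijection between
  two sets of the same size carries one recursion to the other.
\<close>

lemma symmetric_coefficients:
  fixes e :: "'b set \<Rightarrow> real"
  assumes fin: "finite H" and hom: "homogeneous L (\<lambda>T. sum e (Pow T)) H"
  shows "homogeneous L e H"
proof -
  have "\<forall>T T'. T \<subseteq> H \<longrightarrow> T' \<subseteq> H \<longrightarrow> card T = j \<longrightarrow> card T' = j \<longrightarrow> j \<le> L \<longrightarrow> e T = e T'" for j
  proof (induction j rule: less_induct)
    case (less j)
    show ?case
    proof (intro allI impI)
      fix T T' assume T: "T \<subseteq> H" "T' \<subseteq> H" "card T = j" "card T' = j" "j \<le> L"
      have finT: "finite T" "finite T'"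
        using T fin finite_subset by auto
      obtain h where h: "bij_betw h T T'"
        using finT T finite_same_card_bij by metis
      have bij: "bij_betw (\<lambda>U. h ` U) (Pow T) (Pow T')"
        using h by (rule bij_betw_Pow)
      have "h ` T = T'"
        using h by (simp add: bij_betw_def)
      then have bij': "bij_betw (\<lambda>U. h ` U) (Pow T - {T}) (Pow T' - {T'})"
        using bij by (intro bij_betw_DiffI) auto
      have "sum e (Pow T' - {T'}) = (\<Sum>U\<in>Pow T - {T}. e (h ` U))"
        using sum.reindex_bij_betw[OF bij', of e] by simp
      also have "\<dots> = sum e (Pow T - {T})"
      proof (rule sum.cong)
        fix U assume U: "U \<in> Pow T - {T}"
        have "inj_on h U"
          using U h unfolding bij_betw_def by (metis DiffD1 PowD inj_on_subset)
        then have "card (h ` U) = card U"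
          by (rule card_image)
        moreover have "card U < j"
          using U finT(1) T(3) psubset_card_mono[of T U] by auto
        moreover have "h ` U \<subseteq> H" "U \<subseteq> H"
          using U T h by (auto simp: bij_betw_def)
        moreover have "card U \<le> L"
          using \<open>card U < j\<close> T(5) by simp
        ultimately show "e (h ` U) = e U"
          using less.IH[rule_format, of "card U" "h ` U" U] by blast
      qed simp
      finally have "sum e (Pow T - {T}) = sum e (Pow T' - {T'})" ..
      moreover have "sum e (Pow T) = sum e (Pow T')"
        using hom[unfolded homogeneous_def, rule_format, of T T'] T by simp
      moreover have "sum e (Pow T) = e T + sum e (Pow T - {T})"
        using finT(1) by (intro sum.remove) auto
      moreover have "sum e (Pow T') = e T' + sum e (Pow T' - {T'})"
        using finT(2) by (intro sum.remove) auto
      ultimately show "e T = e T'"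
        by simp
    qed
  qed
  then have "e T = e T'" if "T \<subseteq> H" "T' \<subseteq> H" "card T = card T'" "card T \<le> L" for T T'
    using that by metis
  then show ?thesis
    unfolding homogeneous_def by blast
qed

text \<open>
  If all sets of size \<open>r\<close> have the coefficient \<open>g r\<close>, the sum over the subsets of a \<open>j\<close>-element set is
  the sum of \<open>g r * (j choose r)\<close>, and \<open>j choose r\<close> is a polynomial of degree \<open>r\<close> in \<open>j\<close>.
\<close>

lemma symmetric_values_are_polynomial:
  fixes e :: "'b set \<Rightarrow> real"
  assumes fin: "finite H" and hom: "homogeneous L e H" and big: "card H \<ge> L"
    and deg: "\<And>T. T \<subseteq> H \<Longrightarrow> card T \<le> L \<Longrightarrow> card T > s \<Longrightarrow> e T = 0"
  obtains P where "degree P \<le> s"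
    "\<And>T. T \<subseteq> H \<Longrightarrow> card T \<le> L \<Longrightarrow> sum e (Pow T) = poly P (real (card T))"
proof -
  have "\<exists>T. T \<subseteq> H \<and> card T = r" if "r \<le> L" for r
    using that big by (meson le_trans obtain_subset_with_card_n)
  then obtain U where U: "\<And>r. r \<le> L \<Longrightarrow> U r \<subseteq> H \<and> card (U r) = r"
    by metis
  define g where "g r = (if r \<le> L then e (U r) else 0)" for r
  have e: "e T = g (card T)" if "T \<subseteq> H" "card T \<le> L" for T
  proof -
    have "e T = e (U (card T))"
      using hom[unfolded homogeneous_def, rule_format, of T "U (card T)"] U[of "card T"] that by simp
    then show ?thesis
      using that(2) by (simp add: g_def)
  qed
  have g0: "g r = 0" if "r > s" for r
    using deg[of "U r"] U[of r] that by (simp add: g_def)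
  define P where "P = (\<Sum>r\<le>s. smult (g r) (binomial_poly r))"
  have P: "poly P (real j) = (\<Sum>r\<le>s. g r * real (j choose r))" for j
    by (simp add: P_def poly_sum poly_binomial_poly)
  have "degree P \<le> s"
    unfolding P_def by (rule degree_sum_le)
      (auto intro: order_trans[OF degree_smult_le] simp: degree_binomial_poly)
  moreover have "sum e (Pow T) = poly P (real (card T))" if T: "T \<subseteq> H" "card T \<le> L" for T
  proof -
    have finT: "finite T"
      using T fin finite_subset by auto
    have "sum e (Pow T) = (\<Sum>V\<in>Pow T. g (card V))"
    proof (rule sum.cong)
      fix V assume "V \<in> Pow T"
      then show "e V = g (card V)"
        using T finT card_mono[of T V] by (intro e) auto
    qed simp
    also have "\<dots> = (\<Sum>r\<le>card T. \<Sum>V\<in>{V\<in>Pow T. card V = r}. g (card V))"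
      using finT by (intro sum.group[symmetric]) (auto intro: card_mono)
    also have "\<dots> = (\<Sum>r\<le>card T. g r * real (card T choose r))"
      using n_subsets[OF finT] by (intro sum.cong) (simp_all add: Pow_def)
    also have "\<dots> = (\<Sum>r\<le>s + card T. g r * real (card T choose r))"
      by (intro sum.mono_neutral_left) (auto simp: binomial_eq_0)
    also have "\<dots> = (\<Sum>r\<le>s. g r * real (card T choose r))"
      by (intro sum.mono_neutral_right) (auto simp: g0)
    finally show ?thesis
      by (simp add: P)
  qed
  ultimately show thesis
    using that by blast
qed

text \<open>
  This is the place where \<open>W\<close> enters: the common value on \<open>j\<close>-element sets is a polynomial in \<open>j\<close> of
  degree at most \<open>s\<close> with values in \<open>A\<close> at \<open>0, \<dots>, W A s\<close>, hence constant.
\<close>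

lemma symmetric_sums_in_A_trivial:
  fixes e :: "'b set \<Rightarrow> real"
  assumes A: "finite A" and fin: "finite H" and big: "card H \<ge> W A s"
    and hom: "homogeneous (W A s) (\<lambda>T. sum e (Pow T)) H"
    and val: "\<And>T. T \<subseteq> H \<Longrightarrow> card T \<le> W A s \<Longrightarrow> sum e (Pow T) \<in> A"
    and deg: "\<And>T. T \<subseteq> H \<Longrightarrow> card T \<le> W A s \<Longrightarrow> card T > s \<Longrightarrow> e T = 0"
    and T: "T \<subseteq> H" "1 \<le> card T" "card T \<le> W A s"
  shows "e T = 0"
proof -
  obtain P where P: "degree P \<le> s"
    "\<And>T. T \<subseteq> H \<Longrightarrow> card T \<le> W A s \<Longrightarrow> sum e (Pow T) = poly P (real (card T))"
    using symmetric_values_are_polynomial[OF fin symmetric_coefficients[OF fin hom] big deg] by blast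
  have "poly P (real i) \<in> A" if i: "i \<le> W A s" for i
  proof -
    obtain U where U: "U \<subseteq> H" "card U = i"
      using i big by (meson le_trans obtain_subset_with_card_n)
    then show ?thesis
      using P(2)[of U] val[of U] i by simp
  qed
  then obtain k where "P = [:k:]"
    using W_constant[OF A P(1)] by blast
  then have const: "sum e (Pow T) = k" if "T \<subseteq> H" "card T \<le> W A s" for T
    using P(2)[OF that] by simp
  have "T \<subseteq> H \<longrightarrow> 1 \<le> card T \<longrightarrow> card T \<le> W A s \<longrightarrow> e T = 0" for T
  proof (induction "card T" arbitrary: T rule: less_induct)
    case less
    show ?case
    proof (intro impI)
      assume T: "T \<subseteq> H" "1 \<le> card T" "card T \<le> W A s"
      have finT: "finite T"
        using T fin finite_subset by auto
      have "e U = 0" if "U \<in> Pow T - {T} - {{}}" for U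
      proof -
        have "U \<subset> T" "U \<noteq> {}" "finite U"
          using that finT finite_subset by auto
        then have "card U < card T" "1 \<le> card U" "U \<subseteq> H"
          using finT T(1) psubset_card_mono by (auto simp: Suc_le_eq card_gt_0_iff)
        then show ?thesis
          using less[of U] T(3) by simp
      qed
      then have "sum e (Pow T - {T} - {{}}) = 0"
        by simp
      moreover have "sum e (Pow T) = e T + sum e (Pow T - {T})"
        using finT by (intro sum.remove) auto
      moreover have "sum e (Pow T - {T}) = e {} + sum e (Pow T - {T} - {{}})"
        using finT T(2) by (intro sum.remove) auto
      ultimately have "e T = sum e (Pow T) - sum e (Pow {})"
        by simp
      then show "e T = 0"
        using const[of T] const[of "{}"] T by simp
    qed
  qed
  then show ?thesis
    using T by blast
qed

section \<open>Bouquets of blocks around a core\<close>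

text \<open>
  The members of \<open>PP\<close> are disjoint blocks of variables around a core \<open>Z\<close>. For \<open>r = 1\<close> this is a
  sunflower in the support of \<open>c\<close>. Larger \<open>r\<close> are included so that a core of minimal size excludes every
  coefficient that joins several full blocks to a proper part of the core; the blocks other than one
  would otherwise have to be counted into the core.
\<close>

definition bouquet :: "('a set \<Rightarrow> real) \<Rightarrow> 'a set \<Rightarrow> 'a set \<Rightarrow> 'a set set \<Rightarrow> nat \<Rightarrow> nat \<Rightarrow> bool" where
  "bouquet c X Z PP b r \<longleftrightarrow> Z \<subseteq> X \<and> (\<forall>P\<in>PP. P \<subseteq> X \<and> card P = b \<and> P \<inter> Z = {}) \<and> disjoint PP \<and>
     1 \<le> r \<and> (\<forall>T\<subseteq>PP. card T = r \<longrightarrow> c (Z \<union> \<Union>T) \<noteq> 0)"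

lemma bouquetD:
  assumes "bouquet c X Z PP b r"
  shows "Z \<subseteq> X" "\<And>P. P \<in> PP \<Longrightarrow> P \<subseteq> X \<and> card P = b \<and> P \<inter> Z = {}" "disjoint PP" "1 \<le> r"
    "\<And>T. T \<subseteq> PP \<Longrightarrow> card T = r \<Longrightarrow> c (Z \<union> \<Union>T) \<noteq> 0"
proof -
  note * = assms[unfolded bouquet_def]
  show "Z \<subseteq> X" "disjoint PP" "1 \<le> r"
    using * by simp_all
  show "P \<subseteq> X \<and> card P = b \<and> P \<inter> Z = {}" if "P \<in> PP" for P
    using * that by simp
  show "c (Z \<union> \<Union>T) \<noteq> 0" if "T \<subseteq> PP" "card T = r" for T
    using * that by simp
qed

lemma card_blocks:
  assumes "bouquet c X Z PP b r" "finite X" "Y \<subseteq> Z" "T \<subseteq> PP"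
  shows "card (Y \<union> \<Union>T) = card Y + b * card T"
proof -
  have Z: "Z \<subseteq> X" and P: "\<And>P. P \<in> PP \<Longrightarrow> P \<subseteq> X \<and> card P = b \<and> P \<inter> Z = {}" and disj: "disjoint PP"
    by (fact bouquetD[OF assms(1)])+
  have TX: "P \<subseteq> X" if "P \<in> T" for P
    using P assms(4) that by auto
  have fin: "finite P" if "P \<in> T" for P
    using TX[OF that] assms(2) by (rule finite_subset)
  have "T \<subseteq> Pow X"
    using TX by auto
  then have "finite T"
    using assms(2) finite_subset[of T "Pow X"] by simp
  have "card (\<Union>T) = sum card T"
    using disj assms(4) fin by (intro card_Union_disjoint) (meson pairwise_subset)
  also have "\<dots> = (\<Sum>P\<in>T. b)"
    using P assms(4) by (intro sum.cong) auto
  finally have "card (\<Union>T) = b * card T"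
    by simp
  moreover have "finite Y"
    using Z assms(2,3) finite_subset by (metis subset_trans)
  moreover have "finite (\<Union>T)"
    using fin \<open>finite T\<close> by blast
  moreover have "Y \<inter> P = {}" if "P \<in> T" for P
  proof -
    have "P \<inter> Z = {}"
      using P[of P] that assms(4) by auto
    then show ?thesis
      using assms(3) by auto
  qed
  then have "Y \<inter> \<Union>T = {}"
    by auto
  ultimately show ?thesis
    by (simp add: card_Un_disjoint)
qed

text \<open>
  The coefficient family and its variables are not fixed: a bound on \<open>N\<close> has to hold for all
  polynomials of degree \<open>d\<close> at once. The condition \<open>r \<le> d\<close> guarantees that a bouquet of at least \<open>d\<close>
  blocks really has an \<open>r\<close>-element subfamily.
\<close>

definition has_bouquet :: "real set \<Rightarrow> nat \<Rightarrow> nat \<Rightarrow> nat \<Rightarrow> nat \<Rightarrow> nat \<Rightarrow> bool" where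
  "has_bouquet A K d N z b \<longleftrightarrow> (\<exists>(X :: nat set) c Z PP r. ball_valued A K d X c \<and>
     bouquet c X Z PP b r \<and> r \<le> d \<and> card Z = z \<and> card PP = N)"

lemma bouquet_subset: "bouquet c X Z PP b r \<Longrightarrow> H \<subseteq> PP \<Longrightarrow> bouquet c X Z H b r"
  unfolding bouquet_def using pairwise_subset[of disjnt PP H] by (elim conjE, intro conjI) blast+

lemma has_bouquet_antimono:
  assumes "has_bouquet A K d N z b" "N' \<le> N"
  shows "has_bouquet A K d N' z b"
proof -
  obtain X :: "nat set" and c Z PP r where *: "ball_valued A K d X c" "bouquet c X Z PP b r"
      "r \<le> d" "card Z = z" "card PP = N"
    using assms(1) unfolding has_bouquet_def by (elim exE conjE)
  obtain H where "H \<subseteq> PP" "card H = N'"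
    using * assms(2) by (metis obtain_subset_with_card_n)
  then show ?thesis
    unfolding has_bouquet_def using * bouquet_subset
    by (intro exI[of _ X] exI[of _ c] exI[of _ Z] exI[of _ H] exI[of _ r]) auto
qed

lemma uniform_bound:
  assumes "finite I" "\<And>i. i \<in> I \<Longrightarrow> \<exists>N::nat. \<not> Q N i"
    and anti: "\<And>i N N'. Q N i \<Longrightarrow> N' \<le> N \<Longrightarrow> Q N' i"
  shows "\<exists>N. \<forall>i\<in>I. \<not> Q N i"
proof -
  obtain f where f: "\<And>i. i \<in> I \<Longrightarrow> \<not> Q (f i) i"
    using assms(2) by metis
  have "\<not> Q (sum f I) i" if "i \<in> I" for i
    using f[OF that] anti[of "sum f I" i "f i"] member_le_sum[of i I f] that assms(1) by auto
  then show ?thesis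
    by blast
qed

definition splits_block :: "('a set \<Rightarrow> real) \<Rightarrow> 'a set \<Rightarrow> 'a set set \<Rightarrow> bool" where
  "splits_block c Z T \<longleftrightarrow> (\<exists>Y S P. Y \<subseteq> Z \<and> S \<subseteq> \<Union>T \<and> P \<in> T \<and> S \<inter> P \<noteq> {} \<and> S \<inter> P \<noteq> P \<and> c (Y \<union> S) \<noteq> 0)"

text \<open>
  Every \<open>r\<close>-element family \<open>T\<close> of blocks has a nonzero coefficient that meets one block of \<open>T\<close> in a proper
  part. Mark that block. By \<open>fixed_link\<close> many marked blocks are completed by the same \<open>r - 1\<close> blocks \<open>R\<close>;
  among them, many leave the same remainder inside \<open>Z\<close> and \<open>R\<close> and have parts of the same size. This
  remainder is the core, and the parts are the blocks, of a bouquet with smaller blocks.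
\<close>

lemma smaller_blocks:
  fixes X :: "nat set"
  assumes ball: "ball_valued A K d X c" and bq: "bouquet c X Z H b r0"
    and r: "1 \<le> r" and d: "1 \<le> d"
    and q: "q \<ge> N * (2 ^ (card Z + b * (r - 1)) * b)" and big: "card H \<ge> r * (q + 2)"
    and split: "\<And>T. T \<subseteq> H \<Longrightarrow> card T = r \<Longrightarrow> splits_block c Z T"
  shows "\<exists>b' z'. 1 \<le> b' \<and> b' < b \<and> z' \<le> d \<and> has_bouquet A K d N z' b'"
proof -
  have finX: "finite X"
    using ball unfolding ball_valued_def by simp
  have Z: "Z \<subseteq> X" and P: "\<And>P. P \<in> H \<Longrightarrow> P \<subseteq> X \<and> card P = b \<and> P \<inter> Z = {}" and disj: "disjoint H"
    by (fact bouquetD[OF bq])+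
  have finH: "finite H"
    using P finX finite_subset[of H "Pow X"] by blast
  have "\<exists>Y S P. T \<subseteq> H \<and> card T = r \<longrightarrow>
      Y \<subseteq> Z \<and> S \<subseteq> \<Union>T \<and> P \<in> T \<and> S \<inter> P \<noteq> {} \<and> S \<inter> P \<noteq> P \<and> c (Y \<union> S) \<noteq> 0" for T
  proof (cases "T \<subseteq> H \<and> card T = r")
    case True
    then show ?thesis
      using split[of T, unfolded splits_block_def] by simp
  qed blast
  then obtain Y S p where YSp: "\<And>T. T \<subseteq> H \<Longrightarrow> card T = r \<Longrightarrow> Y T \<subseteq> Z \<and> S T \<subseteq> \<Union>T \<and> p T \<in> T \<and>
      S T \<inter> p T \<noteq> {} \<and> S T \<inter> p T \<noteq> p T \<and> c (Y T \<union> S T) \<noteq> 0"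
    by metis
  obtain R where R: "R \<subseteq> H" "card R = r - 1" and link: "card {P\<in>H - R. p (insert P R) = P} > q"
    using fixed_link[OF finH r, of p q] YSp big by blast
  define Q where "Q = {P\<in>H - R. p (insert P R) = P}"
  have finR: "finite R"
    using R(1) finH finite_subset by auto
  have T: "insert P R \<subseteq> H" "card (insert P R) = r" if "P \<in> Q" for P
    using that R finR r unfolding Q_def by auto
  define part where "part P = S (insert P R) \<inter> P" for P
  define rest where "rest P = Y (insert P R) \<union> S (insert P R) - P" for P
  have part: "part P \<subseteq> P" "part P \<noteq> {}" "part P \<noteq> P" and rest: "rest P \<subseteq> Z \<union> \<Union>R" "rest P \<inter> P = {}"
    and nz: "c (rest P \<union> part P) \<noteq> 0" and PH: "P \<in> H" if "P \<in> Q" for P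
  proof -
    have *: "Y (insert P R) \<subseteq> Z \<and> S (insert P R) \<subseteq> \<Union>(insert P R) \<and>
      S (insert P R) \<inter> P \<noteq> {} \<and> S (insert P R) \<inter> P \<noteq> P \<and> c (Y (insert P R) \<union> S (insert P R)) \<noteq> 0"
      using YSp[OF T[OF that]] that unfolding Q_def by simp
    show "P \<in> H"
      using that by (simp add: Q_def)
    then have "P \<inter> Z = {}"
      using P by blast
    then have "rest P \<union> part P = Y (insert P R) \<union> S (insert P R)"
      using * unfolding rest_def part_def by blast
    then show "c (rest P \<union> part P) \<noteq> 0"
      using * by simp
    show "part P \<subseteq> P" "part P \<noteq> {}" "part P \<noteq> P" "rest P \<subseteq> Z \<union> \<Union>R" "rest P \<inter> P = {}"
      using * unfolding rest_def part_def by auto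
  qed
  have finU: "finite (Z \<union> \<Union>R)"
    using Z P R(1) finX by (meson Sup_subset_mono Un_least Union_least finite_subset subset_iff)
  have card_part: "1 \<le> card (part P)" "card (part P) < b" if "P \<in> Q" for P
  proof -
    have "finite P" "card P = b"
      using P[OF PH[OF that]] finX finite_subset by auto
    then show "card (part P) < b"
      using psubset_card_mono[of P "part P"] part[OF that] by auto
    show "1 \<le> card (part P)"
      using part[OF that] \<open>finite P\<close> finite_subset by (metis card_0_eq less_one not_le)
  qed
  have "card (Z \<union> \<Union>R) = card Z + b * (r - 1)"
    using card_blocks[OF bq finX order_refl R(1)] R(2) by simp
  then have "card (Pow (Z \<union> \<Union>R) \<times> {1..<b}) = 2 ^ (card Z + b * (r - 1)) * (b - 1)"
    using finU by (simp add: card_cartesian_product card_Pow)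
  also have "\<dots> \<le> 2 ^ (card Z + b * (r - 1)) * b"
    by simp
  finally have "N * card (Pow (Z \<union> \<Union>R) \<times> {1..<b}) \<le> N * (2 ^ (card Z + b * (r - 1)) * b)"
    by (rule mult_le_mono2)
  then have "N * card (Pow (Z \<union> \<Union>R) \<times> {1..<b}) < card Q"
    using q link unfolding Q_def by linarith
  moreover have "(\<lambda>P. (rest P, card (part P))) ` Q \<subseteq> Pow (Z \<union> \<Union>R) \<times> {1..<b}"
    using rest card_part by fastforce
  moreover have "finite Q"
    using finH by (simp add: Q_def)
  ultimately obtain Z' b' where Zb: "b' \<in> {1..<b}"
    and large: "card {P\<in>Q. (rest P, card (part P)) = (Z', b')} > N"
    using pigeonhole_fibre[of Q "Pow (Z \<union> \<Union>R) \<times> {1..<b}" "\<lambda>P. (rest P, card (part P))" N] finU by auto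
  let ?Q = "{P\<in>Q. (rest P, card (part P)) = (Z', b')}"
  have "inj_on part ?Q"
  proof (rule inj_onI)
    fix P P' assume PP': "P \<in> ?Q" "P' \<in> ?Q" "part P = part P'"
    then have "P \<inter> P' \<noteq> {}"
      using part[of P] part[of P'] by blast
    then show "P = P'"
      using disj PH PP'(1,2) unfolding disjoint_def by blast
  qed
  then have card_img: "card (part ` ?Q) > N"
    using large by (simp add: card_image)
  have "bouquet c X Z' (part ` ?Q) b' 1"
    unfolding bouquet_def
  proof (intro conjI ballI allI impI)
    obtain P where P0: "P \<in> ?Q"
      using large by (metis (no_types, lifting) card.empty equals0I not_less_zero)
    have "\<Union>R \<subseteq> X"
      using P R(1) by blast
    then show "Z' \<subseteq> X"
      using P0 rest[of P] Z by blast
    show "disjoint (part ` ?Q)"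
      unfolding disjoint_def
    proof (intro ballI impI)
      fix B B' assume B: "B \<in> part ` ?Q" "B' \<in> part ` ?Q" "B \<noteq> B'"
      then obtain P P' where P: "P \<in> Q" "P' \<in> Q" "B = part P" "B' = part P'"
        by blast
      then have "P \<noteq> P'"
        using B(3) by auto
      then have "P \<inter> P' = {}"
        by (rule disjointD[OF disj PH[OF P(1)] PH[OF P(2)]])
      then show "B \<inter> B' = {}"
        using part(1)[OF P(1)] part(1)[OF P(2)] unfolding P(3,4) by auto
    qed
    fix B assume "B \<in> part ` ?Q"
    then obtain P' where "P' \<in> ?Q" "B = part P'"
      by blast
    then show "B \<subseteq> X" "card B = b'" "B \<inter> Z' = {}"
      using part(1)[of P'] rest(2)[of P'] P[OF PH, of P'] by auto
  next
    fix T assume T: "T \<subseteq> part ` ?Q" "card T = 1"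
    obtain B where B: "T = {B}"
      using T(2) by (rule card_1_singletonE)
    then have "B \<in> part ` ?Q"
      using T(1) by simp
    then obtain P where "P \<in> Q" "rest P = Z'" "B = part P"
      by auto
    then show "c (Z' \<union> \<Union>T) \<noteq> 0"
      using nz[of P] B by simp
  qed simp
  moreover have "card Z' \<le> d"
  proof -
    obtain P0 where P0: "P0 \<in> ?Q"
      using large by (metis (no_types, lifting) card.empty equals0I not_less_zero)
    have P0Q: "P0 \<in> Q" "rest P0 = Z'"
      using P0 by auto
    have "\<Union>R \<subseteq> X"
      using P R(1) by blast
    then have "rest P0 \<subseteq> X"
      using rest(1)[OF P0Q(1)] Z by blast
    moreover have "part P0 \<subseteq> X"
      using part(1)[OF P0Q(1)] P[OF PH[OF P0Q(1)]] by blast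
    ultimately have sub: "rest P0 \<union> part P0 \<subseteq> X"
      by simp
    have "card (rest P0 \<union> part P0) \<le> d"
      using ball[unfolded ball_valued_def] sub nz[OF P0Q(1)] by (meson not_less)
    moreover have "finite (rest P0 \<union> part P0)"
      using sub finX by (rule finite_subset)
    ultimately show ?thesis
      using P0Q(2) card_mono[of "rest P0 \<union> part P0" "rest P0"] by simp
  qed
  ultimately have "has_bouquet A K d (card (part ` ?Q)) (card Z') b'"
    unfolding has_bouquet_def using ball d
    by (intro exI[of _ X] exI[of _ c] exI[of _ Z'] exI[of _ "part ` ?Q"] exI[of _ 1]) simp
  then have "has_bouquet A K d N (card Z') b'"
    using card_img by (rule has_bouquet_antimono[OF _ less_imp_le])
  then show ?thesis
    using Zb \<open>card Z' \<le> d\<close> by auto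
qed

text \<open>
  A set of variables with nonzero coefficient either lies in the core or meets some block. In the second
  case it meets the blocks in a union of full blocks by \<open>nosplit\<close>, and contains the core by \<open>low\<close>.
\<close>

lemma sum_over_core_and_blocks:
  fixes c :: "'a set \<Rightarrow> real"
  assumes bq: "bouquet c X Z PP b r" and finX: "finite X" and T: "T \<subseteq> PP" and b: "b \<ge> 1"
    and nosplit: "\<And>Y S P. Y \<subseteq> Z \<Longrightarrow> S \<subseteq> \<Union>T \<Longrightarrow> P \<in> T \<Longrightarrow> S \<inter> P \<noteq> {} \<Longrightarrow> S \<inter> P \<noteq> P \<Longrightarrow> c (Y \<union> S) = 0"
    and low: "\<And>Y U. Y \<subset> Z \<Longrightarrow> U \<subseteq> T \<Longrightarrow> U \<noteq> {} \<Longrightarrow> c (Y \<union> \<Union>U) = 0"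
  shows "sum c (Pow (Z \<union> \<Union>T)) = (\<Sum>U\<in>Pow T. if U = {} then sum c (Pow Z) else c (Z \<union> \<Union>U))"
proof -
  have P: "P \<subseteq> X" "card P = b" "P \<inter> Z = {}" if "P \<in> T" for P
    using bouquetD(2)[OF bq, of P] T that by auto
  have disj: "disjoint T"
    using bouquetD(3)[OF bq] T by (rule pairwise_subset)
  have "T \<subseteq> Pow X"
    using P by auto
  then have finT: "finite T"
    using finX finite_subset by auto
  have "Z \<union> \<Union>T \<subseteq> X"
    using bouquetD(1)[OF bq] P(1) by auto
  then have fin: "finite (Z \<union> \<Union>T)"
    using finX finite_subset by auto
  have ne: "P \<noteq> {}" if "P \<in> T" for P
    using P(2)[OF that] b by auto
  let ?B = "(\<lambda>U. Z \<union> \<Union>U) ` (Pow T - {{}})"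
  have inj: "inj_on (\<lambda>U. Z \<union> \<Union>U) (Pow T - {{}})"
  proof (rule inj_onI)
    fix U U' assume U: "U \<in> Pow T - {{}}" "U' \<in> Pow T - {{}}" and eq: "Z \<union> \<Union>U = Z \<union> \<Union>U'"
    have "P \<in> V'" if "P \<in> V" "V \<subseteq> T" "V' \<subseteq> T" "Z \<union> \<Union>V = Z \<union> \<Union>V'" for P V V'
    proof -
      have PT: "P \<in> T"
        using that by auto
      obtain x where x: "x \<in> P"
        using ne[OF PT] by auto
      then have "x \<in> Z \<union> \<Union>V'"
        using that(1,4) by blast
      moreover have "x \<notin> Z"
        using P(3)[OF PT] x by auto
      ultimately obtain P' where P': "P' \<in> V'" "x \<in> P'"
        by auto
      have "P = P'"
        using disjointD[OF disj PT, of P'] P' that(3) x by blast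
      then show ?thesis
        using P'(1) by simp
    qed
    from this[of _ U U'] this[of _ U' U] show "U = U'"
      using U eq by auto
  qed
  have "c S = 0" if "S \<in> Pow (Z \<union> \<Union>T) - (Pow Z \<union> ?B)" for S
  proof -
    define U where "U = {P\<in>T. S \<inter> P \<noteq> {}}"
    have S: "S = (S \<inter> Z) \<union> (S \<inter> \<Union>T)"
      using that by auto
    show ?thesis
    proof (cases "\<exists>P\<in>T. S \<inter> P \<noteq> {} \<and> S \<inter> P \<noteq> P")
      case True
      then obtain P0 where "P0 \<in> T" "S \<inter> P0 \<noteq> {}" "S \<inter> P0 \<noteq> P0"
        by auto
      then have "(S \<inter> \<Union>T) \<inter> P0 \<noteq> {}" "(S \<inter> \<Union>T) \<inter> P0 \<noteq> P0" "P0 \<in> T"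
        by auto
      then show ?thesis
        using nosplit[of "S \<inter> Z" "S \<inter> \<Union>T" P0] S by simp
    next
      case False
      then have full: "S \<inter> P = P" if "P \<in> U" for P
        using that unfolding U_def by auto
      have "S \<inter> \<Union>T = \<Union>U"
      proof
        show "S \<inter> \<Union>T \<subseteq> \<Union>U"
          unfolding U_def by auto
        show "\<Union>U \<subseteq> S \<inter> \<Union>T"
          using full unfolding U_def by fastforce
      qed
      then have SU: "S = (S \<inter> Z) \<union> \<Union>U"
        using S by simp
      have UT: "U \<subseteq> T"
        unfolding U_def by auto
      have "\<not> S \<subseteq> Z"
        using that by auto
      then have "U \<noteq> {}"
        using SU by auto
      moreover have "S \<inter> Z \<noteq> Z"
      proof
        assume "S \<inter> Z = Z"
        then have "S = Z \<union> \<Union>U"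
          using SU by simp
        then have "S \<in> ?B"
          using UT \<open>U \<noteq> {}\<close> by simp
        then show False
          using that by simp
      qed
      then have "S \<inter> Z \<subset> Z"
        by auto
      ultimately show ?thesis
        using low[of "S \<inter> Z" U] UT SU by simp
    qed
  qed
  then have "sum c (Pow (Z \<union> \<Union>T)) = sum c (Pow Z \<union> ?B)"
    using fin finT by (intro sum.mono_neutral_right) (simp, blast, blast)
  also have "\<dots> = sum c (Pow Z) + sum c ?B"
  proof (rule sum.union_disjoint)
    show "finite (Pow Z)" "finite ?B"
      using fin finT by auto
    have "\<not> Z \<union> \<Union>U \<subseteq> Z" if U: "U \<subseteq> T" "U \<noteq> {}" for U
    proof -
      obtain Q where Q: "Q \<in> U"
        using U(2) by auto
      then have "Q \<in> T"
        using U(1) by auto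
      then have "\<not> Q \<subseteq> Z"
        using P(3)[of Q] ne[of Q] by auto
      then show ?thesis
        using Q by auto
    qed
    then show "Pow Z \<inter> ?B = {}"
      by auto
  qed
  also have "sum c ?B = (\<Sum>U\<in>Pow T - {{}}. c (Z \<union> \<Union>U))"
    using sum.reindex[OF inj, of c] by simp
  also have "\<dots> = (\<Sum>U\<in>Pow T - {{}}. if U = {} then sum c (Pow Z) else c (Z \<union> \<Union>U))"
    by (intro sum.cong) auto
  also have "sum c (Pow Z) + \<dots> = (\<Sum>U\<in>Pow T. if U = {} then sum c (Pow Z) else c (Z \<union> \<Union>U))"
    using finT by (subst (2) sum.remove[of _ "{}"]) auto
  finally show ?thesis .
qed

text \<open>
  The induction step of the lexicographic induction on \<open>(b, z)\<close>. Families of blocks are coloured by the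
  value of the polynomial, by the parts \<open>Y\<close> of the core that have a nonzero coefficient with the full
  family, and by whether the family splits a block. On a homogeneous family the last colour cannot
  occur, since it gives smaller blocks, and a proper part \<open>Y\<close> cannot occur, since it is a smaller
  core. What is left is a symmetric polynomial in the blocks of degree at most \<open>(d - z) div b\<close>, and the
  hypothesis on \<open>K\<close> makes enough of its values available to conclude that it is constant. It is not,
  because its coefficients of degree \<open>r\<close> do not vanish.
\<close>

lemma no_large_bouquet_step:
  assumes A: "finite A" "card A \<ge> 2" and b: "b \<ge> 1"
    and K: "z + b \<le> d \<Longrightarrow> z + b * W A ((d - z) div b) \<le> K"
    and smaller_b: "\<And>b' z'. 1 \<le> b' \<Longrightarrow> b' < b \<Longrightarrow> \<exists>N. \<not> has_bouquet A K d N z' b'"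
    and smaller_z: "\<And>z'. z' < z \<Longrightarrow> \<exists>N. \<not> has_bouquet A K d N z' b"
  shows "\<exists>N. \<not> has_bouquet A K d N z b"
proof (cases "z + b \<le> d")
  case False
  have "\<not> has_bouquet A K d d z b"
  proof
    assume "has_bouquet A K d d z b"
    then obtain X :: "nat set" and c Z PP r where ball: "ball_valued A K d X c"
      and bq: "bouquet c X Z PP b r" and "r \<le> d" "card Z = z" "card PP = d"
      unfolding has_bouquet_def by (elim exE conjE)
    then obtain T where T: "T \<subseteq> PP" "card T = r"
      by (metis obtain_subset_with_card_n)
    have finX: "finite X"
      using ball unfolding ball_valued_def by simp
    have "Z \<union> \<Union>T \<subseteq> X"
      using bouquetD(1,2)[OF bq] T(1) by blast
    then have "card (Z \<union> \<Union>T) \<le> d"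
      using ball[unfolded ball_valued_def] bouquetD(5)[OF bq T] by (meson not_less)
    moreover have "card (Z \<union> \<Union>T) = z + b * r"
      using card_blocks[OF bq finX order_refl T(1)] T(2) \<open>card Z = z\<close> by simp
    moreover have "b * r \<ge> b"
      using bouquetD(4)[OF bq] by simp
    ultimately show False
      using False by simp
  qed
  then show ?thesis ..
next
  case zb: True
  define s where "s = (d - z) div b"
  define L where "L = W A s"
  have s: "s \<ge> 1"
    using zb b unfolding s_def by (simp add: Suc_le_eq div_greater_zero_iff)
  have sL: "s < L"
    unfolding L_def using A s by (rule W_greater)
  have KL: "z + b * L \<le> K"
    using K[OF zb] by (simp add: L_def s_def)
  \<comment> \<open>The lexicographically smaller pairs. Cores larger than \<open>d\<close> do not arise, since their coefficients vanish.\<close>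
  define I where "I = ({0..d} \<times> {1..<b}) \<union> ({0..<z} \<times> {b})"
  have "\<exists>N. \<forall>i\<in>I. \<not> has_bouquet A K d N (fst i) (snd i)"
  proof (rule uniform_bound)
    show "finite I"
      by (simp add: I_def)
    show "\<exists>N. \<not> has_bouquet A K d N (fst i) (snd i)" if "i \<in> I" for i
      using that smaller_b smaller_z unfolding I_def by auto
  qed (rule has_bouquet_antimono)
  then obtain N0 where N0: "\<And>i. i \<in> I \<Longrightarrow> \<not> has_bouquet A K d N0 (fst i) (snd i)"
    by blast
  define q where "q = N0 * (2 ^ (z + b * L) * b)"
  \<comment> \<open>The summand \<open>L * (q + 2)\<close> feeds \<open>fixed_link\<close>, and \<open>d\<close> and \<open>L\<close> provide subfamilies of these sizes.\<close>
  define N1 where "N1 = N0 + d + L + L * (q + 2)"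
  define C where "C = card A * (2 ^ 2 ^ z * 2)"
  obtain M where M: "\<forall>(V :: nat set set) (\<chi> :: nat set set \<Rightarrow> real \<times> nat set set \<times> bool) D.
     finite V \<and> card V \<ge> M \<and> finite D \<and> card D \<le> C \<and>
     (\<forall>T\<subseteq>V. card T \<le> L \<longrightarrow> \<chi> T \<in> D) \<longrightarrow> (\<exists>H\<subseteq>V. card H = N1 \<and> homogeneous L \<chi> H)"
    using ramsey_finite_palette[where C=C and L=L and N=N1] ..
  have "\<not> has_bouquet A K d M z b"
  proof
    assume "has_bouquet A K d M z b"
    then obtain X :: "nat set" and c Z PP r where ball: "ball_valued A K d X c"
      and bq: "bouquet c X Z PP b r" and r: "r \<le> d" and Z: "card Z = z" and PP: "card PP = M"
      unfolding has_bouquet_def by (elim exE conjE)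
    have finX: "finite X" and c0: "\<And>S. S \<subseteq> X \<Longrightarrow> d < card S \<Longrightarrow> c S = 0"
      and val: "\<And>T. T \<subseteq> X \<Longrightarrow> card T \<le> K \<Longrightarrow> sum c (Pow T) \<in> A"
      using ball unfolding ball_valued_def by simp_all
    have finZ: "finite Z"
      using bouquetD(1)[OF bq] finX by (rule finite_subset)
    have "PP \<subseteq> Pow X"
      using bouquetD(2)[OF bq] by auto
    then have finPP: "finite PP"
      using finX finite_subset by auto
    have sub: "Y \<union> \<Union>T \<subseteq> X" if "Y \<subseteq> Z" "T \<subseteq> PP" for Y T
      using that bouquetD(1)[OF bq] \<open>PP \<subseteq> Pow X\<close> by auto
    define \<chi> where "\<chi> T = (sum c (Pow (Z \<union> \<Union>T)), {Y\<in>Pow Z. c (Y \<union> \<Union>T) \<noteq> 0}, splits_block c Z T)" for T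
    define D where "D = A \<times> (Pow (Pow Z) \<times> (UNIV :: bool set))"
    have "finite D" "card D \<le> C"
      using A(1) finZ Z by (simp_all add: D_def C_def card_cartesian_product card_Pow)
    moreover have "\<chi> T \<in> D" if "T \<subseteq> PP" "card T \<le> L" for T
    proof -
      have "card (Z \<union> \<Union>T) = z + b * card T"
        using card_blocks[OF bq finX order_refl that(1)] Z by simp
      also have "\<dots> \<le> K"
        using KL mult_le_mono2[OF that(2), of b] by linarith
      finally have "sum c (Pow (Z \<union> \<Union>T)) \<in> A"
        using sub[OF order_refl that(1)] by (intro val)
      then show ?thesis
        unfolding D_def \<chi>_def by blast
    qed
    ultimately have "\<exists>H\<subseteq>PP. card H = N1 \<and> homogeneous L \<chi> H"
      using finPP PP by (intro M[rule_format, of PP D \<chi>]) simp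
    then obtain H where H: "H \<subseteq> PP" "card H = N1" and "homogeneous L \<chi> H"
      by (elim exE conjE)
    then have hom: "\<chi> T = \<chi> T'" if "T \<subseteq> H" "T' \<subseteq> H" "card T = card T'" "card T \<le> L" for T T'
      using that unfolding homogeneous_def by blast
    have bqH: "bouquet c X Z H b r"
      using bq H(1) by (rule bouquet_subset)
    have finH: "finite H"
      using H(1) finPP by (rule finite_subset)
    have nosplit: "\<not> splits_block c Z T" if T: "T \<subseteq> H" "card T \<le> L" for T
    proof
      assume split: "splits_block c Z T"
      then have "T \<noteq> {}"
        unfolding splits_block_def by auto
      then have T1: "1 \<le> card T"
        using T(1) finH finite_subset[of T H] by (simp add: Suc_le_eq card_gt_0_iff)
      have "splits_block c Z T'" if "T' \<subseteq> H" "card T' = card T" for T'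
        using hom[of T T'] T that split by (simp add: \<chi>_def)
      moreover have "N0 * (2 ^ (card Z + b * (card T - 1)) * b) \<le> q"
      proof -
        have "b * (card T - 1) \<le> b * L"
          using T(2) by (intro mult_le_mono2) simp
        then have "(2::nat) ^ (card Z + b * (card T - 1)) \<le> 2 ^ (z + b * L)"
          using Z by (intro power_increasing) simp_all
        then show ?thesis
          unfolding q_def by (intro mult_le_mono mult_le_mono1) simp_all
      qed
      moreover have "card T * (q + 2) \<le> card H"
        using mult_le_mono1[OF T(2), of "q + 2"] unfolding H(2) N1_def by linarith
      moreover have "1 \<le> d"
        using zb b by simp
      ultimately obtain b' z' where "1 \<le> b'" "b' < b" "z' \<le> d" "has_bouquet A K d N0 z' b'"
        using smaller_blocks[OF ball bqH T1] by blast
      then show False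
        using N0[of "(z', b')"] by (simp add: I_def)
    qed
    have low: "c (Y \<union> \<Union>T) = 0" if Y: "Y \<subset> Z" and T: "T \<subseteq> H" "1 \<le> card T" "card T \<le> L" for Y T
    proof (rule ccontr)
      assume nz: "c (Y \<union> \<Union>T) \<noteq> 0"
      have "c (Y \<union> \<Union>T') \<noteq> 0" if "T' \<subseteq> H" "card T' = card T" for T'
      proof -
        have "{Y\<in>Pow Z. c (Y \<union> \<Union>T) \<noteq> 0} = {Y\<in>Pow Z. c (Y \<union> \<Union>T') \<noteq> 0}"
          using hom[of T T'] T that by (simp add: \<chi>_def)
        moreover have "Y \<in> {Y\<in>Pow Z. c (Y \<union> \<Union>T) \<noteq> 0}"
          using Y nz by auto
        ultimately show ?thesis
          by auto
      qed
      moreover have "\<And>P. P \<in> H \<Longrightarrow> P \<subseteq> X \<and> card P = b \<and> P \<inter> Y = {}"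
        using bouquetD(2)[OF bqH] Y by blast
      moreover have "Y \<subseteq> X"
        using Y bouquetD(1)[OF bq] by auto
      ultimately have "bouquet c X Y H b (card T)"
        unfolding bouquet_def using T(2) bouquetD(3)[OF bqH] by simp
      moreover have "card T \<le> d"
      proof -
        have "card (Y \<union> \<Union>T) \<le> d"
          using nz c0[of "Y \<union> \<Union>T"] sub[of Y T] Y T(1) H(1) by (metis not_less psubset_imp_subset subset_trans)
        moreover have "card (Y \<union> \<Union>T) = card Y + b * card T"
          using card_blocks[OF bqH finX, of Y T] Y T(1) by auto
        moreover have "card T \<le> b * card T"
          using b by simp
        ultimately show ?thesis
          by linarith
      qed
      ultimately have "has_bouquet A K d N1 (card Y) b"
        unfolding has_bouquet_def using ball H(2)
        by (intro exI[of _ X] exI[of _ c] exI[of _ Y] exI[of _ H] exI[of _ "card T"]) simp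
      then have "has_bouquet A K d N0 (card Y) b"
        by (rule has_bouquet_antimono) (simp add: N1_def)
      moreover have "card Y < z"
        using psubset_card_mono[OF finZ Y] Z by simp
      ultimately show False
        using N0[of "(card Y, b)"] by (simp add: I_def)
    qed
    \<comment> \<open>The coefficients of the polynomial in the blocks; its constant term collects all coefficients inside the core.\<close>
    define e where "e U = (if U = {} then sum c (Pow Z) else c (Z \<union> \<Union>U))" for U
    have sum_e: "sum e (Pow T) = sum c (Pow (Z \<union> \<Union>T))" if T: "T \<subseteq> H" "card T \<le> L" for T
    proof -
      have finT: "finite T"
        using T(1) finH by (rule finite_subset)
      have "sum c (Pow (Z \<union> \<Union>T)) = (\<Sum>U\<in>Pow T. if U = {} then sum c (Pow Z) else c (Z \<union> \<Union>U))"
      proof (rule sum_over_core_and_blocks[OF bqH finX T(1) b])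
        fix Y S P assume "Y \<subseteq> Z" "S \<subseteq> \<Union>T" "P \<in> T" "S \<inter> P \<noteq> {}" "S \<inter> P \<noteq> P"
        then show "c (Y \<union> S) = 0"
          using nosplit[OF T] unfolding splits_block_def by blast
      next
        fix Y U assume YU: "Y \<subset> Z" "U \<subseteq> T" "U \<noteq> {}"
        have "finite U" "card U \<le> card T"
          using YU(2) finT finite_subset card_mono by auto
        then show "c (Y \<union> \<Union>U) = 0"
          using YU T by (intro low) (auto simp: Suc_le_eq card_gt_0_iff)
      qed
      then show ?thesis
        by (simp add: e_def)
    qed
    have homE: "homogeneous (W A s) (\<lambda>T. sum e (Pow T)) H"
      unfolding homogeneous_def L_def[symmetric]
    proof (intro allI impI)
      fix T T' assume T: "T \<subseteq> H" "T' \<subseteq> H" "card T = card T'" "card T \<le> L"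
      have "sum c (Pow (Z \<union> \<Union>T)) = sum c (Pow (Z \<union> \<Union>T'))"
        using hom[OF T] by (simp add: \<chi>_def)
      then show "sum e (Pow T) = sum e (Pow T')"
        using sum_e[of T] sum_e[of T'] T by simp
    qed
    have "r \<le> card H"
      using r H(2) by (simp add: N1_def)
    then obtain T where T: "T \<subseteq> H" "card T = r"
      by (metis obtain_subset_with_card_n)
    have size: "card (Z \<union> \<Union>U) = z + b * card U" if "U \<subseteq> H" for U
      using card_blocks[OF bqH finX order_refl that] Z by simp
    have zero: "c (Z \<union> \<Union>U) = 0" if U: "U \<subseteq> H" "s < card U" for U
    proof (rule c0)
      show "Z \<union> \<Union>U \<subseteq> X"
        by (rule sub[OF order_refl subset_trans[OF U(1) H(1)]])
      have "(d - z) < b * card U"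
        using U(2) b unfolding s_def by (metis div_less_iff_less_mult less_le_trans mult.commute zero_less_one)
      then show "d < card (Z \<union> \<Union>U)"
        using size[OF U(1)] by simp
    qed
    have "r \<le> s"
      using zero[OF T(1)] bouquetD(5)[OF bqH T] T(2) by (meson not_less)
    have "e T = 0"
    proof (rule symmetric_sums_in_A_trivial[OF A(1) finH _ homE])
      show "W A s \<le> card H"
        by (simp add: H(2) N1_def L_def)
      show "sum e (Pow T) \<in> A" if "T \<subseteq> H" "card T \<le> W A s" for T
      proof -
        have "card T \<le> L"
          using that(2) by (simp add: L_def)
        then have "card (Z \<union> \<Union>T) \<le> K"
          using size[OF that(1)] KL mult_le_mono2[of "card T" L b] by linarith
        then show ?thesis
          using sum_e[OF that(1) \<open>card T \<le> L\<close>] val sub[of Z T] that(1) H(1) by auto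
      qed
      show "e U = 0" if "U \<subseteq> H" "s < card U" for U
        using zero[OF that] that(2) by (auto simp: e_def)
      show "1 \<le> card T" "card T \<le> W A s" "T \<subseteq> H"
        using T \<open>r \<le> s\<close> sL bouquetD(4)[OF bq] by (simp_all add: L_def)
    qed
    moreover have "T \<noteq> {}"
      using T(2) bouquetD(4)[OF bq] by auto
    ultimately show False
      using bouquetD(5)[OF bqH T] by (simp add: e_def)
  qed
  then show ?thesis ..
qed

lemma no_large_bouquet:
  assumes A: "finite A" "card A \<ge> 2"
    and K: "\<And>z b. 1 \<le> b \<Longrightarrow> z + b \<le> d \<Longrightarrow> z + b * W A ((d - z) div b) \<le> K"
    and b: "1 \<le> b"
  shows "\<exists>N. \<not> has_bouquet A K d N z b"
  using b
proof (induction b arbitrary: z rule: less_induct)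
  case (less b)
  note IH = less.IH and b = less.prems
  show ?case
  proof (induction z rule: less_induct)
    case (less z)
    show ?case
      using no_large_bouquet_step[OF A b] K[OF b] IH less by blast
  qed
qed

text \<open>
  A large support contains a large sunflower, which is a bouquet with \<open>r = 1\<close>.
\<close>

lemma few_coefficients:
  assumes A: "finite A" "card A \<ge> 2" and d: "d \<ge> 1"
    and K: "\<And>z b. 1 \<le> b \<Longrightarrow> z + b \<le> d \<Longrightarrow> z + b * W A ((d - z) div b) \<le> K"
  shows "\<exists>M. \<forall>(X :: nat set) c. ball_valued A K d X c \<longrightarrow> card {S\<in>Pow X. c S \<noteq> 0} < M"
proof -
  define I where "I = {0..d} \<times> {1..d}"
  have "\<exists>N. \<forall>i\<in>I. \<not> has_bouquet A K d N (fst i) (snd i)"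
    by (rule uniform_bound) (use no_large_bouquet[OF A K] has_bouquet_antimono in \<open>auto simp: I_def\<close>)
  then obtain N where N: "\<And>i. i \<in> I \<Longrightarrow> \<not> has_bouquet A K d N (fst i) (snd i)"
    by blast
  obtain M where M: "\<forall>\<F> :: nat set set. finite \<F> \<and> (\<forall>S\<in>\<F>. finite S \<and> card S \<le> d) \<and> card \<F> \<ge> M \<longrightarrow> sunflower (Suc N) \<F>"
    using sunflower_exists[where ?'a=nat and d=d and N="Suc N"] ..
  have "card {S\<in>Pow X. c S \<noteq> 0} < M" if ball: "ball_valued A K d X c" for X :: "nat set" and c
  proof (rule ccontr)
    assume big: "\<not> card {S\<in>Pow X. c S \<noteq> 0} < M"
    let ?F = "{S\<in>Pow X. c S \<noteq> 0}"
    have finX: "finite X" and c0: "\<And>S. S \<subseteq> X \<Longrightarrow> d < card S \<Longrightarrow> c S = 0"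
      using ball unfolding ball_valued_def by simp_all
    have size: "finite S \<and> card S \<le> d" if "S \<in> ?F" for S
      using that c0[of S] finX finite_subset[of S X] by (auto simp: not_less[symmetric])
    then have "sunflower (Suc N) ?F"
      using big finX by (intro M[rule_format]) simp
    then obtain Z PP b where PP: "b \<ge> 1" "card PP = Suc N" "disjoint PP"
      and ZP: "\<forall>P\<in>PP. card P = b \<and> P \<inter> Z = {} \<and> Z \<union> P \<in> ?F"
      unfolding sunflower_def by (elim exE conjE)
    obtain P where P: "P \<in> PP"
      using PP(2) by (metis card.empty equals0I nat.distinct(1))
    have "Z \<union> P \<in> ?F" "card P = b"
      using ZP P by auto
    then have "Z \<subseteq> X" "card Z \<le> d" "b \<le> d"
      using size[of "Z \<union> P"] card_mono[of "Z \<union> P" Z] card_mono[of "Z \<union> P" P] by auto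
    have "bouquet c X Z PP b 1"
      unfolding bouquet_def
    proof (intro conjI ballI allI impI)
      fix T assume T: "T \<subseteq> PP" "card T = 1"
      obtain B where B: "T = {B}"
        using T(2) by (rule card_1_singletonE)
      then show "c (Z \<union> \<Union>T) \<noteq> 0"
        using ZP T(1) by simp
    qed (use ZP \<open>Z \<subseteq> X\<close> PP in auto)
    then have "has_bouquet A K d (Suc N) (card Z) b"
      unfolding has_bouquet_def using ball d PP(2)
      by (intro exI[of _ X] exI[of _ c] exI[of _ Z] exI[of _ PP] exI[of _ 1]) simp
    then have "has_bouquet A K d N (card Z) b"
      by (rule has_bouquet_antimono) simp
    then show False
      using N[of "(card Z, b)"] \<open>card Z \<le> d\<close> \<open>b \<le> d\<close> PP(1) by (simp add: I_def)
  qed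
  then show ?thesis
    by blast
qed

section \<open>Degree and sensitivity on a slice\<close>

text \<open>
  Swapping the elements of \<open>S\<close> independently for their partners under \<open>v\<close> embeds a cube of dimension \<open>card S\<close>
  in the slice, and the alternating sum over the cube is the top coefficient of the restriction to it.
  That it vanishes when the dimension exceeds \<open>d\<close> is all that the upper bound uses about degree.
\<close>

definition slice_degree :: "nat \<Rightarrow> nat set \<Rightarrow> nat \<Rightarrow> (nat set \<Rightarrow> real) \<Rightarrow> bool" where
  "slice_degree d V k F \<longleftrightarrow> (\<forall>S Q v. S \<subseteq> V \<longrightarrow> Q \<subseteq> V \<longrightarrow> v ` S \<subseteq> V \<longrightarrow> inj_on v S \<longrightarrow>
     S \<inter> Q = {} \<longrightarrow> v ` S \<inter> Q = {} \<longrightarrow> v ` S \<inter> S = {} \<longrightarrow> d < card S \<longrightarrow> card S + card Q = k \<longrightarrow>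
     (\<Sum>T\<in>Pow S. (-1) ^ card T * F (Q \<union> T \<union> v ` (S - T))) = 0)"

definition sensitive :: "nat set \<Rightarrow> nat \<Rightarrow> (nat set \<Rightarrow> real) \<Rightarrow> nat \<Rightarrow> nat \<Rightarrow> bool" where
  "sensitive V k F a b \<longleftrightarrow> a \<in> V \<and> b \<in> V \<and> a \<noteq> b \<and>
     (\<exists>x. x \<subseteq> V - {a, b} \<and> card x + 1 = k \<and> F (insert a x) \<noteq> F (insert b x))"

definition matching :: "(nat \<times> nat) set \<Rightarrow> bool" where
  "matching E \<longleftrightarrow> (\<forall>p\<in>E. \<forall>q\<in>E. p \<noteq> q \<longrightarrow> {fst p, snd p} \<inter> {fst q, snd q} = {})"

lemma slice_degreeD:
  assumes "slice_degree d V k F" "S \<subseteq> V" "Q \<subseteq> V" "v ` S \<subseteq> V" "inj_on v S"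
    "S \<inter> Q = {}" "v ` S \<inter> Q = {}" "v ` S \<inter> S = {}" "d < card S" "card S + card Q = k"
  shows "(\<Sum>T\<in>Pow S. (-1) ^ card T * F (Q \<union> T \<union> v ` (S - T))) = 0"
  by (rule assms(1)[unfolded slice_degree_def, rule_format, OF assms(2-)])

lemma sum_Pow_insert:
  fixes g :: "'a set \<Rightarrow> real"
  assumes "finite R" "a \<notin> R"
  shows "sum g (Pow (insert a R)) = (\<Sum>U\<in>Pow R. g U + g (insert a U))"
proof -
  have inj: "inj_on (insert a) (Pow R)"
    using assms(2) by (intro inj_onI) (metis Pow_iff insert_ident subsetD)
  have "sum g (Pow (insert a R)) = sum g (Pow R) + sum g (insert a ` Pow R)"
    unfolding Pow_insert using assms by (intro sum.union_disjoint) auto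
  also have "sum g (insert a ` Pow R) = (\<Sum>U\<in>Pow R. g (insert a U))"
    using sum.reindex[OF inj, of g] by simp
  finally show ?thesis
    by (simp add: sum.distrib)
qed

text \<open>
  Suppose that \<open>d\<close> coordinates \<open>B\<close> destroy the sensitivity. A witness \<open>x\<close> of sensitivity avoids \<open>B\<close>.
  Swap \<open>d\<close> of its elements for those of \<open>B\<close>, and also \<open>a\<close> for \<open>b\<close>. In the resulting cube of dimension
  \<open>d + 1\<close> all edges in the direction of the pair are flat except the one at \<open>x\<close>, because the others have an element of
  \<open>B\<close> fixed to one. So the alternating sum over the cube does not vanish.
\<close>

lemma few_desensitizing_coordinates:
  assumes fin: "finite V" and deg: "slice_degree d V k F" and sens: "sensitive V k F a b" and k: "d < k"
    and d: "1 \<le> d"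
  shows "card {i\<in>V - {a, b}. \<not> sensitive (V - {i}) (k - 1) (\<lambda>x. F (insert i x)) a b} < d"
proof (rule ccontr)
  let ?B = "{i\<in>V - {a, b}. \<not> sensitive (V - {i}) (k - 1) (\<lambda>x. F (insert i x)) a b}"
  assume "\<not> ?thesis"
  then have "d \<le> card ?B"
    by simp
  then obtain B where B: "B \<subseteq> ?B" "card B = d"
    by (meson obtain_subset_with_card_n)
  have ab: "a \<in> V" "b \<in> V" "a \<noteq> b"
    using sens unfolding sensitive_def by simp_all
  obtain x where x: "x \<subseteq> V - {a, b}" "card x + 1 = k" "F (insert a x) \<noteq> F (insert b x)"
    using sens unfolding sensitive_def by blast
  have finx: "finite x"
    using x(1) fin finite_subset by auto
  have same: "F (insert a y) = F (insert b y)" if y: "y \<subseteq> V - {a, b}" "card y + 1 = k" "i \<in> y" "i \<in> B" for y i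
  proof (rule ccontr)
    assume ne: "F (insert a y) \<noteq> F (insert b y)"
    have finy: "finite y"
      using y(1) fin finite_subset by auto
    have "y - {i} \<subseteq> V - {i} - {a, b}"
      using y(1) by auto
    moreover have "card (y - {i}) + 1 = k - 1"
    proof -
      have "card y \<noteq> 0"
        using finy y(3) by auto
      moreover have "card (y - {i}) = card y - 1"
        using finy y(3) by simp
      ultimately show ?thesis
        using y(2) by linarith
    qed
    moreover have "insert i (insert a (y - {i})) = insert a y" "insert i (insert b (y - {i})) = insert b y"
      using y(3) by auto
    moreover have "i \<in> ?B"
      using B(1) y(4) by auto
    ultimately have "sensitive (V - {i}) (k - 1) (\<lambda>x. F (insert i x)) a b"
      unfolding sensitive_def using ab ne by (intro conjI exI[of _ "y - {i}"]) auto
    then show False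
      using \<open>i \<in> ?B\<close> by simp
  qed
  have xB: "x \<inter> B = {}"
    using same[OF x(1,2)] x(3) by auto
  have "d \<le> card x"
    using x(2) k by simp
  then obtain R where R: "R \<subseteq> x" "card R = d"
    by (meson obtain_subset_with_card_n)
  have finR: "finite R"
    using R(1) finx by (rule finite_subset)
  have finB: "finite B"
    using B(1) fin finite_subset[of B V] by auto
  obtain v where v: "bij_betw v R B"
    using finite_same_card_bij[OF finR finB] R(2) B(2) by auto
  have vR: "v ` R = B" "inj_on v R"
    using v by (simp_all add: bij_betw_def)
  have aR: "a \<notin> R" "a \<notin> x" "b \<notin> x"
    using R(1) x(1) by auto
  have BV: "B \<subseteq> V" "a \<notin> B" "b \<notin> B"
    using B(1) by auto
  \<comment> \<open>The cube swaps \<open>R\<close> for \<open>B\<close> along \<open>v\<close>, and \<open>a\<close> for \<open>b\<close>.\<close>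
  define w where "w = v(a := b)"
  have wU: "w ` U = v ` U" if "U \<subseteq> R" for U
    using that aR(1) by (intro image_cong) (auto simp: w_def)
  define S where "S = insert a R"
  define Q where "Q = x - R"
  have wS: "w ` S = insert b B"
    using wU[of R] vR(1) by (simp add: S_def w_def[symmetric]) (simp add: w_def)
  have "inj_on w S"
    unfolding S_def
  proof (subst inj_on_insert, intro conjI)
    show "inj_on w R"
      using vR(2) aR(1) by (auto simp: inj_on_def w_def)
    show "w a \<notin> w ` (R - {a})"
      using wU[of "R - {a}"] vR(1) BV(3) by (auto simp: w_def)
  qed
  moreover have "S \<subseteq> V" "Q \<subseteq> V" "w ` S \<subseteq> V" "S \<inter> Q = {}" "w ` S \<inter> Q = {}" "w ` S \<inter> S = {}"
    unfolding wS using R(1) x(1) ab BV aR xB by (auto simp: S_def Q_def)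
  moreover have "d < card S" "card S + card Q = k"
  proof -
    show "d < card S"
      using finR aR(1) R(2) by (simp add: S_def)
    have "card Q = card x - card R"
      unfolding Q_def using finR R(1) by (rule card_Diff_subset)
    moreover have "card R \<le> card x"
      using finx R(1) by (rule card_mono)
    ultimately show "card S + card Q = k"
      using finR aR(1) x(2) by (simp add: S_def)
  qed
  ultimately have "(\<Sum>T\<in>Pow S. (-1) ^ card T * F (Q \<union> T \<union> w ` (S - T))) = 0"
    by (intro slice_degreeD[OF deg])
  then have "0 = (\<Sum>U\<in>Pow R. (-1) ^ card U * F (Q \<union> U \<union> w ` (S - U)) +
      (-1) ^ card (insert a U) * F (Q \<union> insert a U \<union> w ` (S - insert a U)))"
    unfolding S_def using sum_Pow_insert[OF finR aR(1), of "\<lambda>T. (-1) ^ card T * F (Q \<union> T \<union> w ` (insert a R - T))"]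
    by simp
  also have "\<dots> = (\<Sum>U\<in>Pow R. if U = R then (-1) ^ card R * (F (insert b x) - F (insert a x)) else 0)"
  proof (rule sum.cong)
    fix U assume "U \<in> Pow R"
    then have U: "U \<subseteq> R"
      by simp
    then have aU: "a \<notin> U" "finite U"
      using aR(1) finR finite_subset by auto
    define y where "y = Q \<union> U \<union> v ` (R - U)"
    have "S - U = insert a (R - U)" "S - insert a U = R - U"
      using aU aR(1) by (auto simp: S_def)
    moreover have "w ` insert a (R - U) = insert b (v ` (R - U))"
      using wU[of "R - U"] by (simp add: w_def[symmetric]) (simp add: w_def)
    ultimately have eq: "Q \<union> U \<union> w ` (S - U) = insert b y" "Q \<union> insert a U \<union> w ` (S - insert a U) = insert a y"
      using wU[of "R - U"] by (auto simp: y_def)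
    show "(-1) ^ card U * F (Q \<union> U \<union> w ` (S - U)) +
      (-1) ^ card (insert a U) * F (Q \<union> insert a U \<union> w ` (S - insert a U)) =
      (if U = R then (-1) ^ card R * (F (insert b x) - F (insert a x)) else 0)"
    proof (cases "U = R")
      case True
      then have "y = x"
        using R(1) by (auto simp: y_def Q_def)
      then show ?thesis
        unfolding eq using True aU by (simp add: algebra_simps)
    next
      case False
      then obtain i0 where i0: "i0 \<in> R - U"
        using U by auto
      have sub: "v ` (R - U) \<subseteq> B"
        using vR(1) by auto
      have yV: "y \<subseteq> V - {a, b}"
        unfolding y_def using sub BV x(1) U R(1) by (auto simp: Q_def)
      have "card (v ` (R - U)) = card (R - U)"
        using vR(2) by (intro card_image) (auto intro: inj_on_subset)
      moreover have "card y = card (Q \<union> U) + card (v ` (R - U))"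
        unfolding y_def using finx finR sub xB U R(1) aU(2)
        by (intro card_Un_disjoint) (auto simp: Q_def)
      moreover have "card (Q \<union> U) = card Q + card U"
        using finx U aU(2) by (intro card_Un_disjoint) (auto simp: Q_def)
      moreover have "card (R - U) = card R - card U" "card U \<le> card R"
        using U finR aU(2) by (auto intro: card_Diff_subset card_mono)
      moreover have "card Q = card x - card R" "card R \<le> card x"
        unfolding Q_def using finR R(1) finx by (auto intro: card_Diff_subset card_mono)
      ultimately have "card y + 1 = k"
        using x(2) by linarith
      moreover have "v i0 \<in> y" "v i0 \<in> B"
        using i0 vR(1) by (auto simp: y_def)
      ultimately have "F (insert a y) = F (insert b y)"
        using same[OF yV] by blast
      then show ?thesis
        unfolding eq using False aU by simp
    qed
  qed simp
  also have "\<dots> = (-1) ^ card R * (F (insert b x) - F (insert a x))"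
    using finR by (simp add: sum.delta)
  finally show False
    using x(3) by simp
qed

lemma slice_degree_restrict:
  assumes fin: "finite V" and deg: "slice_degree d V k F" and i: "i \<in> V" and k: "1 \<le> k"
  shows "slice_degree d (V - {i}) (k - 1) (\<lambda>x. F (insert i x))"
  unfolding slice_degree_def
proof (intro allI impI)
  fix S Q and v :: "nat \<Rightarrow> nat"
  assume *: "S \<subseteq> V - {i}" "Q \<subseteq> V - {i}" "v ` S \<subseteq> V - {i}" "inj_on v S" "S \<inter> Q = {}" "v ` S \<inter> Q = {}"
    "v ` S \<inter> S = {}" "d < card S" "card S + card Q = k - 1"
  have "finite Q" "i \<notin> Q"
    using *(2) fin finite_subset by auto
  then have "card S + card (insert i Q) = k"
    using *(9) k by simp
  moreover have "S \<subseteq> V" "insert i Q \<subseteq> V" "v ` S \<subseteq> V" "S \<inter> insert i Q = {}" "v ` S \<inter> insert i Q = {}"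
    using *(1,2,3,5,6) i by auto
  ultimately have "(\<Sum>T\<in>Pow S. (-1) ^ card T * F (insert i Q \<union> T \<union> v ` (S - T))) = 0"
    using *(4,7,8) by (intro slice_degreeD[OF deg])
  then show "(\<Sum>T\<in>Pow S. (-1) ^ card T * F (insert i (Q \<union> T \<union> v ` (S - T)))) = 0"
    by simp
qed

text \<open>
  Lowers the weight from \<open>K + j\<close> to \<open>K\<close>. For each pair at most \<open>d + 1\<close> coordinates are forbidden in a step, namely the
  two members of the pair and fewer than \<open>d\<close> that destroy its sensitivity.
\<close>

lemma sensitive_pairs_survive:
  assumes "finite V" "slice_degree d V (K + j) F" "d \<le> K" "1 \<le> d" "finite E"
    "\<And>p. p \<in> E \<Longrightarrow> sensitive V (K + j) F (fst p) (snd p)" "card E * (d + 1) + j < card V"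
  shows "\<exists>T\<subseteq>V. card T = j \<and> slice_degree d (V - T) K (\<lambda>x. F (T \<union> x)) \<and>
    (\<forall>p\<in>E. sensitive (V - T) K (\<lambda>x. F (T \<union> x)) (fst p) (snd p))"
  using assms
proof (induction j arbitrary: V F)
  case 0
  then show ?case
    by (intro exI[of _ "{}"]) simp
next
  case (Suc j)
  define bad where "bad p = {fst p, snd p} \<union> {i\<in>V - {fst p, snd p}.
      \<not> sensitive (V - {i}) (K + j) (\<lambda>x. F (insert i x)) (fst p) (snd p)}" for p
  have "card (bad p) \<le> d + 1" if "p \<in> E" for p
  proof -
    have "card {i\<in>V - {fst p, snd p}.
      \<not> sensitive (V - {i}) (K + Suc j - 1) (\<lambda>x. F (insert i x)) (fst p) (snd p)} < d"
      using few_desensitizing_coordinates[OF Suc.prems(1,2) Suc.prems(6)[OF that]] Suc.prems(3,4) by simp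
    moreover have "card {fst p, snd p} \<le> 2"
      by (simp add: card_insert_if)
    moreover have "card (bad p) \<le> card {fst p, snd p} + card {i\<in>V - {fst p, snd p}.
      \<not> sensitive (V - {i}) (K + j) (\<lambda>x. F (insert i x)) (fst p) (snd p)}"
      unfolding bad_def by (rule card_Un_le)
    ultimately show ?thesis
      using Suc.prems(4) by simp
  qed
  then have "card (\<Union>p\<in>E. bad p) \<le> card E * (d + 1)"
    using card_UN_le[OF Suc.prems(5), of bad] sum_bounded_above[of E "\<lambda>p. card (bad p)" "d + 1"] by simp
  then have less: "card (\<Union>p\<in>E. bad p) < card V"
    using Suc.prems(7) by linarith
  have "finite (\<Union>p\<in>E. bad p)"
    using Suc.prems(1,5) unfolding bad_def by auto
  then have "\<not> V \<subseteq> (\<Union>p\<in>E. bad p)"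
    using less card_mono by (metis not_less)
  then obtain i where i: "i \<in> V" "\<And>p. p \<in> E \<Longrightarrow> i \<notin> bad p"
    by blast
  have "slice_degree d (V - {i}) (K + j) (\<lambda>x. F (insert i x))"
    using slice_degree_restrict[OF Suc.prems(1,2) i(1)] by simp
  moreover have "sensitive (V - {i}) (K + j) (\<lambda>x. F (insert i x)) (fst p) (snd p)" if "p \<in> E" for p
    using i(2)[OF that] i(1) unfolding bad_def by auto
  moreover have "card E * (d + 1) + j < card (V - {i})"
    using Suc.prems(1,7) i(1) by simp
  ultimately have "\<exists>T\<subseteq>V - {i}. card T = j \<and> slice_degree d (V - {i} - T) K (\<lambda>x. F (insert i (T \<union> x))) \<and>
      (\<forall>p\<in>E. sensitive (V - {i} - T) K (\<lambda>x. F (insert i (T \<union> x))) (fst p) (snd p))"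
    using Suc.prems(1,3,4,5) by (intro Suc.IH) simp_all
  then obtain T where T: "T \<subseteq> V - {i}" "card T = j"
    "slice_degree d (V - {i} - T) K (\<lambda>x. F (insert i (T \<union> x)))"
      "\<forall>p\<in>E. sensitive (V - {i} - T) K (\<lambda>x. F (insert i (T \<union> x))) (fst p) (snd p)"
    by (elim exE conjE)
  have "finite T" "i \<notin> T"
    using T(1) Suc.prems(1) finite_subset by auto
  moreover have "V - insert i T = V - {i} - T"
    by auto
  ultimately show ?case
    using T i(1) by (intro exI[of _ "insert i T"]) auto
qed

section \<open>From the slice to the ball\<close>

text \<open>
  Since the \<open>K\<close> elements of \<open>R\<close> are interchangeable, \<open>T \<union> J\<close> with \<open>J \<subseteq> R\<close> of size \<open>K - card T\<close> has a value that
  depends on \<open>T\<close> only. The coefficients come from Moebius inversion. Those of sets \<open>S\<close> with more than \<open>d\<close>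
  elements vanish because the alternating sum over the subsets \<open>T\<close> of \<open>S\<close> is realised in the slice by
  swapping the elements of \<open>S\<close> for elements of the reserve.
\<close>

lemma ball_extension:
  assumes fin: "finite X" "finite R" and XR: "X \<subseteq> V" "R \<subseteq> V" "X \<inter> R = {}" and R: "card R = K"
    and deg: "slice_degree d V K F"
    and val: "\<And>x. x \<subseteq> V \<Longrightarrow> card x = K \<Longrightarrow> F x \<in> A"
    and sym: "\<And>T J J'. T \<subseteq> X \<Longrightarrow> J \<subseteq> R \<Longrightarrow> J' \<subseteq> R \<Longrightarrow> card J = card J' \<Longrightarrow> card T + card J = K \<Longrightarrow>
       F (T \<union> J) = F (T \<union> J')"
  obtains c where "ball_valued A K d X c" "\<And>T. T \<subseteq> X \<Longrightarrow> card T = K \<Longrightarrow> sum c (Pow T) = F T"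
proof -
  have "\<exists>J. j \<le> K \<longrightarrow> J \<subseteq> R \<and> card J = j" for j
    using R by (metis obtain_subset_with_card_n)
  then obtain J where J: "\<And>j. j \<le> K \<Longrightarrow> J j \<subseteq> R \<and> card (J j) = j"
    by metis
  define G where "G T = F (T \<union> J (K - card T))" for T
  have G: "G T = F (T \<union> J')" if "T \<subseteq> X" "J' \<subseteq> R" "card T + card J' = K" for T J'
    unfolding G_def using that J[of "K - card T"] by (intro sym) auto
  define g where "g S = (\<Sum>T\<in>Pow S. (-1) ^ card T * G T)" for S
  \<comment> \<open>Beyond size \<open>K\<close> the values of \<open>G\<close> mean nothing, so the coefficients are cut off.\<close>
  define c where "c S = (if card S \<le> K then (-1) ^ card S * g S else 0)" for S
  have sum_c: "sum c (Pow T) = G T" if T: "T \<subseteq> X" "card T \<le> K" for T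
  proof -
    have finT: "finite T"
      using T(1) fin(1) by (rule finite_subset)
    have "card U \<le> K" if "U \<in> Pow T" for U
      using that finT T(2) card_mono[of T U] by auto
    then have "sum c (Pow T) = (\<Sum>U\<in>Pow T. (-1) ^ card U * g U)"
      by (intro sum.cong) (simp_all add: c_def)
    also have "\<dots> = G T"
      using finT by (intro inclusion_exclusion_symmetric[symmetric]) (simp_all add: g_def)
    finally show ?thesis .
  qed
  have "c S = 0" if S: "S \<subseteq> X" "d < card S" for S
  proof (cases "card S \<le> K")
    case True
    have finS: "finite S"
      using S(1) fin(1) by (rule finite_subset)
    then obtain v where v: "inj_on v S" "v ` S \<subseteq> R"
      using card_le_inj[OF finS fin(2)] True R by auto
    define Q where "Q = R - v ` S"
    have card_vS: "card (v ` S) = card S"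
      using v(1) by (rule card_image)
    have "card Q = card R - card (v ` S)"
      unfolding Q_def using v(2) finS by (intro card_Diff_subset) auto
    then have cQ: "card S + card Q = K"
      using True R card_vS by simp
    have "(\<Sum>T\<in>Pow S. (-1) ^ card T * F (Q \<union> T \<union> v ` (S - T))) = 0"
    proof (rule slice_degreeD[OF deg _ _ _ v(1) _ _ _ S(2) cQ])
      show "S \<subseteq> V" "Q \<subseteq> V" "v ` S \<subseteq> V" "v ` S \<inter> Q = {}"
        using S(1) XR(1,2) v(2) by (auto simp: Q_def)
      have "S \<inter> R = {}"
        using S(1) XR(3) by auto
      then show "S \<inter> Q = {}" "v ` S \<inter> S = {}"
        using v(2) unfolding Q_def by blast+
    qed
    moreover have "F (Q \<union> T \<union> v ` (S - T)) = G T" if T: "T \<in> Pow S" for T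
    proof -
      have finT: "finite T" "card T \<le> card S"
        using T finS finite_subset card_mono by auto
      have "card (v ` (S - T)) = card (S - T)"
        using v(1) by (intro card_image) (auto intro: inj_on_subset)
      moreover have "card (S - T) = card S - card T"
        using T finT(1) by (intro card_Diff_subset) auto
      moreover have "card (Q \<union> v ` (S - T)) = card Q + card (v ` (S - T))"
        using fin(2) finS by (intro card_Un_disjoint) (auto simp: Q_def)
      ultimately have "card T + card (Q \<union> v ` (S - T)) = K"
        using cQ finT(2) by simp
      moreover have "Q \<union> v ` (S - T) \<subseteq> R" "T \<subseteq> X"
        using v(2) T S(1) by (auto simp: Q_def)
      ultimately have "G T = F (T \<union> (Q \<union> v ` (S - T)))"
        by (intro G)
      then show ?thesis
        by (simp add: Un_ac)
    qed
    ultimately have "g S = 0"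
      unfolding g_def by simp
    then show ?thesis
      by (simp add: c_def)
  qed (simp add: c_def)
  moreover have "sum c (Pow T) \<in> A" if T: "T \<subseteq> X" "card T \<le> K" for T
  proof -
    have JK: "J (K - card T) \<subseteq> R" "card (J (K - card T)) = K - card T"
      using J[of "K - card T"] by simp_all
    have "card (T \<union> J (K - card T)) = card T + card (J (K - card T))"
    proof (rule card_Un_disjoint)
      show "finite T" "finite (J (K - card T))"
        using T(1) JK(1) fin finite_subset by auto
      show "T \<inter> J (K - card T) = {}"
        using T(1) JK(1) XR(3) by auto
    qed
    then have "card (T \<union> J (K - card T)) = K"
      using JK(2) T(2) by simp
    moreover have "T \<union> J (K - card T) \<subseteq> V"
      using T(1) JK(1) XR by auto
    ultimately show ?thesis
      unfolding sum_c[OF T] G_def by (intro val)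
  qed
  ultimately have "ball_valued A K d X c"
    unfolding ball_valued_def using fin(1) by simp
  moreover have "sum c (Pow T) = F T" if "T \<subseteq> X" "card T = K" for T
    using sum_c[of T] G[of T "{}"] that by simp
  ultimately show thesis
    using that by blast
qed

text \<open>
  The witnesses of \<open>M\<close> disjoint sensitive pairs occupy a set \<open>X\<close> of bounded size. Colouring sets \<open>J\<close> outside
  \<open>X\<close> by the function \<open>T \<mapsto> F (T \<union> J)\<close> on the subsets of \<open>X\<close> yields a reserve. In the extension to the ball
  each pair is met by some set with nonzero coefficient, and such a set, having at most \<open>d\<close> elements, meets at most
  \<open>d\<close> disjoint pairs. So the number of pairs is at most \<open>d\<close> times the number of nonzero coefficients.
\<close>

lemma few_sensitive_pairs:
  assumes A: "finite A" "card A \<ge> 2" and d: "d \<ge> 1"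
    and K: "\<And>z b. 1 \<le> b \<Longrightarrow> z + b \<le> d \<Longrightarrow> z + b * W A ((d - z) div b) \<le> K"
  shows "\<exists>M N. \<forall>V F E. finite V \<longrightarrow> N \<le> card V \<longrightarrow> slice_degree d V K F \<longrightarrow>
     (\<forall>x. x \<subseteq> V \<longrightarrow> card x = K \<longrightarrow> F x \<in> A) \<longrightarrow> finite E \<longrightarrow> matching E \<longrightarrow>
     (\<forall>p\<in>E. sensitive V K F (fst p) (snd p)) \<longrightarrow> card E < M"
proof -
  obtain B where B: "\<forall>(X :: nat set) c. ball_valued A K d X c \<longrightarrow> card {S\<in>Pow X. c S \<noteq> 0} < B"
    using few_coefficients[OF A d K] by blast
  define M where "M = Suc (d * B)"
  define C where "C = card A ^ (2 ^ (M * (K + 1)))"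
  obtain R where R: "\<forall>(V :: nat set) (\<chi> :: nat set \<Rightarrow> nat set \<Rightarrow> real) D.
     finite V \<and> card V \<ge> R \<and> finite D \<and> card D \<le> C \<and>
     (\<forall>T\<subseteq>V. card T \<le> K \<longrightarrow> \<chi> T \<in> D) \<longrightarrow> (\<exists>H\<subseteq>V. card H = K \<and> homogeneous K \<chi> H)"
    using ramsey_finite_palette[where C=C and L=K and N=K] ..
  define N where "N = M * (K + 1) + R"
  have "card E0 < M" if finV: "finite V" and large: "N \<le> card V" and deg: "slice_degree d V K F"
    and val: "\<forall>x. x \<subseteq> V \<longrightarrow> card x = K \<longrightarrow> F x \<in> A" and finE0: "finite E0" and match0: "matching E0"
    and sens0: "\<forall>p\<in>E0. sensitive V K F (fst p) (snd p)" for V F E0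
  proof (rule ccontr)
    assume "\<not> card E0 < M"
    then have "M \<le> card E0"
      by simp
    then obtain E where E: "E \<subseteq> E0" "card E = M"
      by (meson obtain_subset_with_card_n)
    have finE: "finite E"
      using E(1) finE0 by (rule finite_subset)
    have "\<exists>x. p \<in> E \<longrightarrow> x \<subseteq> V - {fst p, snd p} \<and> card x + 1 = K \<and> F (insert (fst p) x) \<noteq> F (insert (snd p) x)" for p
      using sens0 E(1) unfolding sensitive_def by blast
    then obtain x where x: "\<And>p. p \<in> E \<Longrightarrow>
        x p \<subseteq> V - {fst p, snd p} \<and> card (x p) + 1 = K \<and> F (insert (fst p) (x p)) \<noteq> F (insert (snd p) (x p))"
      by metis
    have inV: "fst p \<in> V" "snd p \<in> V" if "p \<in> E" for p
      using sens0 E(1) that unfolding sensitive_def by auto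
    define X where "X = (\<Union>p\<in>E. insert (fst p) (insert (snd p) (x p)))"
    have XV: "X \<subseteq> V"
      unfolding X_def using inV x by blast
    have finX: "finite X"
      using XV finV by (rule finite_subset)
    have finx: "finite (x p)" if "p \<in> E" for p
      using x[OF that] finV finite_subset[of "x p" V] by auto
    have "card (insert (fst p) (insert (snd p) (x p))) \<le> K + 1" if "p \<in> E" for p
      using x[OF that] finx[OF that] by (auto simp: card_insert_if)
    then have cX: "card X \<le> M * (K + 1)"
      unfolding X_def using card_UN_le[OF finE, of "\<lambda>p. insert (fst p) (insert (snd p) (x p))"]
        sum_bounded_above[of E "\<lambda>p. card (insert (fst p) (insert (snd p) (x p)))" "K + 1"] E(2) by simp
    have "A \<noteq> {}"
      using A(2) by auto
    then obtain a0 where a0: "a0 \<in> A"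
      by auto
    \<comment> \<open>The default \<open>a0\<close> keeps the colours among the functions into \<open>A\<close> where \<open>T \<union> J\<close> is not in the slice.\<close>
    define \<chi> where "\<chi> J = (\<lambda>T\<in>Pow X. if card T + card J = K then F (T \<union> J) else a0)" for J
    define D where "D = (Pow X \<rightarrow>\<^sub>E A)"
    have "finite D"
      unfolding D_def using finX A(1) by (intro finite_PiE) auto
    moreover have "card D \<le> C"
    proof -
      have "card D = card A ^ (2 ^ card X)"
        unfolding D_def using finX by (simp add: card_PiE card_Pow)
      also have "\<dots> \<le> C"
        unfolding C_def using cX A(2) by (intro power_increasing) auto
      finally show ?thesis .
    qed
    moreover have "\<chi> J \<in> D" if J: "J \<subseteq> V - X" for J
    proof -
      have "F (T \<union> J) \<in> A" if T: "T \<subseteq> X" "card T + card J = K" for T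
      proof -
        have "card (T \<union> J) = card T + card J"
          using T(1) J finX finV finite_subset[of T X] finite_subset[of J V] by (intro card_Un_disjoint) auto
        moreover have "T \<union> J \<subseteq> V"
          using T(1) J XV by auto
        ultimately show ?thesis
          using val T(2) by simp
      qed
      then show ?thesis
        unfolding \<chi>_def D_def using a0 by auto
    qed
    moreover have "R \<le> card (V - X)"
      using large cX finX XV by (simp add: card_Diff_subset N_def)
    ultimately have "\<exists>H\<subseteq>V - X. card H = K \<and> homogeneous K \<chi> H"
      using finV by (intro R[rule_format, of "V - X" D \<chi>]) simp
    then obtain H where H: "H \<subseteq> V - X" "card H = K" and hom: "homogeneous K \<chi> H"
      by (elim exE conjE)
    have finH: "finite H"
      using H(1) finV finite_subset[of H V] by auto
    have sym: "F (T \<union> J) = F (T \<union> J')"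
      if *: "T \<subseteq> X" "J \<subseteq> H" "J' \<subseteq> H" "card J = card J'" "card T + card J = K" for T J J'
    proof -
      have "card J \<le> K"
        using *(5) by simp
      then have "\<chi> J = \<chi> J'"
        by (rule hom[unfolded homogeneous_def, rule_format, OF *(2-4)])
      then have "\<chi> J T = \<chi> J' T"
        by simp
      then show ?thesis
        using * by (simp add: \<chi>_def)
    qed
    have HV: "H \<subseteq> V" "X \<inter> H = {}"
      using H(1) by auto
    obtain c where ball: "ball_valued A K d X c" and sum_c: "\<And>T. T \<subseteq> X \<Longrightarrow> card T = K \<Longrightarrow> sum c (Pow T) = F T"
    proof (rule ball_extension[OF finX finH XV HV H(2) deg val[rule_format] sym])
      fix c assume "ball_valued A K d X c" "\<And>T. T \<subseteq> X \<Longrightarrow> card T = K \<Longrightarrow> sum c (Pow T) = F T"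
      then show thesis
        by (rule that)
    qed
    define F0 where "F0 = {S\<in>Pow X. c S \<noteq> 0}"
    have cF0: "card F0 < B"
      using B ball unfolding F0_def by simp
    have finF0: "finite F0"
      unfolding F0_def using finX by simp
    have F0d: "card S \<le> d" "finite S" if "S \<in> F0" for S
    proof -
      have S: "S \<subseteq> X" "c S \<noteq> 0"
        using that by (simp_all add: F0_def)
      show "finite S"
        using S(1) finX by (rule finite_subset)
      show "card S \<le> d"
        using ball[unfolded ball_valued_def] S by (meson not_less)
    qed
    have "\<exists>S. S \<in> F0 \<and> S \<inter> {fst p, snd p} \<noteq> {}" if p: "p \<in> E" for p
    proof (rule ccontr)
      assume none: "\<nexists>S. S \<in> F0 \<and> S \<inter> {fst p, snd p} \<noteq> {}"
      have "sum c (Pow (insert i (x p))) = sum c (Pow (x p))" if i: "i \<in> {fst p, snd p}" for i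
      proof (rule sum.mono_neutral_right)
        show "finite (Pow (insert i (x p)))"
          using finx[OF p] by simp
        show "Pow (x p) \<subseteq> Pow (insert i (x p))"
          by auto
        show "\<forall>S\<in>Pow (insert i (x p)) - Pow (x p). c S = 0"
        proof
          fix S assume S: "S \<in> Pow (insert i (x p)) - Pow (x p)"
          then have "i \<in> S"
            by auto
          moreover have "S \<subseteq> X"
            using S i p unfolding X_def by auto
          ultimately show "c S = 0"
            using none i unfolding F0_def by auto
        qed
      qed
      then have "sum c (Pow (insert (fst p) (x p))) = sum c (Pow (insert (snd p) (x p)))"
        by simp
      moreover have "insert (fst p) (x p) \<subseteq> X" "insert (snd p) (x p) \<subseteq> X"
        using p unfolding X_def by auto
      moreover have "card (insert (fst p) (x p)) = K" "card (insert (snd p) (x p)) = K"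
        using x[OF p] finx[OF p] by (auto simp: card_insert_if)
      ultimately show False
        using x[OF p] by (simp add: sum_c)
    qed
    then obtain S where S: "\<And>p. p \<in> E \<Longrightarrow> S p \<in> F0 \<and> S p \<inter> {fst p, snd p} \<noteq> {}"
      by metis
    have "d * card F0 < card E"
      using E(2) mult_le_mono2[OF less_imp_le[OF cF0], of d] unfolding M_def by linarith
    then obtain S0 where S0: "S0 \<in> F0" "d < card {p\<in>E. S p = S0}"
      using pigeonhole_fibre[OF finE finF0, of S d] S by blast
    have "\<exists>i. p \<in> E \<longrightarrow> i \<in> S p \<inter> {fst p, snd p}" for p
      using S by blast
    then have "\<forall>p. \<exists>i. p \<in> E \<longrightarrow> i \<in> S p \<inter> {fst p, snd p}" ..
    from choice[OF this] obtain e where "\<forall>p. p \<in> E \<longrightarrow> e p \<in> S p \<inter> {fst p, snd p}" ..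
    then have e: "\<And>p. p \<in> E \<Longrightarrow> e p \<in> S p \<inter> {fst p, snd p}"
      by blast
    have "inj_on e {p\<in>E. S p = S0}"
    proof (rule inj_onI)
      fix p q assume pq: "p \<in> {p\<in>E. S p = S0}" "q \<in> {p\<in>E. S p = S0}" "e p = e q"
      then have meet: "e p \<in> {fst p, snd p} \<inter> {fst q, snd q}"
        using e[of p] e[of q] by auto
      have "p \<in> E0" "q \<in> E0"
        using pq(1,2) E(1) by auto
      then show "p = q"
        using match0[unfolded matching_def, rule_format, OF \<open>p \<in> E0\<close> \<open>q \<in> E0\<close>] meet by blast
    qed
    then have "card {p\<in>E. S p = S0} = card (e ` {p\<in>E. S p = S0})"
      by (simp add: card_image)
    also have "\<dots> \<le> card S0"
      using F0d[OF S0(1)] e by (intro card_mono) auto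
    finally show False
      using S0(2) F0d(1)[OF S0(1)] by simp
  qed
  note bound = this
  show ?thesis
    by (rule exI[of _ M], rule exI[of _ N], intro allI impI, rule bound)
qed

section \<open>Juntas from insensitivity\<close>

text \<open>
  One passes from \<open>x\<close> to \<open>y\<close> by transpositions of coordinates outside \<open>J\<close>, each bringing \<open>x\<close> closer to \<open>y\<close>.
\<close>

lemma insensitive_outside_junta:
  assumes fin: "finite V" and ins: "\<And>a b. a \<in> V - J \<Longrightarrow> b \<in> V - J \<Longrightarrow> \<not> sensitive V k F a b"
  shows "x \<subseteq> V \<Longrightarrow> y \<subseteq> V \<Longrightarrow> card x = k \<Longrightarrow> card y = k \<Longrightarrow> x \<inter> J = y \<inter> J \<Longrightarrow> F x = F y"
proof (induction "card (x - y)" arbitrary: x rule: less_induct)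
  case less
  have finxy: "finite x" "finite y"
    using less.prems(1,2) fin finite_subset by auto
  show ?case
  proof (cases "x \<subseteq> y")
    case True
    then show ?thesis
      using card_subset_eq[OF finxy(2) True] less.prems by simp
  next
    case False
    then obtain a where a: "a \<in> x" "a \<notin> y"
      by auto
    have "\<not> y \<subseteq> x"
      using card_subset_eq[OF finxy(1), of y] less.prems(3,4) False by auto
    then obtain b where b: "b \<in> y" "b \<notin> x"
      by auto
    have ab: "a \<in> V - J" "b \<in> V - J" "a \<noteq> b"
      using a b less.prems(1,2,5) by auto
    define x' where "x' = insert b (x - {a})"
    have cx: "card (x - {a}) + 1 = k"
      using a(1) finxy(1) less.prems(3) by (metis Suc_eq_plus1 card_Suc_Diff1)
    have "F (insert a (x - {a})) = F (insert b (x - {a}))"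
    proof (rule ccontr)
      assume "F (insert a (x - {a})) \<noteq> F (insert b (x - {a}))"
      then have "sensitive V k F a b"
        unfolding sensitive_def using ab cx less.prems(1) b(2) by (intro conjI exI[of _ "x - {a}"]) auto
      then show False
        using ins ab by simp
    qed
    then have "F x = F x'"
      using a(1) by (simp add: x'_def insert_absorb)
    also have "F x' = F y"
    proof (rule less.hyps)
      have "x' - y = x - y - {a}"
        using b a by (auto simp: x'_def)
      then show "card (x' - y) < card (x - y)"
        using a finxy card_Diff1_less[of "x - y" a] by simp
      show "x' \<subseteq> V" "y \<subseteq> V"
        using less.prems(1,2) ab by (auto simp: x'_def)
      show "card x' = k"
        using cx b finxy(1) by (simp add: x'_def)
      show "card y = k"
        by (fact less.prems)
      show "x' \<inter> J = y \<inter> J"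
        using less.prems(5) ab by (auto simp: x'_def)
    qed
    finally show ?thesis .
  qed
qed

lemma junta_if_few_sensitive_pairs:
  assumes fin: "finite V"
    and few: "\<And>E. finite E \<Longrightarrow> matching E \<Longrightarrow> \<forall>p\<in>E. sensitive V k F (fst p) (snd p) \<Longrightarrow> card E < M"
  shows "\<exists>J\<subseteq>V. card J \<le> 2 * M \<and>
    (\<forall>x y. x \<subseteq> V \<longrightarrow> y \<subseteq> V \<longrightarrow> card x = k \<longrightarrow> card y = k \<longrightarrow> x \<inter> J = y \<inter> J \<longrightarrow> F x = F y)"
proof -
  define good where "good E \<longleftrightarrow> finite E \<and> matching E \<and> (\<forall>p\<in>E. sensitive V k F (fst p) (snd p))" for E
  have "good {}"
    by (simp add: good_def matching_def)
  moreover have "\<forall>E. good E \<longrightarrow> card E < M"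
    using few by (simp add: good_def)
  ultimately have "\<exists>E. good E \<and> (\<forall>E'. good E' \<longrightarrow> card E' \<le> card E)"
    using ex_has_greatest_nat[of good "{}" card M] by simp
  then obtain E where "good E" and max: "\<And>E'. good E' \<Longrightarrow> card E' \<le> card E"
    by metis
  then have E: "finite E" "matching E" "\<forall>p\<in>E. sensitive V k F (fst p) (snd p)"
    by (simp_all add: good_def)
  define J where "J = (\<Union>p\<in>E. {fst p, snd p})"
  have "card J \<le> (\<Sum>p\<in>E. card {fst p, snd p})"
    unfolding J_def using E(1) by (rule card_UN_le)
  also have "\<dots> \<le> (\<Sum>p\<in>E. 2)"
    by (intro sum_mono) (simp add: card_insert_if)
  finally have "card J \<le> 2 * card E"
    by simp
  then have cJ: "card J \<le> 2 * M"
    using few[OF E] by simp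
  have JV: "J \<subseteq> V"
    unfolding J_def using E(3) by (auto simp: sensitive_def)
  have ins: "\<not> sensitive V k F a b" if ab: "a \<in> V - J" "b \<in> V - J" for a b
  proof
    assume sens: "sensitive V k F a b"
    have new: "(a, b) \<notin> E"
      using ab unfolding J_def by force
    have disj: "{fst q, snd q} \<inter> {a, b} = {}" if "q \<in> E" for q
      using ab that unfolding J_def by auto
    have "matching (insert (a, b) E)"
      unfolding matching_def
    proof (intro ballI impI)
      fix p q assume pq: "p \<in> insert (a, b) E" "q \<in> insert (a, b) E" "p \<noteq> q"
      then consider "p = (a, b)" "q \<in> E" | "q = (a, b)" "p \<in> E" | "p \<in> E" "q \<in> E"
        by blast
      then show "{fst p, snd p} \<inter> {fst q, snd q} = {}"
      proof cases
        case 1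
        then show ?thesis
          using disj[of q] by auto
      next
        case 2
        then show ?thesis
          using disj[of p] by auto
      next
        case 3
        then show ?thesis
          using E(2)[unfolded matching_def, rule_format, of p q] pq(3) by simp
      qed
    qed
    then have "good (insert (a, b) E)"
      using E sens by (simp add: good_def)
    then show False
      using max[of "insert (a, b) E"] E(1) new by simp
  qed
  show ?thesis
  proof (rule exI[of _ J], intro conjI JV cJ allI impI)
    fix x y assume *: "x \<subseteq> V" "y \<subseteq> V" "card x = k" "card y = k" "x \<inter> J = y \<inter> J"
    show "F x = F y"
      by (rule insensitive_outside_junta[where V=V and J=J and k=k and F=F, OF fin _ *]) (rule ins)
  qed
qed

section \<open>Polynomials restricted to a slice\<close>

definition point :: "nat \<Rightarrow> nat set \<Rightarrow> nat \<Rightarrow> nat" where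
  "point n x = (\<lambda>i\<in>{1..n}. if i \<in> x then 1 else 0)"

lemma point_in_slice:
  assumes "x \<subseteq> {1..n}" "card x = k"
  shows "point n x \<in> slice n k"
proof -
  have "(\<Sum>i=1..n. point n x i) = (\<Sum>i\<in>{1..n}. if i \<in> x then 1 else 0)"
    by (intro sum.cong) (auto simp: point_def)
  also have "\<dots> = card ({1..n} \<inter> x)"
    by (simp add: sum.If_cases)
  also have "{1..n} \<inter> x = x"
    using assms(1) by auto
  finally show ?thesis
    using assms(2) by (auto simp: slice_def point_def)
qed

lemma slice_cases:
  assumes "y \<in> slice n k"
  obtains x where "x \<subseteq> {1..n}" "card x = k" "y = point n x"
proof -
  define x where "x = {i\<in>{1..n}. y i = 1}"
  have y: "y \<in> {1..n} \<rightarrow>\<^sub>E {0, 1}" "(\<Sum>i=1..n. y i) = k"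
    using assms by (auto simp: slice_def)
  have 01: "y i = (if i \<in> x then 1 else 0)" if "i \<in> {1..n}" for i
    using PiE_mem[OF y(1) that] that by (auto simp: x_def)
  have "y = point n x"
  proof
    fix i show "y i = point n x i"
      using 01[of i] PiE_arb[OF y(1), of i] by (cases "i \<in> {1..n}") (auto simp: point_def)
  qed
  moreover have "x \<subseteq> {1..n}"
    by (auto simp: x_def)
  moreover have "card x = k"
  proof -
    have "(\<Sum>i=1..n. y i) = (\<Sum>i\<in>{1..n}. if i \<in> x then 1 else 0)"
      using 01 by (intro sum.cong) auto
    also have "\<dots> = card ({1..n} \<inter> x)"
      by (simp add: sum.If_cases)
    also have "{1..n} \<inter> x = x"
      by (auto simp: x_def)
    finally show ?thesis
      using y(2) by simp
  qed
  ultimately show thesis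
    using that by blast
qed

lemma evaluate_point:
  assumes "in_variables {1..n} P"
  shows "evaluate P (\<lambda>i. real (point n x i)) =
    (\<Sum>m\<in>Poly_Mapping.keys P. Poly_Mapping.lookup P m * of_bool (Poly_Mapping.keys m \<subseteq> x))"
  unfolding evaluate_def
proof (intro sum.cong refl arg_cong2[where f="(*)"])
  fix m assume "m \<in> Poly_Mapping.keys P"
  then have sub: "Poly_Mapping.keys m \<subseteq> {1..n}"
    using assms unfolding in_variables_def by auto
  have "(\<Prod>i\<in>Poly_Mapping.keys m. real (point n x i) ^ Poly_Mapping.lookup m i) =
      (\<Prod>i\<in>Poly_Mapping.keys m. if i \<in> x then 1 else 0)"
  proof (rule prod.cong)
    fix i assume i: "i \<in> Poly_Mapping.keys m"
    then have "Poly_Mapping.lookup m i > 0"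
      by (simp add: in_keys_iff)
    moreover have "i \<in> {1..n}"
      using sub i by auto
    ultimately show "real (point n x i) ^ Poly_Mapping.lookup m i = (if i \<in> x then 1 else 0)"
      by (simp add: point_def)
  qed simp
  also have "\<dots> = of_bool (Poly_Mapping.keys m \<subseteq> x)"
  proof (cases "Poly_Mapping.keys m \<subseteq> x")
    case True
    then show ?thesis
      by (simp add: prod.neutral subset_iff)
  next
    case False
    then obtain i where "i \<in> Poly_Mapping.keys m" "i \<notin> x"
      by auto
    then show ?thesis
      using False by (auto intro!: prod_zero)
  qed
  finally show "(\<Prod>i\<in>Poly_Mapping.keys m. real (point n x i) ^ Poly_Mapping.lookup m i) =
      of_bool (Poly_Mapping.keys m \<subseteq> x)" .
qed

text \<open>
  The pairs \<open>{s, v s}\<close> are disjoint and more numerous than the variables \<open>B\<close> of the monomial, so some pair avoids \<open>B\<close>.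
  Toggling it changes the sign but not the value of the monomial.
\<close>

lemma monomial_alternating_sum:
  assumes finS: "finite S" and inj: "inj_on v S" and disj: "v ` S \<inter> S = {}" "S \<inter> Q = {}" "v ` S \<inter> Q = {}"
    and B: "finite B" "card B < card S"
  shows "(\<Sum>T\<in>Pow S. (-1) ^ card T * of_bool (B \<subseteq> Q \<union> T \<union> v ` (S - T))) = (0 :: real)"
proof -
  have "\<exists>s\<in>S. s \<notin> B \<and> v s \<notin> B"
  proof (rule ccontr)
    assume none: "\<not> ?thesis"
    \<comment> \<open>If \<open>B\<close> met all pairs, a choice of one element from each pair would inject \<open>S\<close> into \<open>B\<close>.\<close>
    define g where "g s = (if s \<in> B then s else v s)" for s
    have "inj_on g S"
    proof (rule inj_onI)
      fix s u assume su: "s \<in> S" "u \<in> S" "g s = g u"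
      have "v s \<noteq> u" "v u \<noteq> s"
        using su(1,2) disj(1) by blast+
      then show "s = u"
        using su(3) inj_onD[OF inj _ su(1,2)] unfolding g_def by (auto split: if_splits)
    qed
    moreover have "g ` S \<subseteq> B"
      using none unfolding g_def by auto
    ultimately have "card S \<le> card B"
      using B(1) card_inj_on_le by blast
    then show False
      using B(2) by simp
  qed
  then obtain s where s: "s \<in> S" "s \<notin> B" "v s \<notin> B"
    by auto
  define R where "R = S - {s}"
  have R: "S = insert s R" "finite R" "s \<notin> R"
    using s(1) finS by (auto simp: R_def)
  have same: "B \<subseteq> Q \<union> U \<union> v ` (S - U) \<longleftrightarrow> B \<subseteq> Q \<union> insert s U \<union> v ` (S - insert s U)" if U: "U \<subseteq> R" for U
  proof -
    have "s \<notin> U"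
      using U R(3) by auto
    then have "S - U = insert s (S - insert s U)"
      using s(1) by auto
    then have "v ` (S - U) = insert (v s) (v ` (S - insert s U))"
      by simp
    then show ?thesis
      using s(2,3) by auto
  qed
  have "(\<Sum>T\<in>Pow S. (-1) ^ card T * of_bool (B \<subseteq> Q \<union> T \<union> v ` (S - T))) =
      (\<Sum>U\<in>Pow R. (-1) ^ card U * of_bool (B \<subseteq> Q \<union> U \<union> v ` (S - U)) +
        (-1) ^ card (insert s U) * of_bool (B \<subseteq> Q \<union> insert s U \<union> v ` (S - insert s U)) :: real)"
    using sum_Pow_insert[OF R(2,3), of "\<lambda>T. (-1) ^ card T * of_bool (B \<subseteq> Q \<union> T \<union> v ` (S - T))"] R(1) by simp
  also have "\<dots> = (\<Sum>U\<in>Pow R. 0)"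
  proof (rule sum.cong)
    fix U assume "U \<in> Pow R"
    then have U: "U \<subseteq> R"
      by simp
    then have "finite U" "s \<notin> U"
      using R(2,3) finite_subset by auto
    then have "card (insert s U) = Suc (card U)"
      by simp
    then show "(-1) ^ card U * of_bool (B \<subseteq> Q \<union> U \<union> v ` (S - U)) +
        (-1) ^ card (insert s U) * of_bool (B \<subseteq> Q \<union> insert s U \<union> v ` (S - insert s U)) = (0 :: real)"
      unfolding same[OF U] by simp
  qed simp
  finally show ?thesis
    by simp
qed

lemma slice_degree_of_polynomial:
  assumes "has_degree_on_slice n k d f"
  shows "slice_degree d {1..n} k (\<lambda>x. f (point n x))"
  unfolding slice_degree_def
proof (intro allI impI)
  fix S Q and v :: "nat \<Rightarrow> nat"
  assume *: "S \<subseteq> {1..n}" "Q \<subseteq> {1..n}" "v ` S \<subseteq> {1..n}" "inj_on v S" "S \<inter> Q = {}" "v ` S \<inter> Q = {}"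
    "v ` S \<inter> S = {}" "d < card S" "card S + card Q = k"
  obtain P where P: "in_variables {1..n} P" "total_degree_at_most d P"
    "\<And>x. x \<in> slice n k \<Longrightarrow> f x = evaluate P (\<lambda>i. real (x i))"
    using assms unfolding has_degree_on_slice_def by auto
  have finS: "finite S" and finQ: "finite Q"
    using *(1,2) finite_subset by auto
  define c where "c m = Poly_Mapping.lookup P m" for m
  define K where "K m = Poly_Mapping.keys m" for m :: "nat \<Rightarrow>\<^sub>0 nat"
  have f: "f (point n (Q \<union> T \<union> v ` (S - T))) =
      (\<Sum>m\<in>Poly_Mapping.keys P. c m * of_bool (K m \<subseteq> Q \<union> T \<union> v ` (S - T)))" if T: "T \<subseteq> S" for T
  proof -
    have finT: "finite T"
      using T finS by (rule finite_subset)
    have "card (v ` (S - T)) = card (S - T)"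
      using *(4) by (intro card_image) (auto intro: inj_on_subset)
    moreover have "card (S - T) = card S - card T" "card T \<le> card S"
      using T finS finT by (auto intro: card_Diff_subset card_mono)
    moreover have "card (Q \<union> T) = card Q + card T"
      using *(5) T finQ finT by (intro card_Un_disjoint) auto
    moreover have "card (Q \<union> T \<union> v ` (S - T)) = card (Q \<union> T) + card (v ` (S - T))"
      using *(6,7) T finQ finT finS by (intro card_Un_disjoint) auto
    ultimately have "card (Q \<union> T \<union> v ` (S - T)) = k"
      using *(9) by linarith
    moreover have "Q \<union> T \<union> v ` (S - T) \<subseteq> {1..n}"
      using *(1,2,3) T by blast
    ultimately show ?thesis
      using P(3)[OF point_in_slice] evaluate_point[OF P(1)] by (simp add: c_def K_def)
  qed
  have small: "card (K m) \<le> d" if m: "m \<in> Poly_Mapping.keys P" for m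
  proof -
    have "card (K m) = (\<Sum>i\<in>K m. 1)"
      by simp
    also have "\<dots> \<le> (\<Sum>i\<in>K m. Poly_Mapping.lookup m i)"
      by (intro sum_mono) (simp add: K_def in_keys_iff)
    also have "\<dots> \<le> d"
      using P(2) m unfolding total_degree_at_most_def K_def by blast
    finally show ?thesis .
  qed
  have "(\<Sum>T\<in>Pow S. (-1) ^ card T * f (point n (Q \<union> T \<union> v ` (S - T)))) =
      (\<Sum>T\<in>Pow S. \<Sum>m\<in>Poly_Mapping.keys P. c m * ((-1) ^ card T * of_bool (K m \<subseteq> Q \<union> T \<union> v ` (S - T))))"
  proof (intro sum.cong refl)
    fix T assume "T \<in> Pow S"
    then have "T \<subseteq> S"
      by simp
    show "(-1) ^ card T * f (point n (Q \<union> T \<union> v ` (S - T))) =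
        (\<Sum>m\<in>Poly_Mapping.keys P. c m * ((-1) ^ card T * of_bool (K m \<subseteq> Q \<union> T \<union> v ` (S - T))))"
      unfolding f[OF \<open>T \<subseteq> S\<close>] sum_distrib_left by (intro sum.cong refl) (simp only: mult_ac)
  qed
  also have "\<dots> = (\<Sum>m\<in>Poly_Mapping.keys P. c m * (\<Sum>T\<in>Pow S. (-1) ^ card T * of_bool (K m \<subseteq> Q \<union> T \<union> v ` (S - T))))"
    by (subst sum.swap) (simp only: sum_distrib_left)
  also have "\<dots> = (\<Sum>m\<in>Poly_Mapping.keys P. 0)"
  proof (intro sum.cong refl)
    fix m assume "m \<in> Poly_Mapping.keys P"
    then have "card (K m) < card S"
      using small[of m] *(8) by simp
    moreover have "finite (K m)"
      by (simp add: K_def)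
    ultimately have "(\<Sum>T\<in>Pow S. (-1) ^ card T * of_bool (K m \<subseteq> Q \<union> T \<union> v ` (S - T))) = (0 :: real)"
      using monomial_alternating_sum[OF finS *(4,7,5,6)] by simp
    then show "c m * (\<Sum>T\<in>Pow S. (-1) ^ card T * of_bool (K m \<subseteq> Q \<union> T \<union> v ` (S - T))) = 0"
      by simp
  qed
  finally show "(\<Sum>T\<in>Pow S. (-1) ^ card T * f (point n (Q \<union> T \<union> v ` (S - T)))) = 0"
    by simp
qed

section \<open>Juntas above the threshold\<close>

lemma k_bound_ge:
  assumes "s \<in> {1..d}"
  shows "k_bound A d \<ge> int d + int (d div s) * (int (W A s) - int s)"
  unfolding k_bound_def using assms by (intro add_left_mono Max_ge) auto

lemma k_bound_attained:
  assumes "d \<ge> 1"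
  obtains s where "s \<in> {1..d}" "k_bound A d = int d + int (d div s) * (int (W A s) - int s)"
proof -
  have "(MAX s\<in>{1..d}. int (d div s) * (int (W A s) - int s)) \<in>
      (\<lambda>s. int (d div s) * (int (W A s) - int s)) ` {1..d}"
    using assms by (intro Max_in) auto
  then show thesis
    using that unfolding k_bound_def by auto
qed

text \<open>
  The term of the maximum with \<open>s = (d - z) div b\<close> suffices. Since \<open>b \<le> d div s\<close> and \<open>z \<le> d - s * b\<close>, it is at least
  \<open>d + b * (W A s - s) = (d - s * b) + b * W A s\<close>.
\<close>

lemma k_bound_blocks:
  assumes A: "finite A" "card A \<ge> 2" and zb: "1 \<le> b" "z + b \<le> d"
  shows "int (z + b * W A ((d - z) div b)) \<le> k_bound A d"
proof -
  define s where "s = (d - z) div b"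
  have s1: "1 \<le> s"
    using zb unfolding s_def by (simp add: Suc_le_eq div_greater_zero_iff)
  have sb: "s * b \<le> d - z"
    unfolding s_def by (rule div_times_less_eq_dividend)
  then have sb': "s * b + z \<le> d"
    using zb by simp
  have "s \<le> s * b"
    using zb(1) by simp
  then have sd: "s \<in> {1..d}"
    using s1 sb' unfolding atLeastAtMost_iff by linarith
  have "b * s \<le> d"
    using sb' by (simp add: mult.commute)
  then have "b \<le> d div s"
    using s1 by (simp add: less_eq_div_iff_mult_less_eq)
  moreover have "s < W A s"
    using A s1 by (rule W_greater)
  ultimately have "int b * (int (W A s) - int s) \<le> int (d div s) * (int (W A s) - int s)"
    by (intro mult_right_mono) auto
  then have "int d + int b * (int (W A s) - int s) \<le> k_bound A d"
    using k_bound_ge[OF sd, of A] by simp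
  moreover have "int (z + b * W A s) \<le> int d + int b * (int (W A s) - int s)"
  proof -
    have "int s * int b + int z \<le> int d"
      using sb' by (metis of_nat_add of_nat_le_iff of_nat_mult)
    then show ?thesis
      by (simp add: algebra_simps)
  qed
  ultimately show ?thesis
    unfolding s_def by linarith
qed

text \<open>
  If \<open>n\<close> is bounded by a constant, all coordinates together are a junta. Otherwise \<open>n \<ge> 2 * k\<close> leaves, after
  lowering the weight to \<open>K\<close>, still at least half of the coordinates.
\<close>

lemma juntas_above_threshold:
  assumes A: "finite A" "card A \<ge> 2" and d: "d \<ge> 1"
  shows "\<exists>m. \<forall>k. int k \<ge> k_bound A d \<longrightarrow> (\<forall>n\<ge>2 * k. \<forall>f.
     valued_on_slice n k A f \<and> has_degree_on_slice n k d f \<longrightarrow> junta_on_slice n k m f)"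
proof -
  define K where "K = nat (k_bound A d)"
  have KK: "z + b * W A ((d - z) div b) \<le> K" if "1 \<le> b" "z + b \<le> d" for z b
    using k_bound_blocks[OF A that] unfolding K_def by linarith
  have "d \<le> K"
  proof -
    have "1 < W A 1"
      using W_greater[OF A, of 1] by simp
    then have "d \<le> d * W A 1"
      by simp
    also have "\<dots> \<le> K"
      using KK[of d 0] d by simp
    finally show ?thesis .
  qed
  have "\<exists>M N. \<forall>V F E. finite V \<longrightarrow> N \<le> card V \<longrightarrow> slice_degree d V K F \<longrightarrow>
     (\<forall>x. x \<subseteq> V \<longrightarrow> card x = K \<longrightarrow> F x \<in> A) \<longrightarrow> finite E \<longrightarrow> matching E \<longrightarrow>
     (\<forall>p\<in>E. sensitive V K F (fst p) (snd p)) \<longrightarrow> card E < M"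
    by (rule few_sensitive_pairs[OF A d]) (rule KK)
  then obtain M N where bound: "\<forall>V F E. finite V \<longrightarrow> N \<le> card V \<longrightarrow> slice_degree d V K F \<longrightarrow>
     (\<forall>x. x \<subseteq> V \<longrightarrow> card x = K \<longrightarrow> F x \<in> A) \<longrightarrow> finite E \<longrightarrow> matching E \<longrightarrow>
     (\<forall>p\<in>E. sensitive V K F (fst p) (snd p)) \<longrightarrow> card E < M"
    by (elim exE)
  define q where "q = M * (d + 1)"
  define n0 where "n0 = 2 * (N + q) + 2"
  define m where "m = n0 + 2 * M"
  have "junta_on_slice n k m f" if k: "int k \<ge> k_bound A d" and n: "n \<ge> 2 * k"
    and val: "valued_on_slice n k A f" and deg: "has_degree_on_slice n k d f" for n k f
  proof (cases "n \<le> n0")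
    case True
    have "f x = f (restrict x {1..n})" if "x \<in> slice n k" for x
      using that unfolding slice_def by (auto simp: PiE_restrict)
    then have "set_junta_on_slice n k {1..n} f"
      unfolding set_junta_on_slice_def by blast
    then show ?thesis
      unfolding junta_on_slice_def using True by (intro exI[of _ "{1..n}"]) (simp add: m_def)
  next
    case False
    define j where "j = k - K"
    have kj: "k = K + j"
      using k by (simp add: j_def K_def)
    define V where "V = {1..n}"
    define F where "F x = f (point n x)" for x
    have finV: "finite V" and cV: "card V = n"
      by (simp_all add: V_def)
    have degF: "slice_degree d V (K + j) F"
      using slice_degree_of_polynomial[OF deg] unfolding V_def F_def kj .
    have valF: "F x \<in> A" if "x \<subseteq> V" "card x = k" for x
      using val point_in_slice[of x n k] that unfolding valued_on_slice_def F_def V_def by auto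
    have few: "card E < M" if E: "finite E" "matching E" "\<forall>p\<in>E. sensitive V k F (fst p) (snd p)" for E
    proof (rule ccontr)
      assume "\<not> card E < M"
      then obtain E' where E': "E' \<subseteq> E" "card E' = M"
        by (meson not_less obtain_subset_with_card_n)
      have finE': "finite E'"
        using E'(1) E(1) by (rule finite_subset)
      have "card E' * (d + 1) + j < card V"
      proof -
        have "2 * q + 2 * j < 2 * n"
          using False n unfolding n0_def kj by simp
        then show ?thesis
          unfolding E'(2) cV q_def[symmetric] by simp
      qed
      moreover have "sensitive V (K + j) F (fst p) (snd p)" if "p \<in> E'" for p
        using E(3) E'(1) that unfolding kj by auto
      ultimately obtain T where T: "T \<subseteq> V" "card T = j" "slice_degree d (V - T) K (\<lambda>x. F (T \<union> x))"
        "\<forall>p\<in>E'. sensitive (V - T) K (\<lambda>x. F (T \<union> x)) (fst p) (snd p)"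
        using sensitive_pairs_survive[OF finV degF \<open>d \<le> K\<close> d finE'] by blast
      have finT: "finite T"
        using T(1) finV by (rule finite_subset)
      have "N \<le> card (V - T)"
      proof -
        have "2 * N + 2 * j < 2 * n"
          using False n unfolding n0_def kj by simp
        then show ?thesis
          unfolding card_Diff_subset[OF finT T(1)] cV T(2) by simp
      qed
      moreover have "\<forall>x. x \<subseteq> V - T \<longrightarrow> card x = K \<longrightarrow> F (T \<union> x) \<in> A"
      proof (intro allI impI)
        fix x assume x: "x \<subseteq> V - T" "card x = K"
        have "finite x"
          using x(1) finV finite_subset by blast
        then have "card (T \<union> x) = card T + card x"
          using x(1) finT by (intro card_Un_disjoint) auto
        then show "F (T \<union> x) \<in> A"
          using x T(1,2) kj by (intro valF) auto
      qed
      moreover have "matching E'"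
        using E(2) E'(1) unfolding matching_def by blast
      moreover have "finite (V - T)"
        using finV by simp
      ultimately have "card E' < M"
        using bound[rule_format, of "V - T" "\<lambda>x. F (T \<union> x)" E'] T(3,4) finE' by simp
      then show False
        using E'(2) by simp
    qed
    have "\<exists>J\<subseteq>V. card J \<le> 2 * M \<and>
        (\<forall>x y. x \<subseteq> V \<longrightarrow> y \<subseteq> V \<longrightarrow> card x = k \<longrightarrow> card y = k \<longrightarrow> x \<inter> J = y \<inter> J \<longrightarrow> F x = F y)"
      by (rule junta_if_few_sensitive_pairs[OF finV]) (rule few)
    then obtain J where J: "J \<subseteq> V" "card J \<le> 2 * M"
      and same: "\<forall>x y. x \<subseteq> V \<longrightarrow> y \<subseteq> V \<longrightarrow> card x = k \<longrightarrow> card y = k \<longrightarrow> x \<inter> J = y \<inter> J \<longrightarrow> F x = F y"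
      by (elim exE conjE)
    define g where "g \<xi> = f (SOME y. y \<in> slice n k \<and> restrict y J = \<xi>)" for \<xi>
    have "f y = g (restrict y J)" if y: "y \<in> slice n k" for y
    proof -
      define y' where "y' = (SOME y'. y' \<in> slice n k \<and> restrict y' J = restrict y J)"
      have y': "y' \<in> slice n k" "restrict y' J = restrict y J"
        unfolding y'_def using someI[of "\<lambda>y'. y' \<in> slice n k \<and> restrict y' J = restrict y J" y] y by auto
      obtain x where x: "x \<subseteq> {1..n}" "card x = k" "y = point n x"
        using y by (rule slice_cases)
      obtain x' where x': "x' \<subseteq> {1..n}" "card x' = k" "y' = point n x'"
        using y'(1) by (rule slice_cases)
      have "i \<in> x \<longleftrightarrow> i \<in> x'" if "i \<in> J" for i
      proof -
        have "y' i = y i"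
          using fun_cong[OF y'(2), of i] that by simp
        moreover have "i \<in> {1..n}"
          using that J(1) by (auto simp: V_def)
        ultimately show ?thesis
          unfolding x(3) x'(3) by (cases "i \<in> x"; cases "i \<in> x'") (simp_all add: point_def)
      qed
      then have "x \<inter> J = x' \<inter> J"
        by auto
      then have "F x = F x'"
        using same[rule_format, of x x'] x x' by (simp add: V_def)
      then have "f y = f y'"
        by (simp add: F_def x(3) x'(3))
      then show ?thesis
        by (simp add: g_def y'_def)
    qed
    then have "set_junta_on_slice n k J f"
      unfolding set_junta_on_slice_def by blast
    then show ?thesis
      unfolding junta_on_slice_def using J by (intro exI[of _ J]) (simp add: m_def V_def)
  qed
  then show ?thesis
    by blast
qed

section \<open>Non-juntas below the threshold\<close>

lemma evaluate_superset:
  assumes "finite M" "Poly_Mapping.keys P \<subseteq> M"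
  shows "evaluate P x = (\<Sum>m\<in>M. Poly_Mapping.lookup P m *
     (\<Prod>i\<in>Poly_Mapping.keys m. x i ^ Poly_Mapping.lookup m i))"
  unfolding evaluate_def using assms
  by (intro sum.mono_neutral_left) (auto simp: in_keys_iff)

lemma evaluate_add: "evaluate (P + Q) x = evaluate P x + evaluate Q x"
proof -
  let ?M = "Poly_Mapping.keys P \<union> Poly_Mapping.keys Q"
  show ?thesis
    using evaluate_superset[of ?M P x] evaluate_superset[of ?M Q x] evaluate_superset[of ?M "P + Q" x]
      Poly_Mapping.keys_add[of P Q]
    by (simp add: lookup_add distrib_right sum.distrib)
qed

lemma squarefree_monomial:
  assumes "finite (S :: nat set)"
  shows "\<exists>m :: nat \<Rightarrow>\<^sub>0 nat. Poly_Mapping.keys m = S \<and> (\<forall>i\<in>S. Poly_Mapping.lookup m i = 1)"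
proof -
  define m :: "nat \<Rightarrow>\<^sub>0 nat" where "m = Abs_poly_mapping (\<lambda>i. if i \<in> S then 1 else 0)"
  have m: "Poly_Mapping.lookup m i = (if i \<in> S then 1 else 0)" for i
    unfolding m_def using assms by (subst lookup_Abs_poly_mapping) auto
  have "Poly_Mapping.keys m = S"
    by (auto simp: in_keys_iff m split: if_splits)
  then show ?thesis
    using m by (intro exI[of _ m]) simp
qed

lemma multilinear_polynomial:
  assumes "finite I" "\<And>j. j \<in> I \<Longrightarrow> finite (S j) \<and> S j \<subseteq> V \<and> card (S j) \<le> d"
  shows "\<exists>P. in_variables V P \<and> total_degree_at_most d P \<and>
     (\<forall>x. evaluate P x = (\<Sum>j\<in>I. c j * (\<Prod>i\<in>S j. x i)))"
  using assms
proof (induction I rule: finite_induct)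
  case empty
  show ?case
    by (intro exI[of _ 0]) (simp add: in_variables_def total_degree_at_most_def evaluate_def)
next
  case (insert j I)
  then obtain P where P: "in_variables V P" "total_degree_at_most d P"
     "\<And>x. evaluate P x = (\<Sum>j\<in>I. c j * (\<Prod>i\<in>S j. x i))"
    by auto
  have Sj: "finite (S j)" "S j \<subseteq> V" "card (S j) \<le> d"
    using insert.prems by auto
  obtain m :: "nat \<Rightarrow>\<^sub>0 nat" where m: "Poly_Mapping.keys m = S j" "\<forall>i\<in>S j. Poly_Mapping.lookup m i = 1"
    using squarefree_monomial[OF Sj(1)] by (elim exE conjE)
  define Q where "Q = Poly_Mapping.single m (c j)"
  have keysQ: "Poly_Mapping.keys Q \<subseteq> {m}"
    by (simp add: Q_def)
  have "evaluate Q x = c j * (\<Prod>i\<in>S j. x i)" for x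
    using evaluate_superset[OF _ keysQ, of x] m by (simp add: Q_def)
  then have "\<forall>x. evaluate (P + Q) x = (\<Sum>j\<in>insert j I. c j * (\<Prod>i\<in>S j. x i))"
    using insert.hyps P(3) by (simp add: evaluate_add add.commute)
  moreover have keys: "m' \<in> Poly_Mapping.keys P \<or> m' = m" if "m' \<in> Poly_Mapping.keys (P + Q)" for m'
    using that keys_add[of P Q] keysQ by auto
  have "in_variables V (P + Q)"
    using P(1) Sj(2) m(1) keys unfolding in_variables_def by metis
  moreover have "(\<Sum>i\<in>Poly_Mapping.keys m. Poly_Mapping.lookup m i) \<le> d"
    using Sj(3) m by simp
  then have "total_degree_at_most d (P + Q)"
    using P(2) keys unfolding total_degree_at_most_def by metis
  ultimately show ?case
    by blast
qed

text \<open>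
  Subtracting a multiple of \<open>binomial_poly s\<close> removes the coefficient of degree \<open>s\<close>.
\<close>

lemma newton_expansion:
  assumes "degree (P :: real poly) \<le> s"
  shows "\<exists>\<gamma>. \<forall>j. poly P (real j) = (\<Sum>u\<le>s. \<gamma> u * real (j choose u))"
  using assms
proof (induction s arbitrary: P)
  case 0
  then obtain c where "P = [:c:]"
    by (metis degree_0_id le_zero_eq)
  then show ?case
    by (intro exI[of _ "\<lambda>_. c"]) simp
next
  case (Suc s)
  define B where "B = binomial_poly (Suc s)"
  have dB: "degree B = Suc s"
    unfolding B_def by (rule degree_binomial_poly)
  then have "coeff B (Suc s) \<noteq> 0"
    by (metis degree_0 leading_coeff_0_iff nat.distinct(1))
  define \<beta> where "\<beta> = coeff P (Suc s) / coeff B (Suc s)"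
  have "degree (P - smult \<beta> B) \<le> s"
  proof (rule degree_le, intro allI impI)
    fix i assume "s < i"
    then consider "i = Suc s" | "Suc s < i"
      by linarith
    then show "coeff (P - smult \<beta> B) i = 0"
    proof cases
      case 1
      then show ?thesis
        using \<open>coeff B (Suc s) \<noteq> 0\<close> by (simp add: \<beta>_def)
    next
      case 2
      then show ?thesis
        using Suc.prems dB by (simp add: coeff_eq_0)
    qed
  qed
  then obtain \<gamma> where \<gamma>: "\<And>j. poly (P - smult \<beta> B) (real j) = (\<Sum>u\<le>s. \<gamma> u * real (j choose u))"
    using Suc.IH by blast
  have "poly P (real j) = (\<Sum>u\<le>Suc s. (\<gamma>(Suc s := \<beta>)) u * real (j choose u))" for j
  proof -
    have "poly P (real j) = poly (P - smult \<beta> B) (real j) + \<beta> * real (j choose Suc s)"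
      by (simp add: B_def poly_binomial_poly)
    also have "poly (P - smult \<beta> B) (real j) = (\<Sum>u\<le>s. (\<gamma>(Suc s := \<beta>)) u * real (j choose u))"
      unfolding \<gamma> by (intro sum.cong) auto
    finally show ?thesis
      by simp
  qed
  then show ?case
    by blast
qed

lemma not_junta:
  assumes "\<And>J. J \<subseteq> {1..n} \<Longrightarrow> card J \<le> m \<Longrightarrow>
     \<exists>x y. x \<in> slice n k \<and> y \<in> slice n k \<and> restrict x J = restrict y J \<and> f x \<noteq> f y"
  shows "\<not> junta_on_slice n k m f"
  using assms unfolding junta_on_slice_def set_junta_on_slice_def by metis

lemma poly_step:
  assumes "degree (P :: real poly) \<le> s" "\<nexists>c. P = [:c:]"
  shows "\<exists>c<s. poly P (real c) \<noteq> poly P (real (Suc c))"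
proof (rule ccontr)
  assume "\<not> ?thesis"
  then have step: "\<And>c. c < s \<Longrightarrow> poly P (real c) = poly P (real (Suc c))"
    by blast
  have const: "c \<le> s \<Longrightarrow> poly P (real c) = poly P 0" for c
    by (induction c) (use step in auto)
  have "P = [:poly P 0:]"
  proof (rule poly_constI)
    show "degree P < card (real ` {..s})"
      using assms(1) by (simp add: card_image)
    show "poly P x = poly P 0" if "x \<in> real ` {..s}" for x
      using that const by auto
  qed
  then show False
    using assms(2) by blast
qed

text \<open>
  The blocks start behind \<open>{1..r}\<close>, whose coordinates are used as a common factor.
\<close>

definition block :: "nat \<Rightarrow> nat \<Rightarrow> nat \<Rightarrow> nat set" where
  "block r t i = {r + i * t<..r + Suc i * t}"

lemma card_block: "card (block r t i) = t" and finite_block: "finite (block r t i)"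
  by (simp_all add: block_def)

lemma block_disjoint:
  assumes "i \<noteq> j" shows "block r t i \<inter> block r t j = {}"
proof -
  have "block r t i \<inter> block r t j = {}" if "i < j" for i j
  proof -
    have "Suc i * t \<le> j * t"
      using that by (intro mult_le_mono1) simp
    then show ?thesis
      by (auto simp: block_def)
  qed
  then show ?thesis
    using assms by (metis Int_commute nat_neq_iff)
qed

lemma block_bounds:
  assumes "x \<in> block r t i" "i < N"
  shows "r < x" "x \<le> r + N * t"
proof -
  have "Suc i * t \<le> N * t"
    using assms(2) by (intro mult_le_mono1) simp
  then show "r < x" "x \<le> r + N * t"
    using assms(1) by (auto simp: block_def)
qed

lemma card_blocks_union:
  assumes "finite I"
  shows "card (\<Union>i\<in>I. block r t i) = card I * t"
proof -
  have "card (\<Union>i\<in>I. block r t i) = (\<Sum>i\<in>I. card (block r t i))"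
    using assms block_disjoint by (intro card_UN_disjoint) (auto simp: finite_block)
  then show ?thesis
    by (simp add: card_block)
qed

definition full_blocks :: "nat \<Rightarrow> nat \<Rightarrow> nat \<Rightarrow> nat set \<Rightarrow> nat set" where
  "full_blocks r t N x = {i. i < N \<and> block r t i \<subseteq> x}"

text \<open>
  As a polynomial this is \<open>P(0) + x\<^sub>1 \<cdots> x\<^sub>r (P(y\<^sub>1 + \<cdots> + y\<^sub>N) - P(0))\<close>, where \<open>y\<^sub>i\<close> is the product of the \<open>t\<close> variables of
  the block with index \<open>i\<close>.
\<close>

definition block_function :: "real poly \<Rightarrow> nat \<Rightarrow> nat \<Rightarrow> nat \<Rightarrow> nat set \<Rightarrow> real" where
  "block_function P r t N x =
     (if {1..r} \<subseteq> x then poly P (real (card (full_blocks r t N x))) else poly P 0)"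

lemma finite_full_blocks: "finite (full_blocks r t N x)"
  unfolding full_blocks_def by simp

lemma full_blocks_weight:
  assumes "finite x" "{1..r} \<subseteq> x"
  shows "r + card (full_blocks r t N x) * t \<le> card x"
proof -
  have "card ({1..r} \<union> (\<Union>i\<in>full_blocks r t N x. block r t i)) =
      card {1..r} + card (\<Union>i\<in>full_blocks r t N x. block r t i)"
  proof (rule card_Un_disjoint)
    show "finite (\<Union>i\<in>full_blocks r t N x. block r t i)"
      by (simp add: finite_full_blocks finite_block)
    show "{1..r} \<inter> (\<Union>i\<in>full_blocks r t N x. block r t i) = {}"
      by (auto simp: block_def)
  qed simp
  also have "\<dots> = r + card (full_blocks r t N x) * t"
    by (simp add: card_blocks_union finite_full_blocks)
  finally show ?thesis
    using assms by (metis (no_types, lifting) UN_least Un_least card_mono full_blocks_def mem_Collect_eq)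
qed

text \<open>
  In the expansion of \<open>P\<close> in binomial coefficients, the binomial coefficient \<open>q choose u\<close> at the number \<open>q\<close> of full blocks counts
  the \<open>u\<close>-element families of full blocks, and a family is full when one squarefree monomial is one.
\<close>

lemma block_function_multilinear:
  assumes "degree P \<le> s"
  shows "\<exists>\<gamma>. \<forall>x. block_function P r t N x = poly P 0 +
     (\<Sum>T\<in>{T\<in>Pow {..<N}. 1 \<le> card T \<and> card T \<le> s}.
        \<gamma> (card T) * of_bool ({1..r} \<union> (\<Union>i\<in>T. block r t i) \<subseteq> x))"
proof -
  obtain \<gamma> where \<gamma>: "\<And>j. poly P (real j) = (\<Sum>u\<le>s. \<gamma> u * real (j choose u))"
    using newton_expansion[OF assms] by blast
  have zero: "poly P 0 = \<gamma> 0"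
  proof -
    have "poly P (real 0) = (\<Sum>u\<le>s. if u = 0 then \<gamma> 0 else 0)"
      unfolding \<gamma> by (intro sum.cong) auto
    then show ?thesis
      by simp
  qed
  let ?I = "{T\<in>Pow {..<N}. 1 \<le> card T \<and> card T \<le> s}"
  have "block_function P r t N x = poly P 0 +
     (\<Sum>T\<in>?I. \<gamma> (card T) * of_bool ({1..r} \<union> (\<Union>i\<in>T. block r t i) \<subseteq> x))" for x
  proof (cases "{1..r} \<subseteq> x")
    case False
    then show ?thesis
      by (simp add: block_function_def)
  next
    case True
    let ?B = "full_blocks r t N x"
    have "poly P (real (card ?B)) = (\<Sum>u\<in>{..s}. \<gamma> u * real (card ?B choose u))"
      by (rule \<gamma>)
    also have "\<dots> = \<gamma> 0 + (\<Sum>u\<in>{1..s}. \<gamma> u * real (card ?B choose u))"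
    proof -
      have "{..s} = insert 0 {1..s}"
        by auto
      then show ?thesis
        by simp
    qed
    also have "(\<Sum>u\<in>{1..s}. \<gamma> u * real (card ?B choose u)) =
        (\<Sum>u\<in>{1..s}. \<Sum>T\<in>{T. T \<subseteq> ?B \<and> card T = u}. \<gamma> u)"
      by (simp add: n_subsets[OF finite_full_blocks] mult.commute)
    also have "\<dots> = (\<Sum>u\<in>{1..s}. \<Sum>T\<in>{T \<in> {T. T \<subseteq> ?B \<and> 1 \<le> card T \<and> card T \<le> s}. card T = u}. \<gamma> (card T))"
      by (intro sum.cong) auto
    also have "\<dots> = (\<Sum>T\<in>{T. T \<subseteq> ?B \<and> 1 \<le> card T \<and> card T \<le> s}. \<gamma> (card T))"
      by (intro sum.group) (auto simp: finite_full_blocks)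
    also have "\<dots> = (\<Sum>T\<in>?I. if T \<subseteq> ?B then \<gamma> (card T) else 0)"
      by (intro sum.mono_neutral_cong_left) (auto simp: full_blocks_def)
    also have "\<dots> = (\<Sum>T\<in>?I. \<gamma> (card T) * of_bool ({1..r} \<union> (\<Union>i\<in>T. block r t i) \<subseteq> x))"
    proof (intro sum.cong refl)
      fix T assume "T \<in> ?I"
      then have "T \<subseteq> {..<N}"
        by simp
      then have "T \<subseteq> ?B \<longleftrightarrow> {1..r} \<union> (\<Union>i\<in>T. block r t i) \<subseteq> x"
        using True unfolding full_blocks_def by auto
      then show "(if T \<subseteq> ?B then \<gamma> (card T) else 0) =
          \<gamma> (card T) * of_bool ({1..r} \<union> (\<Union>i\<in>T. block r t i) \<subseteq> x)"
        by simp
    qed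
    finally show ?thesis
      using True by (simp add: block_function_def zero)
  qed
  then show ?thesis
    by blast
qed

lemma block_function_degree:
  assumes deg: "degree P \<le> s" and d: "s * t + r \<le> d" and n: "r + N * t \<le> n"
  shows "has_degree_on_slice n k d (\<lambda>y. block_function P r t N {i\<in>{1..n}. y i = 1})"
proof -
  obtain \<gamma> where \<gamma>: "\<And>x. block_function P r t N x = poly P 0 +
     (\<Sum>T\<in>{T\<in>Pow {..<N}. 1 \<le> card T \<and> card T \<le> s}.
        \<gamma> (card T) * of_bool ({1..r} \<union> (\<Union>i\<in>T. block r t i) \<subseteq> x))"
    using block_function_multilinear[OF deg] by blast
  define I where "I = {T\<in>Pow {..<N}. 1 \<le> card T \<and> card T \<le> s}"
  \<comment> \<open>The empty index carries the constant term, whose monomial must not contain \<open>{1..r}\<close>.\<close>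
  define S where "S T = (if T = {} then {} else {1..r} \<union> (\<Union>i\<in>T. block r t i))" for T
  define c where "c T = (if T = {} then poly P 0 else \<gamma> (card T))" for T :: "nat set"
  have I: "T \<subseteq> {..<N}" "card T \<le> s" "finite T" "T \<noteq> {}" if "T \<in> I" for T
    using that finite_subset[of T "{..<N}"] unfolding I_def by auto
  have finI: "finite (insert {} I)" and "{} \<notin> I"
    by (simp_all add: I_def)
  have S: "finite (S T) \<and> S T \<subseteq> {1..n} \<and> card (S T) \<le> d" if "T \<in> insert {} I" for T
  proof (cases "T = {}")
    case False
    then have T: "T \<subseteq> {..<N}" "card T \<le> s" "finite T"
      using I[of T] that by auto
    have ST: "S T = {1..r} \<union> (\<Union>i\<in>T. block r t i)"
      using False by (simp add: S_def)
    have "finite (S T)"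
      unfolding ST using T(3) by (simp add: finite_block)
    moreover have "S T \<subseteq> {1..n}"
    proof
      fix x assume "x \<in> S T"
      then consider "x \<in> {1..r}" | i where "i \<in> T" "x \<in> block r t i"
        unfolding ST by blast
      then show "x \<in> {1..n}"
      proof cases
        case 1
        then show ?thesis
          using n by auto
      next
        case 2
        then show ?thesis
          using block_bounds[of x r t i N] T(1) n by fastforce
      qed
    qed
    moreover have "card (S T) \<le> r + card T * t"
      using card_Un_le[of "{1..r}" "\<Union>i\<in>T. block r t i"] card_blocks_union[OF T(3), of r t] unfolding ST by simp
    moreover have "card T * t \<le> s * t"
      using T(2) by (rule mult_le_mono1)
    ultimately show ?thesis
      using d by linarith
  qed (simp add: S_def)
  obtain Q where Q: "in_variables {1..n} Q" "total_degree_at_most d Q"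
    "\<And>x. evaluate Q x = (\<Sum>T\<in>insert {} I. c T * (\<Prod>i\<in>S T. x i))"
    using multilinear_polynomial[OF finI S, of "\<lambda>T. T" c] by blast
  have "block_function P r t N {i\<in>{1..n}. y i = 1} = evaluate Q (\<lambda>i. real (y i))" if y: "y \<in> slice n k" for y
  proof -
    let ?x = "{i\<in>{1..n}. y i = 1}"
    have y01: "y i = 0 \<or> y i = 1" if "i \<in> {1..n}" for i
      using y that unfolding slice_def by auto
    have prod: "(\<Prod>i\<in>S T. real (y i)) = of_bool (S T \<subseteq> ?x)" if T: "T \<in> insert {} I" for T
    proof (cases "S T \<subseteq> ?x")
      case True
      then have "\<And>i. i \<in> S T \<Longrightarrow> y i = 1"
        by auto
      then show ?thesis
        using True by (simp add: prod.neutral)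
    next
      case False
      then obtain i where i: "i \<in> S T" "i \<notin> ?x"
        by blast
      then have "y i = 0"
        using S[OF T] y01[of i] by auto
      then have "(\<Prod>i\<in>S T. real (y i)) = 0"
        using S[OF T] i(1) by (intro prod_zero) auto
      then show ?thesis
        using False by simp
    qed
    have "evaluate Q (\<lambda>i. real (y i)) = (\<Sum>T\<in>insert {} I. c T * of_bool (S T \<subseteq> ?x))"
      unfolding Q(3) by (intro sum.cong refl) (simp only: prod)
    also have "\<dots> = c {} * of_bool (S {} \<subseteq> ?x) + (\<Sum>T\<in>I. c T * of_bool (S T \<subseteq> ?x))"
      using finI \<open>{} \<notin> I\<close> by (intro sum.insert) auto
    also have "c {} * of_bool (S {} \<subseteq> ?x) = poly P 0"
      by (simp add: c_def S_def)
    also have "(\<Sum>T\<in>I. c T * of_bool (S T \<subseteq> ?x)) =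
        (\<Sum>T\<in>I. \<gamma> (card T) * of_bool ({1..r} \<union> (\<Union>i\<in>T. block r t i) \<subseteq> ?x))"
    proof (intro sum.cong refl)
      fix T assume "T \<in> I"
      then have "T \<noteq> {}"
        using I by blast
      then show "c T * of_bool (S T \<subseteq> ?x) = \<gamma> (card T) * of_bool ({1..r} \<union> (\<Union>i\<in>T. block r t i) \<subseteq> ?x)"
        by (simp only: c_def S_def if_False)
    qed
    finally show ?thesis
      unfolding \<gamma> I_def[symmetric] by simp
  qed
  then show ?thesis
    unfolding has_degree_on_slice_def using Q(1,2) by blast
qed

lemma block_function_support:
  assumes t: "1 \<le> t" and I: "I \<subseteq> {..<N}" and D: "D \<inter> {1..r + N * t} = {}"
  shows "full_blocks r t N ({1..r} \<union> (\<Union>i\<in>I. block r t i) \<union> D) = I"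
proof
  show "I \<subseteq> full_blocks r t N ({1..r} \<union> (\<Union>i\<in>I. block r t i) \<union> D)"
    using I unfolding full_blocks_def by auto
  show "full_blocks r t N ({1..r} \<union> (\<Union>i\<in>I. block r t i) \<union> D) \<subseteq> I"
  proof
    fix i assume "i \<in> full_blocks r t N ({1..r} \<union> (\<Union>i\<in>I. block r t i) \<union> D)"
    then have i: "i < N" "block r t i \<subseteq> {1..r} \<union> (\<Union>i\<in>I. block r t i) \<union> D"
      unfolding full_blocks_def by auto
    define x where "x = r + Suc i * t"
    have x: "x \<in> block r t i"
      using t by (simp add: x_def block_def)
    have "x \<notin> {1..r}" "x \<in> {1..r + N * t}"
      using block_bounds[OF x i(1)] by auto
    then have "x \<notin> {1..r} \<union> D"
      using D by blast
    then obtain j where "j \<in> I" "x \<in> block r t j"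
      using i(2) x by blast
    then show "i \<in> I"
      using block_disjoint[of i j r t] x by blast
  qed
qed

text \<open>
  Given \<open>J\<close>, more than \<open>c\<close> blocks avoid \<open>J\<close>, where \<open>c < s\<close> is a place at which \<open>P\<close> changes. Filling \<open>c\<close> or \<open>c + 1\<close> of these
  blocks, and putting the remaining weight on coordinates behind all blocks and outside \<open>J\<close>, gives two points
  that agree on \<open>J\<close>. Since \<open>r + s * t \<le> k\<close>, the weight suffices for \<open>c + 1\<close> blocks.
\<close>

lemma block_function_not_junta:
  assumes deg: "degree P \<le> s" and nc: "\<nexists>c. P = [:c:]" and t: "1 \<le> t" and k: "r + s * t \<le> k"
    and N: "N = m + s" and n: "n = r + N * t + k + m"
  shows "\<not> junta_on_slice n k m (\<lambda>y. block_function P r t N {i\<in>{1..n}. y i = 1})"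
proof (rule not_junta)
  fix J assume J: "J \<subseteq> {1..n}" "card J \<le> m"
  have finJ: "finite J"
    using J(1) finite_subset by auto
  obtain c where c: "c < s" "poly P (real c) \<noteq> poly P (real (Suc c))"
    using poly_step[OF deg nc] by blast
  define hit where "hit = {i. i < N \<and> block r t i \<inter> J \<noteq> {}}"
  have "card hit \<le> card J"
  proof -
    have "\<forall>i. \<exists>x. i \<in> hit \<longrightarrow> x \<in> block r t i \<inter> J"
      unfolding hit_def by blast
    from choice[OF this] obtain h where "\<forall>i. i \<in> hit \<longrightarrow> h i \<in> block r t i \<inter> J" ..
    then have h: "h i \<in> block r t i" "h i \<in> J" if "i \<in> hit" for i
      using that by simp_all
    have "inj_on h hit"
    proof (rule inj_onI)
      fix i j assume "i \<in> hit" "j \<in> hit" "h i = h j"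
      then show "i = j"
        using h(1)[of i] h(1)[of j] block_disjoint[of i j r t] by auto
    qed
    then show ?thesis
      using h(2) finJ by (intro card_inj_on_le[of h]) auto
  qed
  moreover have "card ({..<N} - hit) = N - card hit"
  proof -
    have "hit \<subseteq> {..<N}"
      unfolding hit_def by auto
    then show ?thesis
      using card_Diff_subset[of hit "{..<N}"] finite_subset by fastforce
  qed
  ultimately have "Suc c \<le> card ({..<N} - hit)"
    using J(2) c(1) N by simp
  then obtain I where I: "I \<subseteq> {..<N} - hit" "card I = Suc c"
    by (meson obtain_subset_with_card_n)
  have finI: "finite I"
    using I(1) finite_subset by auto
  obtain i0 where i0: "i0 \<in> I"
    using I(2) by fastforce
  have cI': "card (I - {i0}) = c"
    using I(2) i0 finI by simp
  have free: "block r t i \<inter> J = {}" if "i \<in> I" for i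
    using that I(1) unfolding hit_def by auto
  define D where "D = {r + N * t<..n} - J"
  have "k \<le> card D"
  proof -
    have "card {r + N * t<..n} - card J \<le> card D"
      unfolding D_def using finJ by (rule diff_card_le_card_Diff)
    then show ?thesis
      using J(2) n by simp
  qed
  have witness: "\<exists>x. x \<subseteq> {1..n} \<and> card x = k \<and> x \<inter> J = {1..r} \<inter> J \<and>
      block_function P r t N x = poly P (real (card I'))" if I': "I' \<subseteq> I" for I'
  proof -
    have finI': "finite I'"
      using I' finI by (rule finite_subset)
    have "card I' \<le> s"
      using card_mono[OF finI I'] I(2) c(1) by simp
    then have "card I' * t \<le> s * t"
      by (rule mult_le_mono1)
    then have le: "r + card I' * t \<le> k"
      using k by linarith
    have "k - (r + card I' * t) \<le> card D"
      using \<open>k \<le> card D\<close> by simp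
    then obtain D' where D': "D' \<subseteq> D" "card D' = k - (r + card I' * t)"
      by (meson obtain_subset_with_card_n)
    have finD': "finite D'"
      using D'(1) finite_subset[of D' "{r + N * t<..n}"] unfolding D_def by auto
    have D'0: "D' \<inter> {1..r + N * t} = {}"
      using D'(1) unfolding D_def by auto
    define x where "x = {1..r} \<union> (\<Union>i\<in>I'. block r t i) \<union> D'"
    have I'N: "I' \<subseteq> {..<N}"
      using I' I(1) by auto
    have blk: "r < j" "j \<le> r + N * t" if "i \<in> I'" "j \<in> block r t i" for i j
      using block_bounds[OF that(2), of N] I'N that(1) by auto
    have "card ({1..r} \<union> (\<Union>i\<in>I'. block r t i)) = card {1..r} + card (\<Union>i\<in>I'. block r t i)"
      using blk(1) finI' by (intro card_Un_disjoint) (auto simp: finite_block not_less[symmetric])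
    then have "card ({1..r} \<union> (\<Union>i\<in>I'. block r t i)) = r + card I' * t"
      by (simp add: card_blocks_union[OF finI'])
    moreover have "card x = card ({1..r} \<union> (\<Union>i\<in>I'. block r t i)) + card D'"
      unfolding x_def
    proof (rule card_Un_disjoint)
      show "finite ({1..r} \<union> (\<Union>i\<in>I'. block r t i))"
        using finI' by (simp add: finite_block)
      have "{1..r} \<union> (\<Union>i\<in>I'. block r t i) \<subseteq> {1..r + N * t}"
        using blk by fastforce
      then show "({1..r} \<union> (\<Union>i\<in>I'. block r t i)) \<inter> D' = {}"
        using D'0 by blast
    qed (rule finD')
    ultimately have "card x = k"
      using D'(2) le by simp
    moreover have "x \<subseteq> {1..n}"
    proof
      fix j assume "j \<in> x"
      then consider "j \<in> {1..r}" | i where "i \<in> I'" "j \<in> block r t i" | "j \<in> D'"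
        unfolding x_def by blast
      then show "j \<in> {1..n}"
      proof cases
        case 1
        then show ?thesis
          using n by simp
      next
        case 2
        then show ?thesis
          using blk[OF 2] n by simp
      next
        case 3
        then have "j \<in> {r + N * t<..n}"
          using D'(1) unfolding D_def by blast
        then show ?thesis
          by simp
      qed
    qed
    moreover have "x \<inter> J = {1..r} \<inter> J"
      using free I' D'(1) unfolding x_def D_def by blast
    moreover have "block_function P r t N x = poly P (real (card I'))"
      using block_function_support[OF t I'N D'0] unfolding block_function_def x_def by auto
    ultimately show ?thesis
      by blast
  qed
  obtain x where x: "x \<subseteq> {1..n}" "card x = k" "x \<inter> J = {1..r} \<inter> J"
      "block_function P r t N x = poly P (real (Suc c))"
    using witness[of I] I(2) by auto
  obtain x' where x': "x' \<subseteq> {1..n}" "card x' = k" "x' \<inter> J = {1..r} \<inter> J"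
      "block_function P r t N x' = poly P (real c)"
    using witness[of "I - {i0}"] cI' by auto
  have set: "{i\<in>{1..n}. point n y i = 1} = y" if "y \<subseteq> {1..n}" for y
    using that by (auto simp: point_def split: if_splits)
  have "restrict (point n x) J = restrict (point n x') J"
  proof
    fix i
    have "i \<in> x \<longleftrightarrow> i \<in> x'" if "i \<in> J"
      using x(3) x'(3) that by blast
    then show "restrict (point n x) J i = restrict (point n x') J i"
      by (simp add: point_def restrict_def)
  qed
  moreover have "block_function P r t N {i\<in>{1..n}. point n x i = 1} \<noteq>
      block_function P r t N {i\<in>{1..n}. point n x' i = 1}"
    unfolding set[OF x(1)] set[OF x'(1)] x(4) x'(4) using c(2) by simp
  ultimately show "\<exists>x y. x \<in> slice n k \<and> y \<in> slice n k \<and> restrict x J = restrict y J \<and>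
      block_function P r t N {i\<in>{1..n}. x i = 1} \<noteq> block_function P r t N {i\<in>{1..n}. y i = 1}"
    using point_in_slice[OF x(1,2)] point_in_slice[OF x'(1,2)] by blast
qed

text \<open>
  When \<open>{1..r}\<close> is contained in a set of size \<open>k < r + w * t\<close>, fewer than \<open>w\<close> blocks can be full.
\<close>

lemma non_juntas_from_polynomial:
  assumes deg: "degree P \<le> s" and nc: "\<nexists>c. P = [:c:]" and val: "\<And>i. i < w \<Longrightarrow> poly P (real i) \<in> A"
    and t: "1 \<le> t" and d: "s * t + r \<le> d" and k: "r + s * t \<le> k" "k < r + w * t"
  shows "\<exists>n\<ge>2 * k. \<exists>f. valued_on_slice n k A f \<and> has_degree_on_slice n k d f \<and> \<not> junta_on_slice n k m f"
proof -
  \<comment> \<open>Nonjuntas for the larger size \<open>m + k\<close> are built, so that the padding also makes \<open>n \<ge> 2 * k\<close>.\<close>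
  define N where "N = m + k + s"
  define n where "n = r + N * t + k + (m + k)"
  define f where "f y = block_function P r t N {i\<in>{1..n}. y i = 1}" for y :: "nat \<Rightarrow> nat"
  have "\<not> junta_on_slice n k (m + k) f"
    unfolding f_def by (rule block_function_not_junta[OF deg nc t k(1)]) (simp_all add: N_def n_def)
  then have "\<not> junta_on_slice n k m f"
    unfolding junta_on_slice_def by (meson le_add1 le_trans)
  moreover have "has_degree_on_slice n k d f"
    unfolding f_def by (rule block_function_degree[OF deg d]) (simp add: n_def)
  moreover have "valued_on_slice n k A f"
    unfolding valued_on_slice_def
  proof
    fix y assume "y \<in> slice n k"
    then obtain x where x: "x \<subseteq> {1..n}" "card x = k" "y = point n x"
      by (rule slice_cases)
    have set: "{i\<in>{1..n}. y i = 1} = x"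
      using x(1) unfolding x(3) by (auto simp: point_def split: if_splits)
    have w: "0 < w"
      using k by (cases w) auto
    show "f y \<in> A"
    proof (cases "{1..r} \<subseteq> x")
      case True
      have "finite x"
        using x(1) finite_subset by auto
      then have "r + card (full_blocks r t N x) * t \<le> k"
        using full_blocks_weight[OF _ True] x(2) by simp
      then have "card (full_blocks r t N x) * t < w * t"
        using k(2) by linarith
      then have "card (full_blocks r t N x) < w"
        by simp
      then show ?thesis
        unfolding f_def set block_function_def using True val by simp
    next
      case False
      then show ?thesis
        unfolding f_def set block_function_def using val[OF w] by simp
    qed
  qed
  moreover have "2 * k \<le> n"
    by (simp add: n_def)
  ultimately show ?thesis
    by blast
qed

text \<open>
  For \<open>k \<ge> d\<close> the parameters come from a term that attains the maximum in \<open>k_bound\<close>. For \<open>k < d\<close> a single full block of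
  \<open>k\<close> coordinates uses up the weight, and a linear polynomial in the number of full blocks, which is 0 or 1, has
  degree \<open>k\<close>.
\<close>

lemma non_juntas_below_threshold:
  assumes A: "finite A" "card A \<ge> 2" and d: "d \<ge> 1" and k: "1 \<le> k" "int k < k_bound A d"
  shows "\<exists>n\<ge>2 * k. \<exists>f. valued_on_slice n k A f \<and> has_degree_on_slice n k d f \<and> \<not> junta_on_slice n k m f"
proof (cases "k < d")
  case True
  obtain a b where ab: "a \<in> A" "b \<in> A" "a \<noteq> b"
    using A(2) by (metis card_2_iff' obtain_subset_with_card_n subsetD)
  show ?thesis
  proof (rule non_juntas_from_polynomial[where P="[:a, b - a:]" and s=1 and t=k and r=0 and w=2])
    show "poly [:a, b - a:] (real i) \<in> A" if "i < 2" for i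
      using that ab by (auto simp: less_2_cases_iff)
    show "\<nexists>c. [:a, b - a:] = [:c:]"
      using ab(3) by simp
  qed (use True k in auto)
next
  case False
  obtain s where s: "s \<in> {1..d}" "k_bound A d = int d + int (d div s) * (int (W A s) - int s)"
    using k_bound_attained[OF d] by blast
  have sW: "s < W A s"
    using W_greater[OF A] s(1) by simp
  then obtain P where P: "degree P \<le> s" "\<And>i. i < W A s \<Longrightarrow> poly P (real i) \<in> A" "\<nexists>c. P = [:c:]"
    using W_attained by (metis less_nat_zero_code not_gr_zero)
  define t where "t = d div s"
  define r where "r = d mod s"
  have dst: "r + s * t = d"
    unfolding r_def t_def by simp
  have "1 \<le> t"
    using s(1) unfolding t_def by (simp add: Suc_le_eq div_greater_zero_iff)
  moreover have "k < r + W A s * t"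
  proof -
    have "int k < int (r + s * t) + int t * (int (W A s) - int s)"
      using k(2) unfolding s(2) dst t_def[symmetric] .
    then have "int k < int (r + W A s * t)"
      by (simp add: algebra_simps)
    then show ?thesis
      by (simp only: of_nat_less_iff)
  qed
  ultimately show ?thesis
    using False dst P
    by (intro non_juntas_from_polynomial[where P=P and s=s and t=t and r=r and w="W A s"]) auto
qed

section \<open>Arithmetic progressions and the threshold theorem\<close>

text \<open>
  For every \<open>A\<close> the bound \<open>W A s \<le> s * card A\<close> shows that the maximum is at most \<open>d * (card A - 1)\<close>. A linear
  polynomial that runs through the progression gives \<open>W A 1 = card A\<close>, so that the bound is attained at \<open>s = 1\<close>.
\<close>

lemma k_bound_arithmetic_progression:
  assumes A: "finite A" "card A \<ge> 2" and d: "d \<ge> 1" and ap: "arithmetic_progression A"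
  shows "k_bound A d = int (card A * d)"
proof -
  obtain a b l where ab: "b \<noteq> 0" "A = (\<lambda>i. a + real i * b) ` {..<l}"
    using ap unfolding arithmetic_progression_def by blast
  have "inj_on (\<lambda>i. a + real i * b) {..<l}"
    using ab(1) by (intro inj_onI) simp
  then have l: "card A = l"
    unfolding ab(2) by (simp add: card_image)
  have "l - 1 < W A 1"
  proof (rule W_greater_if_nonconstant[OF A(1)])
    show "degree [:a, b:] \<le> 1"
      by simp
    show "poly [:a, b:] (real i) \<in> A" if "i \<le> l - 1" for i
    proof -
      have "i < l"
        using that A(2) l by simp
      then show ?thesis
        unfolding ab(2) by (intro image_eqI[of _ _ i]) auto
    qed
    show "\<nexists>c. [:a, b:] = [:c:]"
      using ab(1) by simp
  qed
  moreover have "W A 1 \<le> l"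
    using W_le[OF A(1), of 1] l by simp
  ultimately have W1: "W A 1 = l"
    by simp
  have "(MAX s\<in>{1..d}. int (d div s) * (int (W A s) - int s)) = int d * (int l - 1)"
  proof (rule Max_eqI)
    fix y assume "y \<in> (\<lambda>s. int (d div s) * (int (W A s) - int s)) ` {1..d}"
    then obtain s where s: "y = int (d div s) * (int (W A s) - int s)"
      by blast
    have "int (W A s) \<le> int s * int l"
      using W_le[OF A(1), of s] l by (metis of_nat_le_iff of_nat_mult)
    then have "y \<le> int (d div s) * (int s * (int l - 1))"
      unfolding s by (intro mult_left_mono) (simp_all add: algebra_simps)
    also have "\<dots> = int (d div s * s) * (int l - 1)"
      by simp
    also have "\<dots> \<le> int d * (int l - 1)"
    proof (rule mult_right_mono)
      show "int (d div s * s) \<le> int d"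
        by (simp only: of_nat_le_iff div_times_less_eq_dividend)
      show "0 \<le> int l - 1"
        using A(2) l by simp
    qed
    finally show "y \<le> int d * (int l - 1)" .
  next
    show "int d * (int l - 1) \<in> (\<lambda>s. int (d div s) * (int (W A s) - int s)) ` {1..d}"
      using d W1 by (intro image_eqI[of _ _ 1]) auto
  qed simp
  then show ?thesis
    unfolding k_bound_def l by (simp add: algebra_simps)
qed

theorem theorem1p2:
  fixes A :: "real set" and d :: nat
  assumes "finite A" and "card A \<ge> 2" and "d \<ge> 1"
  shows "(arithmetic_progression A \<longrightarrow> k_bound A d = int (card A * d)) \<and>
    (\<exists>m :: nat. \<forall>k :: nat. int k \<ge> k_bound A d \<longrightarrow>
        (\<forall>n\<ge>2 * k. \<forall>f :: (nat \<Rightarrow> nat) \<Rightarrow> real.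
           valued_on_slice n k A f \<and> has_degree_on_slice n k d f \<longrightarrow> junta_on_slice n k m f)) \<and>
    (\<forall>k :: nat. 1 \<le> k \<and> int k < k_bound A d \<longrightarrow>
        (\<forall>m :: nat. \<exists>n\<ge>2 * k. \<exists>f :: (nat \<Rightarrow> nat) \<Rightarrow> real.
           valued_on_slice n k A f \<and> has_degree_on_slice n k d f \<and> \<not> junta_on_slice n k m f))"
  using k_bound_arithmetic_progression[OF assms] juntas_above_threshold[OF assms]
    non_juntas_below_threshold[OF assms] by blast

end
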